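(* The cell class $\mathcal{G}_\xi$ is concentrated.
   Context: For a permutation class $\mathcal{C}$, $\operatorname{gr}(\mathcal{C})=\lim_{n\to\infty}\sqrt[n]{|\mathcal{C}_n|}$ is its growth rate. For a permutation $\pi$, $\operatorname{Sub}(\pi)$ is the class of all permutations contained in $\pi$; $\bigoplus\operatorname{Sub}(\pi)$ is its sum closure (smallest class containing it closed under sums), and the skew closure of $\operatorname{Sub}(\pi)$ is the smallest class containing it closed under skew sums. For real $\gamma$, $\mathcal{G}_\gamma=\{\pi : \operatorname{gr}(\bigoplus\operatorname{Sub}(\pi))<\gamma \text{ or } \operatorname{gr}(\text{skew closure of }\operatorname{Sub}(\pi))<\gamma\}$, and $\xi\approx 2.30522$ is the unique positive root of $x^5-2x^4-x^2-x-1$. A permutation $\pi$ is $(q,r)$-concentrated if for every horizontal or vertical line $L$ through its plot (not passing through entries), all but at most $r$ entries of $\pi$ can be covered by $q$ pairwise independent axis-parallel rectangles not intersecting $L$ (two rectangles are independent if both their $x$- and $y$-projections are disjoint). A set of permutations is concentrated if all its members are $(q,r)$-concentrated for some fixed $q,r$. *)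

theory Defs
  imports
    "HOL-Analysis.Analysis"
    "HOL-Combinatorics.Multiset_Permutations"
    "HOL-Library.Sublist"
begin

(* A permutation of length n is the list of its values, a rearrangement of 1, ..., n.
   The empty permutation is included. *)
definition perms :: "nat list set" where
  "perms = (\<Union>n. permutations_of_set {1..n})"

definition order_isomorphic :: "nat list \<Rightarrow> nat list \<Rightarrow> bool" where
  "order_isomorphic xs ys \<longleftrightarrow> length xs = length ys \<and>
     (\<forall>i<length xs. \<forall>j<length xs. xs ! i < xs ! j \<longleftrightarrow> ys ! i < ys ! j)"

(* Here subseq is the not necessarily contiguous sublist relation on lists. *)
definition contained_in :: "nat list \<Rightarrow> nat list \<Rightarrow> bool" where
  "contained_in \<sigma> \<pi> \<longleftrightarrow> (\<exists>ys. subseq ys \<pi> \<and> order_isomorphic \<sigma> ys)"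

definition perm_class :: "nat list set \<Rightarrow> bool" where
  "perm_class C \<longleftrightarrow> C \<subseteq> perms \<and>
     (\<forall>\<pi>\<in>C. \<forall>\<sigma>\<in>perms. contained_in \<sigma> \<pi> \<longrightarrow> \<sigma> \<in> C)"

definition Sub :: "nat list \<Rightarrow> nat list set" where
  "Sub \<pi> = {\<sigma> \<in> perms. contained_in \<sigma> \<pi>}"

definition direct_sum :: "nat list \<Rightarrow> nat list \<Rightarrow> nat list" where
  "direct_sum \<sigma> \<tau> = \<sigma> @ map (\<lambda>v. v + length \<sigma>) \<tau>"

definition skew_sum :: "nat list \<Rightarrow> nat list \<Rightarrow> nat list" where
  "skew_sum \<sigma> \<tau> = map (\<lambda>v. v + length \<tau>) \<sigma> @ \<tau>"

definition sum_closure :: "nat list set \<Rightarrow> nat list set" where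
  "sum_closure X =
     \<Inter> {C. perm_class C \<and> X \<subseteq> C \<and> (\<forall>\<sigma>\<in>C. \<forall>\<tau>\<in>C. direct_sum \<sigma> \<tau> \<in> C)}"

definition skew_closure :: "nat list set \<Rightarrow> nat list set" where
  "skew_closure X =
     \<Inter> {C. perm_class C \<and> X \<subseteq> C \<and> (\<forall>\<sigma>\<in>C. \<forall>\<tau>\<in>C. skew_sum \<sigma> \<tau> \<in> C)}"

(* The value is meaningful only if the limit exists and is finite. This is the case for the
   sum and skew closures of Sub \<pi>: their counting sequences are supermultiplicative and
   exponentially bounded. *)
definition growth_rate :: "nat list set \<Rightarrow> real" where
  "growth_rate C = lim (\<lambda>n. root n (real (card {\<pi> \<in> C. length \<pi> = n})))"

definition cell_class :: "real \<Rightarrow> nat list set" where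
  "cell_class \<gamma> = {\<pi> \<in> perms.
     growth_rate (sum_closure (Sub \<pi>)) < \<gamma> \<or> growth_rate (skew_closure (Sub \<pi>)) < \<gamma>}"

definition xi :: real where
  "xi = (THE x. x > 0 \<and> x^5 - 2 * x^4 - x^2 - x - 1 = 0)"

(* List positions start at 0, plot positions at 1. *)
definition plot :: "nat list \<Rightarrow> (real \<times> real) set" where
  "plot \<pi> = {(real (i + 1), real (\<pi> ! i)) | i. i < length \<pi>}"

definition axis_line :: "(real \<times> real) set \<Rightarrow> bool" where
  "axis_line L \<longleftrightarrow> (\<exists>c. L = {c} \<times> UNIV \<or> L = UNIV \<times> {c})"

(* A line passes through the plot if it meets the bounding square of the entries. *)
definition cutting_line :: "nat list \<Rightarrow> (real \<times> real) set \<Rightarrow> bool" where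
  "cutting_line \<pi> L \<longleftrightarrow> axis_line L \<and>
     L \<inter> cbox (1, 1) (real (length \<pi>), real (length \<pi>)) \<noteq> {} \<and> L \<inter> plot \<pi> = {}"

(* Rectangles are closed and nonempty; as with rectangular hulls of sets of entries, they may
   degenerate to segments or points. *)
definition rectangle :: "(real \<times> real) set \<Rightarrow> bool" where
  "rectangle R \<longleftrightarrow> (\<exists>a b c d. a \<le> b \<and> c \<le> d \<and> R = {a..b} \<times> {c..d})"

definition independent_rects :: "(real \<times> real) set \<Rightarrow> (real \<times> real) set \<Rightarrow> bool" where
  "independent_rects R S \<longleftrightarrow> fst ` R \<inter> fst ` S = {} \<and> snd ` R \<inter> snd ` S = {}"

definition qr_concentrated :: "nat \<Rightarrow> nat \<Rightarrow> nat list \<Rightarrow> bool" where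
  "qr_concentrated q r \<pi> \<longleftrightarrow> (\<forall>L. cutting_line \<pi> L \<longrightarrow>
     (\<exists>R :: nat \<Rightarrow> (real \<times> real) set.
        (\<forall>i<q. rectangle (R i) \<and> R i \<inter> L = {}) \<and>
        (\<forall>i<q. \<forall>j<q. i \<noteq> j \<longrightarrow> independent_rects (R i) (R j)) \<and>
        card (plot \<pi> - (\<Union>i<q. R i)) \<le> r))"

definition concentrated :: "nat list set \<Rightarrow> bool" where
  "concentrated X \<longleftrightarrow> (\<exists>q r. \<forall>\<pi>\<in>X. qr_concentrated q r \<pi>)"

end

theory Submission
  imports Defs "HOL-Library.Ramsey"
begin

text \<open>
  If \<open>s n\<close> is the number of sum-indecomposable permutations of length \<open>n\<close> contained in \<open>\<pi>\<close>, then the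
  growth rate of the sum closure of \<open>Sub \<pi>\<close> is the number \<open>x\<close> with \<open>(\<Sum>n. s n / x ^ n) = 1\<close>. Hence, up to
  reversal, a member of the cell class has \<open>(\<Sum>n. s n / xi ^ n) < 1\<close>, which excludes every
  permutation with too many short sum-indecomposable patterns. Three consequences are used.
  First, the points north-west of a given point are monotone up to boundedly many exceptions.
  Second, two monotone sets separated by a line interleave only boundedly often along it.
  Third, \<open>\<pi>\<close> cannot contain an increasing oscillation of length 6 together with large monotone sets
  attached to it in both directions.

  Let \<open>L\<close> be a vertical line, and \<open>y\<close> the highest point to its left. The points right of \<open>L\<close> and
  below \<open>y\<close> are almost monotone and interleave (vertically) with the points left of \<open>L\<close>. Those of the
  latter which lie above the lowest such point are again almost monotone and interleave
  (horizontally) with the remaining ones, and so on: this builds a chain of monotone links going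
  south-west, each interacting only with its two neighbours, and similarly one going north-east. By
  the third fact one of the first five links of a chain is small, and removing it stops the chain.
  By the second fact boundedly many cuts make the links independent, and monotonicity makes the
  pieces of one link independent of each other.
\<close>

section \<open>Patterns of planar point sets\<close>

text \<open>With t = 1/x, multiplying t + t^2 + 2 t^3 + 3 t^4 + 4 t^5 + 4 t^6 + ... = 1 by 1 - t
  gives 2 t + t^3 + t^4 + t^5 = 1, which is the equation of \<open>xi\<close>. So \<open>xi\<close>
  belongs to the counts 1, 1, 2, 3, 4, 4, 4, ... of sum-indecomposables by length, and each
  exclusion exhibits finitely many patterns that just outweigh them. For the oscillation with two
  increasing sets the counts are 1, 1, 2, 4, 4, 2, of weight about 1.001. Such margins fix the block
  sizes 6 and 5 used below. Permutations are replaced by finite sets with two real coordinate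
  functions. Passing to a subset, exchanging the coordinates or turning by 180 degrees then requires
  no renumbering, and each direction is treated once. Lightness survives these symmetries but no
  reflection in an axis, so the skew case enters only at the end. The bounds come from Ramsey's
  theorem and are not explicit. What matters is that they precede the quantifiers over the point set
  and its coordinates.\<close>

lemma perms_iff: "\<sigma> \<in> perms \<longleftrightarrow> distinct \<sigma> \<and> set \<sigma> = {1..length \<sigma>}"
proof
  assume "\<sigma> \<in> perms"
  then obtain n where n: "set \<sigma> = {1..n}" "distinct \<sigma>"
    by (auto simp: perms_def permutations_of_set_def)
  then have "length \<sigma> = n" using distinct_card[of \<sigma>] by simp
  then show "distinct \<sigma> \<and> set \<sigma> = {1..length \<sigma>}" using n by simp
next
  assume "distinct \<sigma> \<and> set \<sigma> = {1..length \<sigma>}"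
  then show "\<sigma> \<in> perms"
    unfolding perms_def by (intro UN_I[of "length \<sigma>"]) (auto intro: permutations_of_setI)
qed

lemma perms_bij: "\<sigma> \<in> perms \<Longrightarrow> bij_betw ((!) \<sigma>) {..<length \<sigma>} {1..length \<sigma>}"
  by (metis perms_iff bij_betw_nth)

lemma perms_nth_bounds:
  assumes "\<sigma> \<in> perms" "i < length \<sigma>"
  shows "1 \<le> \<sigma> ! i" "\<sigma> ! i \<le> length \<sigma>"
  using perms_bij[OF assms(1)] assms(2) by (auto simp: bij_betw_def)

lemma perms_nth_eq_iff:
  assumes "\<sigma> \<in> perms" "i < length \<sigma>" "j < length \<sigma>"
  shows "\<sigma> ! i = \<sigma> ! j \<longleftrightarrow> i = j"
  using assms by (simp add: perms_iff nth_eq_iff_index_eq)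

section \<open>Sum-indecomposable patterns and their total weight\<close>

definition indec :: "nat list \<Rightarrow> bool" where
  "indec \<sigma> \<longleftrightarrow> \<sigma> \<in> perms \<and> \<sigma> \<noteq> [] \<and>
     (\<forall>k. 0 < k \<and> k < length \<sigma> \<longrightarrow> set (take k \<sigma>) \<noteq> {1..k})"

lemma indec_perms: "indec \<sigma> \<Longrightarrow> \<sigma> \<in> perms"
  by (simp add: indec_def)

definition has_pattern :: "'a set \<Rightarrow> ('a \<Rightarrow> real) \<Rightarrow> ('a \<Rightarrow> real) \<Rightarrow> nat list \<Rightarrow> bool" where
  "has_pattern P X Y \<sigma> \<longleftrightarrow> (\<exists>e. (\<forall>i<length \<sigma>. e i \<in> P) \<and>
     (\<forall>i<length \<sigma>. \<forall>j<length \<sigma>. (X (e i) < X (e j) \<longleftrightarrow> i < j) \<and>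
        (Y (e i) < Y (e j) \<longleftrightarrow> \<sigma> ! i < \<sigma> ! j)))"

text \<open>This says that the generating function of the sum-indecomposable patterns is below 1 at
  1/\<open>xi\<close>. Quantifying over finite families \<open>F\<close> avoids a separate proof
  that only finitely many patterns occur.\<close>

definition light :: "'a set \<Rightarrow> ('a \<Rightarrow> real) \<Rightarrow> ('a \<Rightarrow> real) \<Rightarrow> bool" where
  "light P X Y \<longleftrightarrow> (\<forall>F. finite F \<and> (\<forall>\<sigma>\<in>F. indec \<sigma> \<and> has_pattern P X Y \<sigma>) \<longrightarrow>
     (\<Sum>\<sigma>\<in>F. (1 / xi) ^ length \<sigma>) < 1)"

section \<open>Symmetries that preserve lightness\<close>

definition rev_compl :: "nat list \<Rightarrow> nat list" where
  "rev_compl \<sigma> = map (\<lambda>v. Suc (length \<sigma>) - v) (rev \<sigma>)"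

lemma length_rev_compl [simp]: "length (rev_compl \<sigma>) = length \<sigma>"
  by (simp add: rev_compl_def)

lemma rev_compl_nth: "i < length \<sigma> \<Longrightarrow> rev_compl \<sigma> ! i = Suc (length \<sigma>) - \<sigma> ! (length \<sigma> - Suc i)"
  by (simp add: rev_compl_def rev_nth)

lemma reflect_interval: "(\<lambda>v. Suc n - v) ` {a..b} = {Suc n - b..Suc n - a}"
  if "1 \<le> a" "b \<le> n" "a \<le> b"
proof safe
  fix v assume "v \<in> {Suc n - b..Suc n - a}"
  then show "v \<in> (\<lambda>v. Suc n - v) ` {a..b}"
    using that by (intro image_eqI[of _ _ "Suc n - v"]) auto
qed (use that in auto)

lemma rev_compl_perms:
  assumes "\<sigma> \<in> perms" shows "rev_compl \<sigma> \<in> perms"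
proof (cases "\<sigma> = []")
  case False
  have d: "distinct \<sigma>" and s: "set \<sigma> = {1..length \<sigma>}" using assms by (auto simp: perms_iff)
  have "set (rev_compl \<sigma>) = (\<lambda>v. Suc (length \<sigma>) - v) ` {1..length \<sigma>}" by (simp add: rev_compl_def s)
  also have "\<dots> = {1..length \<sigma>}" using False by (subst reflect_interval) (auto simp: Suc_le_eq)
  finally have "set (rev_compl \<sigma>) = {1..length (rev_compl \<sigma>)}" by simp
  then show ?thesis by (metis perms_iff card_distinct card_atLeastAtMost diff_Suc_1)
qed (use assms in \<open>simp add: rev_compl_def\<close>)

lemma rev_compl_rev_compl: "\<sigma> \<in> perms \<Longrightarrow> rev_compl (rev_compl \<sigma>) = \<sigma>"
  by (intro nth_equalityI) (simp_all add: rev_compl_nth perms_nth_bounds(2) le_SucI)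

text \<open>A prefix of the reverse complement with values 1..k comes from the last k entries of
  \<open>\<sigma>\<close> carrying the k largest values. The remaining prefix of length n - k then
  has values 1..n-k, contrary to indecomposability.\<close>

lemma rev_compl_indec:
  assumes "indec \<sigma>" shows "indec (rev_compl \<sigma>)"
  unfolding indec_def
proof (intro conjI allI impI notI)
  let ?n = "length \<sigma>"
  have p: "\<sigma> \<in> perms" and ne: "\<sigma> \<noteq> []" using assms by (auto simp: indec_def)
  show "rev_compl \<sigma> \<in> perms" using p rev_compl_perms by blast
  show False if "rev_compl \<sigma> = []" using that ne by (simp add: rev_compl_def)
  fix k assume k: "0 < k \<and> k < length (rev_compl \<sigma>)" and eq: "set (take k (rev_compl \<sigma>)) = {1..k}"
  have "take k (rev_compl \<sigma>) = map (\<lambda>v. Suc ?n - v) (rev (drop (?n - k) \<sigma>))"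
    using k by (simp add: rev_compl_def take_map take_rev)
  then have 1: "(\<lambda>v. Suc ?n - v) ` set (drop (?n - k) \<sigma>) = {1..k}" using eq by simp
  have s: "set \<sigma> = {1..?n}" and d: "distinct \<sigma>" using p by (auto simp: perms_iff)
  have sub: "set (drop (?n - k) \<sigma>) \<subseteq> {1..?n}" using s set_drop_subset by fastforce
  have "set (drop (?n - k) \<sigma>) = (\<lambda>v. Suc ?n - v) ` (\<lambda>v. Suc ?n - v) ` set (drop (?n - k) \<sigma>)"
    using sub by (force simp: image_image image_iff subset_iff)
  also have "\<dots> = {Suc (?n - k)..?n}" unfolding 1 using k
    by (subst reflect_interval) auto
  finally have 2: "set (drop (?n - k) \<sigma>) = {Suc (?n - k)..?n}" .
  have "set (take (?n - k) \<sigma>) \<inter> set (drop (?n - k) \<sigma>) = {}"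
    using d by (simp add: set_take_disj_set_drop_if_distinct)
  moreover have "set (take (?n - k) \<sigma>) \<union> set (drop (?n - k) \<sigma>) = {1..?n}"
    using s by (metis append_take_drop_id set_append)
  ultimately have "set (take (?n - k) \<sigma>) = {1..?n} - {Suc (?n - k)..?n}"
    using 2 by blast
  also have "\<dots> = {1..?n - k}" by auto
  finally show False using assms k by (simp add: indec_def)
qed

lemma has_rev_compl:
  assumes "has_pattern P (\<lambda>p. - X p) (\<lambda>p. - Y p) \<sigma>" "\<sigma> \<in> perms"
  shows "has_pattern P X Y (rev_compl \<sigma>)"
proof -
  let ?n = "length \<sigma>"
  obtain e where e: "\<And>i. i < ?n \<Longrightarrow> e i \<in> P"
    "\<And>i j. i < ?n \<Longrightarrow> j < ?n \<Longrightarrow> (X (e j) < X (e i) \<longleftrightarrow> i < j) \<and> (Y (e j) < Y (e i) \<longleftrightarrow> \<sigma> ! i < \<sigma> ! j)"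
    using assms(1) unfolding has_pattern_def by auto
  have "(X (e (?n - Suc i)) < X (e (?n - Suc j)) \<longleftrightarrow> i < j) \<and>
        (Y (e (?n - Suc i)) < Y (e (?n - Suc j)) \<longleftrightarrow> rev_compl \<sigma> ! i < rev_compl \<sigma> ! j)"
    if "i < ?n" "j < ?n" for i j
  proof -
    have b: "?n - Suc j < ?n" "?n - Suc i < ?n" using that by auto
    have "rev_compl \<sigma> ! i < rev_compl \<sigma> ! j \<longleftrightarrow> \<sigma> ! (?n - Suc j) < \<sigma> ! (?n - Suc i)"
      unfolding rev_compl_nth[OF that(1)] rev_compl_nth[OF that(2)]
      using perms_nth_bounds[OF assms(2) b(1)] perms_nth_bounds[OF assms(2) b(2)] by linarith
    moreover have "?n - Suc j < ?n - Suc i \<longleftrightarrow> i < j" using that by linarith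
    ultimately show ?thesis using e(2)[OF b] by simp
  qed
  then show ?thesis unfolding has_pattern_def using e(1)
    by (intro exI[of _ "\<lambda>i. e (?n - Suc i)"]) simp
qed

text \<open>The two shifts by \<open>Suc\<close> reconcile positions counted from 0 with values
  counted from 1.\<close>

definition perm_inverse :: "nat list \<Rightarrow> nat list" where
  "perm_inverse \<sigma> = map (\<lambda>v. Suc (inv_into {..<length \<sigma>} ((!) \<sigma>) (Suc v))) [0..<length \<sigma>]"

lemma length_perm_inverse [simp]: "length (perm_inverse \<sigma>) = length \<sigma>"
  by (simp add: perm_inverse_def)

lemma perm_inverse_nth: "v < length \<sigma> \<Longrightarrow> perm_inverse \<sigma> ! v = Suc (inv_into {..<length \<sigma>} ((!) \<sigma>) (Suc v))"
  by (simp add: perm_inverse_def)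

lemma perm_inverse_nth_iff:
  assumes "\<sigma> \<in> perms" "v < length \<sigma>" "i < length \<sigma>"
  shows "perm_inverse \<sigma> ! v = Suc i \<longleftrightarrow> \<sigma> ! i = Suc v"
  using perms_bij[OF assms(1)] assms(2,3)
  by (metis Suc_leI Suc_inject atLeastAtMost_iff bij_betw_inv_into_left bij_betw_inv_into_right
      perm_inverse_nth lessThan_iff le_add1 plus_1_eq_Suc)

lemma perm_inverse_obtain:
  assumes "\<sigma> \<in> perms" "v < length \<sigma>"
  obtains i where "i < length \<sigma>" "\<sigma> ! i = Suc v" "perm_inverse \<sigma> ! v = Suc i"
proof -
  have "Suc v \<in> (!) \<sigma> ` {..<length \<sigma>}"
    using perms_bij[OF assms(1)] assms(2) by (auto simp: bij_betw_def)
  then obtain i where "i < length \<sigma>" "\<sigma> ! i = Suc v" by auto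
  then show thesis using that perm_inverse_nth_iff assms by blast
qed

lemma perm_inverse_perms:
  assumes "\<sigma> \<in> perms" shows "perm_inverse \<sigma> \<in> perms"
proof -
  let ?n = "length \<sigma>"
  have "set (perm_inverse \<sigma>) = {1..?n}"
  proof (intro set_eqI iffI)
    fix x assume "x \<in> set (perm_inverse \<sigma>)"
    then obtain v where "v < ?n" "perm_inverse \<sigma> ! v = x" by (auto simp: in_set_conv_nth)
    then show "x \<in> {1..?n}" using perm_inverse_obtain[OF assms] by (metis Suc_le_eq atLeastAtMost_iff le_add1 plus_1_eq_Suc)
  next
    fix x assume x: "x \<in> {1..?n}"
    then have "x - 1 < ?n" by auto
    then have "1 \<le> \<sigma> ! (x - 1)" "\<sigma> ! (x - 1) \<le> ?n" using perms_nth_bounds[OF assms] by auto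
    then have "\<sigma> ! (x - 1) - 1 < ?n" "perm_inverse \<sigma> ! (\<sigma> ! (x - 1) - 1) = Suc (x - 1)"
      using perm_inverse_nth_iff[OF assms, of "\<sigma> ! (x - 1) - 1" "x - 1"] \<open>x - 1 < ?n\<close> by auto
    then show "x \<in> set (perm_inverse \<sigma>)" using x by (metis Suc_pred' atLeastAtMost_iff in_set_conv_nth length_perm_inverse less_eq_Suc_le One_nat_def)
  qed
  then show ?thesis by (metis perms_iff card_distinct card_atLeastAtMost diff_Suc_1 length_perm_inverse)
qed

lemma perm_inverse_perm_inverse:
  assumes "\<sigma> \<in> perms" shows "perm_inverse (perm_inverse \<sigma>) = \<sigma>"
proof (intro nth_equalityI)
  fix i assume "i < length (perm_inverse (perm_inverse \<sigma>))"
  then have i: "i < length \<sigma>" by simp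
  obtain j where "j < length \<sigma>" "perm_inverse \<sigma> ! j = Suc i" "perm_inverse (perm_inverse \<sigma>) ! i = Suc j"
    using perm_inverse_obtain[OF perm_inverse_perms[OF assms], of i] i by auto
  then show "perm_inverse (perm_inverse \<sigma>) ! i = \<sigma> ! i" using perm_inverse_nth_iff[OF assms] i by metis
qed simp

lemma take_perm_inverse_interval:
  assumes "\<sigma> \<in> perms" "k \<le> length \<sigma>" "set (take k \<sigma>) = {1..k}"
  shows "set (take k (perm_inverse \<sigma>)) = {1..k}"
proof (intro card_subset_eq)
  show "set (take k (perm_inverse \<sigma>)) \<subseteq> {1..k}"
  proof
    fix x assume "x \<in> set (take k (perm_inverse \<sigma>))"
    then obtain v where v: "v < k" "perm_inverse \<sigma> ! v = x" using assms(2) by (auto simp: in_set_conv_nth)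
    obtain i where i: "i < length \<sigma>" "\<sigma> ! i = Suc v" "x = Suc i"
      using perm_inverse_obtain[OF assms(1), of v] v assms(2) by auto
    have "Suc v \<in> set (take k \<sigma>)" using assms(3) v by auto
    then obtain j where "j < k" "\<sigma> ! j = Suc v" using assms(2) by (auto simp: in_set_conv_nth)
    then have "i = j" using i perms_nth_eq_iff[OF assms(1), of i j] assms(2) by simp
    then show "x \<in> {1..k}" using i \<open>j < k\<close> by auto
  qed
  have "distinct (take k (perm_inverse \<sigma>))" using perm_inverse_perms[OF assms(1)] by (simp add: perms_iff)
  then show "card (set (take k (perm_inverse \<sigma>))) = card {1..k}" using assms(2) by (simp add: distinct_card)
qed simp

lemma perm_inverse_indec:
  assumes "indec \<sigma>" shows "indec (perm_inverse \<sigma>)"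
  unfolding indec_def
proof (intro conjI allI impI notI)
  have p: "\<sigma> \<in> perms" and ne: "\<sigma> \<noteq> []" using assms by (auto simp: indec_def)
  show "perm_inverse \<sigma> \<in> perms" using p perm_inverse_perms by blast
  show False if "perm_inverse \<sigma> = []" using that ne by (simp add: perm_inverse_def)
  fix k assume "0 < k \<and> k < length (perm_inverse \<sigma>)" "set (take k (perm_inverse \<sigma>)) = {1..k}"
  then show False
    using take_perm_inverse_interval[OF perm_inverse_perms[OF p], of k] assms perm_inverse_perm_inverse[OF p] by (auto simp: indec_def)
qed

lemma has_perm_inverse:
  assumes "has_pattern P Y X \<sigma>" "\<sigma> \<in> perms"
  shows "has_pattern P X Y (perm_inverse \<sigma>)"
proof -
  let ?n = "length \<sigma>"
  obtain e where e: "\<And>i. i < ?n \<Longrightarrow> e i \<in> P"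
    "\<And>i j. i < ?n \<Longrightarrow> j < ?n \<Longrightarrow> (Y (e i) < Y (e j) \<longleftrightarrow> i < j) \<and> (X (e i) < X (e j) \<longleftrightarrow> \<sigma> ! i < \<sigma> ! j)"
    using assms(1) unfolding has_pattern_def by auto
  define f where "f v = e (perm_inverse \<sigma> ! v - 1)" for v
  have "f v \<in> P" if "v < ?n" for v
    using perm_inverse_obtain[OF assms(2) that] e(1) by (metis f_def diff_Suc_1)
  moreover have "(X (f v) < X (f w) \<longleftrightarrow> v < w) \<and> (Y (f v) < Y (f w) \<longleftrightarrow> perm_inverse \<sigma> ! v < perm_inverse \<sigma> ! w)"
    if vw: "v < ?n" "w < ?n" for v w
  proof -
    obtain i where i: "i < ?n" "\<sigma> ! i = Suc v" "perm_inverse \<sigma> ! v = Suc i"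
      using perm_inverse_obtain[OF assms(2) vw(1)] by blast
    obtain j where j: "j < ?n" "\<sigma> ! j = Suc w" "perm_inverse \<sigma> ! w = Suc j"
      using perm_inverse_obtain[OF assms(2) vw(2)] by blast
    show ?thesis using e(2)[OF i(1) j(1)] i j by (simp add: f_def)
  qed
  ultimately show ?thesis unfolding has_pattern_def by (intro exI[of _ f]) simp
qed

text \<open>As an involution, \<open>t\<close> is injective on the given family, and it preserves
  lengths. It therefore carries a family of patterns in the new coordinates to one of equal weight
  in the old ones.\<close>

lemma light_transfer:
  assumes "light P X Y"
    and "\<And>\<sigma>. indec \<sigma> \<Longrightarrow> has_pattern P X' Y' \<sigma> \<Longrightarrow> indec (t \<sigma>) \<and> has_pattern P X Y (t \<sigma>) \<and> length (t \<sigma>) = length \<sigma> \<and> t (t \<sigma>) = \<sigma>"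
  shows "light P X' Y'"
  unfolding light_def
proof (intro allI impI)
  fix F assume F: "finite F \<and> (\<forall>\<sigma>\<in>F. indec \<sigma> \<and> has_pattern P X' Y' \<sigma>)"
  have inj: "inj_on t F" using F assms(2) by (metis inj_on_def)
  have "(\<Sum>\<sigma>\<in>F. (1 / xi) ^ length \<sigma>) = (\<Sum>\<sigma>\<in>F. (1 / xi) ^ length (t \<sigma>))"
    using F assms(2) by (intro sum.cong) auto
  also have "\<dots> = (\<Sum>\<sigma>\<in>t ` F. (1 / xi) ^ length \<sigma>)" using inj by (simp add: sum.reindex)
  also have "\<dots> < 1" using assms F unfolding light_def by (metis (no_types, lifting) finite_imageI imageE)
  finally show "(\<Sum>\<sigma>\<in>F. (1 / xi) ^ length \<sigma>) < 1" .
qed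

text \<open>Exchanging the coordinates inverts patterns, and a half turn (next lemma)
  reverse-complements them. Both keep sum-indecomposability, whereas a reflection in one axis would
  turn it into skew-indecomposability.\<close>

lemma light_swap: "light P X Y \<Longrightarrow> light P Y X"
  by (erule light_transfer[where t = perm_inverse])
    (simp add: has_perm_inverse perm_inverse_indec perm_inverse_perm_inverse indec_perms)

lemma light_rotate: "light P X Y \<Longrightarrow> light P (\<lambda>p. - X p) (\<lambda>p. - Y p)"
  by (erule light_transfer[where t = rev_compl])
    (simp add: has_rev_compl rev_compl_indec rev_compl_rev_compl indec_perms)

text \<open>The weights are powers of 1/\<open>xi\<close>, so lower bounds on weights call for an
  upper bound on \<open>xi\<close>; 2.306 is a short rational just above 2.30522. Uniqueness of the
  root is proved because \<open>xi\<close> is a definite description.\<close>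

lemma xi_pos: "xi > 0" and xi_le: "xi \<le> 1153 / 500"
proof -
  let ?p = "\<lambda>x::real. x^5 - 2 * x^4 - x^2 - x - 1"
  obtain r where r: "r \<ge> 2" "r \<le> 1153/500" "?p r = 0"
  proof -
    have "continuous_on {2..1153/500} ?p" by (intro continuous_intros)
    moreover have "?p 2 \<le> 0" by simp
    moreover have "0 \<le> ?p (1153/500)" by (simp add: power_divide)
    ultimately show thesis using IVT'[of ?p 2 0 "1153/500"] that by auto
  qed
  \<comment> \<open>The polynomial p is not monotone on the positive reals, but p(x)/x^5 = 1 - 2/x -
    1/x^3 - 1/x^4 - 1/x^5 is strictly increasing. The identity below is this fact with denominators
    cleared.\<close>
  have less: False if x: "0 < x" "?p x = 0" and y: "x < y" "?p y = 0" for x y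
  proof -
    have "y^5 * ?p x - x^5 * ?p y =
        - (2 * x^4 * y^4 * (y - x) + x^2 * y^2 * (y^3 - x^3) + x * y * (y^4 - x^4) + (y^5 - x^5))"
      by (simp add: algebra_simps eval_nat_numeral)
    then have "2 * x^4 * y^4 * (y - x) + x^2 * y^2 * (y^3 - x^3) + x * y * (y^4 - x^4) + (y^5 - x^5) = 0"
      unfolding x(2) y(2) by simp
    moreover have "x^n < y^n" if "0 < n" for n
      using x(1) y(1) that by (intro power_strict_mono) auto
    then have "x^3 < y^3" "x^4 < y^4" "x^5 < y^5" by auto
    then have "0 < 2 * x^4 * y^4 * (y - x)" "0 < x^2 * y^2 * (y^3 - x^3)"
        "0 < x * y * (y^4 - x^4)" "0 < y^5 - x^5" using x(1) y(1) by auto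
    ultimately show False by linarith
  qed
  have uniq: "x = y" if "0 < x" "?p x = 0" "0 < y" "?p y = 0" for x y
    using less[of x y] less[of y x] that by (meson linorder_neqE)
  have "\<exists>!x. x > 0 \<and> ?p x = 0" using r uniq by (intro ex1I[of _ r]) auto
  from theI'[OF this] have xi: "xi > 0 \<and> ?p xi = 0" by (simp add: xi_def)
  then show "xi > 0" ..
  show "xi \<le> 1153 / 500" using xi r uniq[of xi r] by simp
qed

section \<open>Checking total weights by integer computation\<close>

definition standardize :: "nat list \<Rightarrow> nat list" where
  "standardize ys = map (\<lambda>v. length (filter (\<lambda>w. w \<le> v) ys)) ys"

definition selected_patterns :: "nat list \<times> nat list list \<Rightarrow> nat list list" where
  "selected_patterns c = map (\<lambda>js. standardize (map ((!) (fst c)) js)) (snd c)"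

text \<open>An executable test: a prefix of length k of a permutation differs from 1..k exactly when
  it contains a value above k.\<close>

definition is_indec :: "nat list \<Rightarrow> bool" where
  "is_indec \<sigma> \<longleftrightarrow> \<sigma> \<noteq> [] \<and> distinct \<sigma> \<and> list_all (\<lambda>v. 1 \<le> v \<and> v \<le> length \<sigma>) \<sigma> \<and>
     list_all (\<lambda>k. list_ex (\<lambda>v. k < v) (take k \<sigma>)) [1..<length \<sigma>]"

text \<open>An entry \<open>(\<tau>, jss)\<close> lists index sequences selecting pairwise non-isomorphic sum-indecomposable
  patterns of \<open>\<tau>\<close>. The last condition says that the patterns have total weight at least 1 if \<open>xi\<close> is
  replaced by its upper bound \<open>1153 / 500\<close>, cleared of denominators.\<close>

definition cert :: "(nat list \<times> nat list list) list \<Rightarrow> bool" where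
  "cert cs \<longleftrightarrow>
     list_all (\<lambda>c. list_all (\<lambda>js. sorted_wrt (<) js \<and> list_all (\<lambda>j. j < length (fst c)) js) (snd c)) cs \<and>
     (let ss = concat (map selected_patterns cs) in distinct ss \<and> list_all is_indec ss \<and>
       list_all (\<lambda>s. length s \<le> 7) ss \<and>
       (1153::int) ^ 7 \<le> sum_list (map (\<lambda>s. 500 ^ length s * 1153 ^ (7 - length s)) ss))"

lemma is_indec: "is_indec \<sigma> \<Longrightarrow> indec \<sigma>"
proof -
  assume a: "is_indec \<sigma>"
  then have d: "distinct \<sigma>" and s: "set \<sigma> \<subseteq> {1..length \<sigma>}"
    by (auto simp: is_indec_def list_all_iff)
  have "set \<sigma> = {1..length \<sigma>}" using s d by (intro card_subset_eq) (auto simp: distinct_card)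
  moreover have "set (take k \<sigma>) \<noteq> {1..k}" if "0 < k \<and> k < length \<sigma>" for k
  proof -
    have "\<exists>v\<in>set (take k \<sigma>). k < v" using a that
      by (simp add: is_indec_def list_all_iff list_ex_iff)
    then show ?thesis by (metis atLeastAtMost_iff not_le)
  qed
  ultimately show "indec \<sigma>" using a d by (auto simp: indec_def perms_iff is_indec_def)
qed

lemma has_sub:
  assumes "has_pattern P X Y \<tau>" "sorted_wrt (<) js" "\<And>j. j \<in> set js \<Longrightarrow> j < length \<tau>" "length \<sigma> = length js"
    "\<And>i j. i < length js \<Longrightarrow> j < length js \<Longrightarrow> \<sigma> ! i < \<sigma> ! j \<longleftrightarrow> \<tau> ! (js ! i) < \<tau> ! (js ! j)"
  shows "has_pattern P X Y \<sigma>"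
proof -
  obtain e where e: "\<And>i. i < length \<tau> \<Longrightarrow> e i \<in> P"
    "\<And>i j. i < length \<tau> \<Longrightarrow> j < length \<tau> \<Longrightarrow> (X (e i) < X (e j) \<longleftrightarrow> i < j) \<and> (Y (e i) < Y (e j) \<longleftrightarrow> \<tau> ! i < \<tau> ! j)"
    using assms(1) unfolding has_pattern_def by blast
  have "js ! i < js ! j \<longleftrightarrow> i < j" if "i < length js" "j < length js" for i j
    using sorted_wrt_nth_less[OF assms(2)] that by (metis linorder_neqE_nat order_less_asym)
  then show ?thesis unfolding has_pattern_def
    using e assms(3-5) by (intro exI[of _ "\<lambda>i. e (js ! i)"]) simp
qed

lemma standardize_less_iff:
  assumes "i < length ys" "j < length ys"
  shows "standardize ys ! i < standardize ys ! j \<longleftrightarrow> ys ! i < ys ! j"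
proof -
  have le: "length (filter (\<lambda>w. w \<le> u) ys) \<le> length (filter (\<lambda>w. w \<le> v) ys)" if "u \<le> v" for u v
    using that by (induction ys) auto
  have "length (filter (\<lambda>w. w \<le> u) zs) < length (filter (\<lambda>w. w \<le> v) zs)"
    if "u < v" "v \<in> set zs" for u v :: nat and zs
    using that
  proof (induction zs)
    case (Cons z zs)
    have le: "length (filter (\<lambda>w. w \<le> u) zs) \<le> length (filter (\<lambda>w. w \<le> v) zs)"
      using Cons.prems(1) by (induction zs) auto
    show ?case using Cons le by (cases "v \<in> set zs") auto
  qed simp
  then show ?thesis using le assms unfolding standardize_def by (simp add: not_le[symmetric]) (meson leD leI nth_mem)
qed

text \<open>Patterns selected from several contained permutations are pooled. Distinctness is
  checked over the whole pool, so the pool is a single family \<open>F\<close> for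
  \<open>light\<close>.\<close>

lemma cert_contradiction:
  assumes "light P X Y" "\<And>c. c \<in> set cs \<Longrightarrow> has_pattern P X Y (fst c)" "cert cs"
  shows False
proof -
  define ss where "ss = concat (map selected_patterns cs)"
  have ss: "distinct ss" "\<And>s. s \<in> set ss \<Longrightarrow> is_indec s" "\<And>s. s \<in> set ss \<Longrightarrow> length s \<le> 7"
    "(1153::int) ^ 7 \<le> sum_list (map (\<lambda>s. 500 ^ length s * 1153 ^ (7 - length s)) ss)"
    using assms(3) unfolding cert_def ss_def[symmetric] by (auto simp: Let_def list_all_iff)
  have "has_pattern P X Y s" if s: "s \<in> set ss" for s
  proof -
    obtain c js where c: "c \<in> set cs" "js \<in> set (snd c)" "s = standardize (map ((!) (fst c)) js)"
      using s by (auto simp: ss_def selected_patterns_def)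
    have js: "sorted_wrt (<) js" "\<And>j. j \<in> set js \<Longrightarrow> j < length (fst c)"
      using assms(3) c(1,2) by (auto simp: cert_def list_all_iff)
    show ?thesis
    proof (rule has_sub[OF assms(2)[OF c(1)] js])
      fix i j assume "i < length js" "j < length js"
      then show "s ! i < s ! j \<longleftrightarrow> fst c ! (js ! i) < fst c ! (js ! j)"
        unfolding c(3) by (subst standardize_less_iff) auto
    qed (simp_all add: c(3) standardize_def)
  qed
  then have "(\<Sum>\<sigma>\<in>set ss. (1 / xi) ^ length \<sigma>) < 1"
    using assms(1) ss(2) is_indec unfolding light_def by blast
  moreover have "(\<Sum>\<sigma>\<in>set ss. (1 / xi) ^ length \<sigma>) \<ge> (\<Sum>\<sigma>\<in>set ss. (500 / 1153) ^ length \<sigma>)"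
    using xi_pos xi_le by (intro sum_mono power_mono) (auto simp: field_simps)
  moreover have "(\<Sum>\<sigma>\<in>set ss. (500 / 1153 :: real) ^ length \<sigma>) =
      (\<Sum>\<sigma>\<in>set ss. real_of_int (500 ^ length \<sigma> * 1153 ^ (7 - length \<sigma>))) / 1153 ^ 7"
    unfolding sum_divide_distrib
  proof (rule sum.cong)
    fix s assume "s \<in> set ss"
    then have "a ^ 7 = a ^ length s * a ^ (7 - length s)" for a :: real
      using ss(3) by (metis power_add le_add_diff_inverse)
    then have "b ^ length s * a ^ (7 - length s) / a ^ 7 = (b / a) ^ length s" if "a \<noteq> 0" for a b :: real
      using that by (simp add: power_divide)
    from this[of 1153 500] show "(500 / 1153) ^ length s = real_of_int (500 ^ length s * 1153 ^ (7 - length s)) / 1153 ^ 7"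
      by simp
  qed simp
  moreover have "(\<Sum>\<sigma>\<in>set ss. real_of_int (500 ^ length \<sigma> * 1153 ^ (7 - length \<sigma>))) \<ge> 1153 ^ 7"
  proof -
    have "(1153::int) ^ 7 \<le> (\<Sum>\<sigma>\<in>set ss. 500 ^ length \<sigma> * 1153 ^ (7 - length \<sigma>))"
      using ss(1,4) by (simp add: sum_list_distinct_conv_sum_set)
    then have "real_of_int (1153 ^ 7) \<le>
        real_of_int (\<Sum>\<sigma>\<in>set ss. 500 ^ length \<sigma> * 1153 ^ (7 - length \<sigma>))"
      by (simp only: of_int_le_iff)
    then show ?thesis by simp
  qed
  ultimately show False by simp
qed


section \<open>Certificates\<close>

text \<open>The counts for lengths 1 to 7 are 1, 1, 2, 3, 4, 5, 6, as in
  \<open>cert_dec_inc\<close>, \<open>cert_inc_skew_dec\<close> and \<open>cert_dec_dec\<close>. The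
  weight is about 1.003, and it would drop below 1 without the six patterns of length 7.\<close>

lemma cert_inc_dec:
  "cert [([2, 3, 4, 5, 6, 7, 13, 12, 11, 10, 9, 8, 1], [[0], [0, 12], [0, 1, 12], [6, 7, 8], [0, 1,
    2, 12], [0, 6, 7, 12], [6, 7, 8, 9], [0, 1, 2, 3, 12], [0, 1, 6, 7, 12], [0, 6, 7, 8, 12],
    [6, 7, 8, 9, 10], [0, 1, 2, 3, 4, 12], [0, 1, 2, 6, 7, 12], [0, 1, 6, 7, 8, 12], [0, 6, 7,
    8, 9, 12], [6, 7, 8, 9, 10, 11], [0, 1, 2, 3, 4, 5, 12], [0, 1, 2, 3, 6, 7, 12], [0, 1, 2,
    6, 7, 8, 12], [0, 1, 6, 7, 8, 9, 12], [0, 6, 7, 8, 9, 10, 12], [6, 7, 8, 9, 10, 11, 12]])]"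
  by code_simp

lemma cert_dec_inc:
  "cert [([7, 6, 5, 4, 3, 2, 8, 9, 10, 11, 12, 13, 1], [[0], [0, 1], [0, 6, 12], [0, 1, 2], [0, 6,
    7, 12], [0, 1, 6, 12], [0, 1, 2, 3], [0, 6, 7, 8, 12], [0, 1, 6, 7, 12], [0, 1, 2, 6, 12],
    [0, 1, 2, 3, 4], [0, 6, 7, 8, 9, 12], [0, 1, 6, 7, 8, 12], [0, 1, 2, 6, 7, 12], [0, 1, 2, 3,
    6, 12], [0, 1, 2, 3, 4, 5], [0, 6, 7, 8, 9, 10, 12], [0, 1, 6, 7, 8, 9, 12], [0, 1, 2, 6, 7,
    8, 12], [0, 1, 2, 3, 6, 7, 12], [0, 1, 2, 3, 4, 6, 12], [0, 1, 2, 3, 4, 5, 12]])]"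
  by code_simp

lemma cert_inc_skew_dec:
  "cert [([8, 9, 10, 11, 12, 13, 7, 6, 5, 4, 3, 2, 1], [[0], [0, 6], [0, 1, 6], [0, 6, 7], [0, 1, 2,
    6], [0, 1, 6, 7], [0, 6, 7, 8], [0, 1, 2, 3, 6], [0, 1, 2, 6, 7], [0, 1, 6, 7, 8], [0, 6, 7,
    8, 9], [0, 1, 2, 3, 4, 6], [0, 1, 2, 3, 6, 7], [0, 1, 2, 6, 7, 8], [0, 1, 6, 7, 8, 9], [0,
    6, 7, 8, 9, 10], [0, 1, 2, 3, 4, 5, 6], [0, 1, 2, 3, 4, 6, 7], [0, 1, 2, 3, 6, 7, 8], [0, 1,
    2, 6, 7, 8, 9], [0, 1, 6, 7, 8, 9, 10], [0, 6, 7, 8, 9, 10, 11]])]"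
  by code_simp

lemma cert_dec_skew_inc:
  "cert [([13, 12, 11, 10, 9, 8, 2, 3, 4, 5, 6, 7, 1], [[0], [0, 1], [6, 7, 12], [0, 6, 7], [0, 1,
    2], [6, 7, 8, 12], [0, 6, 7, 8], [0, 6, 7, 12], [0, 1, 6, 7]])]"
  by code_simp

lemma cert_inc_skew_inc:
  "cert [([8, 9, 10, 11, 12, 13, 2, 3, 4, 5, 6, 7, 1], [[0], [0, 6], [0, 1, 6], [0, 6, 7], [0, 6,
    12], [0, 1, 2, 6], [0, 1, 6, 7], [0, 1, 6, 12], [0, 6, 7, 8]])]"
  by code_simp

lemma cert_dec_dec:
  "cert [([7, 6, 5, 4, 3, 2, 13, 12, 11, 10, 9, 8, 1], [[0], [0, 1], [0, 6, 12], [0, 1, 2], [0, 6,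
    7, 12], [0, 1, 6, 12], [0, 1, 2, 3], [0, 6, 7, 8, 12], [0, 1, 6, 7, 12], [0, 1, 2, 6, 12],
    [0, 1, 2, 3, 4], [0, 6, 7, 8, 9, 12], [0, 1, 6, 7, 8, 12], [0, 1, 2, 6, 7, 12], [0, 1, 2, 3,
    6, 12], [0, 1, 2, 3, 4, 5], [0, 6, 7, 8, 9, 10, 12], [0, 1, 6, 7, 8, 9, 12], [0, 1, 2, 6, 7,
    8, 12], [0, 1, 2, 3, 6, 7, 12], [0, 1, 2, 3, 4, 6, 12], [0, 1, 2, 3, 4, 5, 12]])]"
  by code_simp

text \<open>Counts 1, 1, 2, 3, 5, 5 for lengths 1 to 6, with total weight about 1.001.\<close>

lemma cert_21s:
  "cert [([3, 2, 5, 4, 7, 6, 9, 8, 11, 10, 13, 12, 1], [[0], [0, 1], [0, 2, 12], [0, 1, 12], [0, 2,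
    4, 12], [0, 2, 3, 12], [0, 1, 2, 12], [0, 2, 4, 6, 12], [0, 2, 4, 5, 12], [0, 2, 3, 4, 12],
    [0, 1, 2, 4, 12], [0, 1, 2, 3, 12], [0, 2, 4, 6, 8, 12], [0, 2, 4, 6, 7, 12], [0, 2, 4, 5,
    6, 12], [0, 2, 3, 4, 6, 12], [0, 2, 3, 4, 5, 12]])]"
  by code_simp

lemma cert_12s:
  "cert [([12, 13, 10, 11, 8, 9, 6, 7, 4, 5, 2, 3, 1], [[0], [0, 2], [0, 1, 2], [0, 2, 3], [0, 2,
    4], [0, 1, 2, 3], [0, 1, 2, 4], [0, 2, 3, 4], [0, 2, 4, 5]])]"
  by code_simp

text \<open>Here and in the next three certificates, upper and lower entries alternate from left to
  right, starting with an upper one. The two letters give the directions, increasing or decreasing,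
  of the upper and the lower sequence.\<close>

lemma cert_alt_ii:
  "cert [([5, 1, 6, 2, 7, 3, 8, 4], [[0], [0, 1], [0, 2, 3], [0, 1, 3], [0, 2, 4, 5], [0, 1, 2, 3],
    [0, 2, 3, 5], [0, 1, 3, 5], [0, 2, 4, 6, 7], [0, 1, 2, 4, 5], [0, 2, 3, 4, 5], [0, 2, 4, 5,
    7], [0, 1, 3, 4, 5]])]"
  by code_simp

lemma cert_alt_id:
  "cert [([5, 4, 6, 3, 7, 2, 8, 1], [[0], [0, 1], [0, 2, 3], [0, 1, 3], [0, 2, 4, 5], [0, 1, 2, 3],
    [0, 2, 3, 5], [0, 1, 3, 5], [0, 2, 4, 6, 7], [0, 1, 2, 4, 5], [0, 2, 3, 4, 5], [0, 2, 4, 5,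
    7], [0, 1, 3, 4, 5]])]"
  by code_simp

lemma cert_alt_di:
  "cert [([8, 1, 7, 2, 6, 3, 5, 4], [[0], [0, 1], [0, 1, 2], [0, 2, 3], [0, 1, 3, 4], [0, 1, 2, 3],
    [0, 2, 3, 4], [0, 2, 4, 5], [0, 1, 3, 5, 6], [0, 1, 3, 4, 5], [0, 1, 2, 3, 4], [0, 1, 2, 4,
    5], [0, 2, 3, 5, 6]])]"
  by code_simp

lemma cert_alt_dd:
  "cert [([8, 4, 7, 3, 6, 2, 5, 1], [[0], [0, 1], [1, 2, 3], [0, 1, 2], [0, 1, 3], [1, 2, 3, 4], [1,
    2, 4, 5], [1, 3, 4, 5], [1, 2, 3, 5]])]"
  by code_simp

text \<open>The patterns listed from the oscillation 315264 have counts 1, 1, 2, 2, 2, whose weight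
  is below 1. Adding 321 and 4321 exceeds it, so the oscillation excludes long decreasing
  sequences.\<close>

lemma cert_osc_dec:
  "cert [([3, 1, 5, 2, 6, 4], [[0], [0, 1], [0, 2, 3], [0, 1, 3], [0, 2, 3, 5], [0, 1, 2, 3], [0, 2,
    3, 4, 5], [0, 1, 2, 3, 5]]),      ([5, 4, 3, 2, 1], [[0, 1, 2], [0, 1, 2, 3]])]"
  by code_simp

text \<open>Increasing sets are attached on both sides: 2341, 23451, 234561 come from points
  north-west of a point, and 4123, 51234 from points south-east of one. With only one of these two
  families the total would stay below 1.\<close>

lemma cert_osc_inc:
  "cert [([3, 1, 5, 2, 6, 4], [[0], [0, 1], [0, 2, 3], [0, 1, 3], [0, 2, 3, 5], [0, 1, 2, 3], [0, 2,
    3, 4, 5], [0, 1, 2, 3, 5], [0, 1, 2, 3, 4, 5]]),      ([2, 3, 4, 5, 6, 1], [[0, 1, 2, 5],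
    [0, 1, 2, 3, 5], [0, 1, 2, 3, 4, 5]]),      ([6, 1, 2, 3, 4, 5], [[0, 1, 2, 3], [0, 1, 2, 3,
    4]])]"
  by code_simp

section \<open>Points north-west of a point are almost monotone\<close>

definition incr :: "('a \<Rightarrow> real) \<Rightarrow> ('a \<Rightarrow> real) \<Rightarrow> 'a set \<Rightarrow> bool" where
  "incr X Y A \<longleftrightarrow> (\<forall>p\<in>A. \<forall>q\<in>A. X p < X q \<longrightarrow> Y p < Y q)"

definition decr :: "('a \<Rightarrow> real) \<Rightarrow> ('a \<Rightarrow> real) \<Rightarrow> 'a set \<Rightarrow> bool" where
  "decr X Y A \<longleftrightarrow> (\<forall>p\<in>A. \<forall>q\<in>A. X p < X q \<longrightarrow> Y q < Y p)"

text \<open>Decreasing sequences are written as chains of negated values, so one notion serves both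
  directions.\<close>

definition chain :: "nat \<Rightarrow> (nat \<Rightarrow> real) \<Rightarrow> bool" where
  "chain n f \<longleftrightarrow> (\<forall>i j. i < j \<longrightarrow> j < n \<longrightarrow> f i < f j)"

lemma chain_Suc: "(\<And>i. Suc i < n \<Longrightarrow> f i < f (Suc i)) \<Longrightarrow> chain n f"
  unfolding chain_def
proof (intro allI impI)
  fix i j assume *: "\<And>i. Suc i < n \<Longrightarrow> f i < f (Suc i)" and "i < j" "j < n"
  from this(2,3) show "f i < f j"
  proof (induction j)
    case (Suc j)
    then show ?case using *[of j] by (cases "i = j") auto
  qed simp
qed

lemma chain_less_iff: "chain n f \<Longrightarrow> i < n \<Longrightarrow> j < n \<Longrightarrow> f i < f j \<longleftrightarrow> i < j"
  unfolding chain_def by (metis linorder_neqE_nat order_less_asym order_less_irrefl)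

lemma chain_shift: "chain n f \<Longrightarrow> s + m \<le> n \<Longrightarrow> chain m (\<lambda>i. f (s + i))"
  unfolding chain_def by auto

lemma chain_rev: "chain n f \<Longrightarrow> chain n (\<lambda>i. - f (n - Suc i))"
  unfolding chain_def by auto

lemma has_mono: "has_pattern P X Y \<sigma> \<Longrightarrow> P \<subseteq> Q \<Longrightarrow> has_pattern Q X Y \<sigma>"
  unfolding has_pattern_def by blast

text \<open>The function \<open>h\<close> lists the vertical coordinates in increasing order. The
  entry \<open>\<tau> ! i\<close> is then the rank, counted from 1, of the i-th point from the
  left.\<close>

lemma hasI:
  assumes "\<And>i. i < length \<tau> \<Longrightarrow> e i \<in> P" "chain (length \<tau>) (\<lambda>i. X (e i))"
    "chain (length \<tau>) h" "\<And>i. i < length \<tau> \<Longrightarrow> 1 \<le> \<tau> ! i \<and> \<tau> ! i \<le> length \<tau>"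
    "\<And>i. i < length \<tau> \<Longrightarrow> Y (e i) = h (\<tau> ! i - 1)"
  shows "has_pattern P X Y \<tau>"
proof -
  have "Y (e i) < Y (e j) \<longleftrightarrow> \<tau> ! i < \<tau> ! j" if ij: "i < length \<tau>" "j < length \<tau>" for i j
  proof -
    have "\<tau> ! i - 1 < length \<tau>" "\<tau> ! j - 1 < length \<tau>" using assms(4)[OF ij(1)] assms(4)[OF ij(2)] by auto
    then have "Y (e i) < Y (e j) \<longleftrightarrow> \<tau> ! i - 1 < \<tau> ! j - 1"
      using chain_less_iff[OF assms(3)] assms(5)[OF ij(1)] assms(5)[OF ij(2)] by simp
    then show ?thesis using assms(4)[OF ij(1)] assms(4)[OF ij(2)] by auto
  qed
  then show ?thesis unfolding has_pattern_def using assms(1) chain_less_iff[OF assms(2)] by (intro exI[of _ e]) simp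
qed

lemma has_inc:
  assumes "chain n (\<lambda>i. X (a i))" "chain n (\<lambda>i. Y (a i))"
  shows "has_pattern (a ` {..<n}) X Y [1..<Suc n]"
  by (rule hasI[where e = a and h = "\<lambda>i. Y (a i)"]) (use assms in \<open>simp_all del: upt_Suc\<close>)

lemma has_dec:
  assumes "chain n (\<lambda>i. X (a i))" "chain n (\<lambda>i. - Y (a i))"
  shows "has_pattern (a ` {..<n}) X Y (rev [1..<Suc n])"
  by (rule hasI[where e = a and h = "\<lambda>i. Y (a (n - Suc i))"])
    (use assms chain_rev[OF assms(2)] in \<open>auto simp: rev_nth simp del: upt_Suc\<close>)

lemma has_direct_sum:
  assumes "has_pattern A X Y \<sigma>" "has_pattern B X Y \<tau>" "\<sigma> \<in> perms" "\<tau> \<in> perms"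
    "\<And>a b. a \<in> A \<Longrightarrow> b \<in> B \<Longrightarrow> X a < X b \<and> Y a < Y b"
  shows "has_pattern (A \<union> B) X Y (direct_sum \<sigma> \<tau>)"
proof -
  let ?m = "length \<sigma>" and ?n = "length \<tau>"
  obtain e where e: "\<And>i. i < ?m \<Longrightarrow> e i \<in> A"
    "\<And>i j. i < ?m \<Longrightarrow> j < ?m \<Longrightarrow> (X (e i) < X (e j) \<longleftrightarrow> i < j) \<and> (Y (e i) < Y (e j) \<longleftrightarrow> \<sigma> ! i < \<sigma> ! j)"
    using assms(1) unfolding has_pattern_def by blast
  obtain f where f: "\<And>i. i < ?n \<Longrightarrow> f i \<in> B"
    "\<And>i j. i < ?n \<Longrightarrow> j < ?n \<Longrightarrow> (X (f i) < X (f j) \<longleftrightarrow> i < j) \<and> (Y (f i) < Y (f j) \<longleftrightarrow> \<tau> ! i < \<tau> ! j)"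
    using assms(2) unfolding has_pattern_def by blast
  let ?g = "\<lambda>i. if i < ?m then e i else f (i - ?m)"
  have nth: "direct_sum \<sigma> \<tau> ! i = (if i < ?m then \<sigma> ! i else \<tau> ! (i - ?m) + ?m)" if "i < ?m + ?n" for i
    using that by (simp add: direct_sum_def nth_append)
  have "(X (?g i) < X (?g j) \<longleftrightarrow> i < j) \<and> (Y (?g i) < Y (?g j) \<longleftrightarrow> direct_sum \<sigma> \<tau> ! i < direct_sum \<sigma> \<tau> ! j)"
    if ij: "i < ?m + ?n" "j < ?m + ?n" for i j
  proof -
    consider "i < ?m" "j < ?m" | "i < ?m" "\<not> j < ?m" | "\<not> i < ?m" "j < ?m" | "\<not> i < ?m" "\<not> j < ?m" by blast
    then show ?thesis
    proof cases
      case 1 then show ?thesis using e(2) ij by (simp add: nth)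
    next
      case 2
      then have "X (e i) < X (f (j - ?m))" "Y (e i) < Y (f (j - ?m))" "\<sigma> ! i \<le> ?m" "1 \<le> \<tau> ! (j - ?m)"
        using assms(5) e(1) f(1) ij perms_nth_bounds[OF assms(3)] perms_nth_bounds[OF assms(4)] by auto
      then show ?thesis using 2 ij by (simp add: nth)
    next
      case 3
      then have "X (e j) < X (f (i - ?m))" "Y (e j) < Y (f (i - ?m))" "\<sigma> ! j \<le> ?m" "1 \<le> \<tau> ! (i - ?m)"
        using assms(5) e(1) f(1) ij perms_nth_bounds[OF assms(3)] perms_nth_bounds[OF assms(4)] by auto
      then show ?thesis using 3 ij by (simp add: nth)
    next
      case 4
      then have "i - ?m < ?n" "j - ?m < ?n" "i - ?m < j - ?m \<longleftrightarrow> i < j" using ij by auto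
      then show ?thesis using 4 f(2) ij by (simp add: nth)
    qed
  qed
  moreover have "?g i \<in> A \<union> B" if "i < ?m + ?n" for i using that e(1) f(1) by auto
  moreover have "length (direct_sum \<sigma> \<tau>) = ?m + ?n" by (simp add: direct_sum_def)
  ultimately show ?thesis unfolding has_pattern_def by (intro exI[of _ ?g]) simp
qed

definition complement :: "nat list \<Rightarrow> nat list" where
  "complement \<sigma> = map (\<lambda>v. Suc (length \<sigma>) - v) \<sigma>"

lemma has_complement:
  assumes "has_pattern P X (\<lambda>p. - Y p) \<sigma>" "\<sigma> \<in> perms"
  shows "has_pattern P X Y (complement \<sigma>)"
proof -
  have "\<sigma> ! j < \<sigma> ! i \<longleftrightarrow> complement \<sigma> ! i < complement \<sigma> ! j" if "i < length \<sigma>" "j < length \<sigma>" for i j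
    using perms_nth_bounds[OF assms(2) that(1)] perms_nth_bounds[OF assms(2) that(2)] that
    by (auto simp: complement_def)
  then show ?thesis using assms(1) unfolding has_pattern_def by (auto simp: complement_def)
qed

lemma is_perm: "distinct \<sigma> \<Longrightarrow> list_all (\<lambda>v. 1 \<le> v \<and> v \<le> length \<sigma>) \<sigma> \<Longrightarrow> \<sigma> \<in> perms"
  unfolding perms_iff
  by (intro conjI card_subset_eq) (auto simp: list_all_iff distinct_card)

lemma complement_perms: "\<sigma> \<in> perms \<Longrightarrow> complement \<sigma> \<in> perms"
  using rev_compl_perms[of \<sigma>] by (simp add: perms_iff rev_compl_def complement_def rev_map[symmetric])

lemma complement_complement: "\<sigma> \<in> perms \<Longrightarrow> complement (complement \<sigma>) = \<sigma>"
  by (intro nth_equalityI) (simp_all add: complement_def le_SucI perms_nth_bounds(2))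

lemma has_skew_sum:
  assumes "has_pattern A X Y (complement \<sigma>)" "has_pattern B X Y (complement \<tau>)" "\<sigma> \<in> perms" "\<tau> \<in> perms"
    "\<And>a b. a \<in> A \<Longrightarrow> b \<in> B \<Longrightarrow> X a < X b \<and> Y b < Y a"
  shows "has_pattern (A \<union> B) X Y (complement (direct_sum \<sigma> \<tau>))"
proof -
  have "has_pattern A X (\<lambda>p. - Y p) \<sigma>" "has_pattern B X (\<lambda>p. - Y p) \<tau>"
    using has_complement[of A X "\<lambda>p. - Y p" "complement \<sigma>"] has_complement[of B X "\<lambda>p. - Y p" "complement \<tau>"]
      assms(1-4) complement_perms complement_complement by auto
  then have "has_pattern (A \<union> B) X (\<lambda>p. - Y p) (direct_sum \<sigma> \<tau>)"
    using assms(3-5) by (intro has_direct_sum) auto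
  moreover have "direct_sum \<sigma> \<tau> \<in> perms"
  proof (rule is_perm)
    show "distinct (direct_sum \<sigma> \<tau>)" using assms(3,4)
      by (auto simp: direct_sum_def perms_iff distinct_map inj_on_def)
    show "list_all (\<lambda>v. 1 \<le> v \<and> v \<le> length (direct_sum \<sigma> \<tau>)) (direct_sum \<sigma> \<tau>)"
      using assms(3,4) by (auto simp: direct_sum_def perms_iff list_all_iff)
  qed
  ultimately show ?thesis by (rule has_complement)
qed

section \<open>Ramsey-type selection of uniform sequences\<close>

abbreviation for_pairs :: "nat \<Rightarrow> (nat \<Rightarrow> nat \<Rightarrow> bool) \<Rightarrow> bool" where
  "for_pairs n f \<equiv> \<forall>i j. i < j \<longrightarrow> j < n \<longrightarrow> f i j"

abbreviation homogeneous :: "nat \<Rightarrow> (nat \<Rightarrow> nat \<Rightarrow> bool) \<Rightarrow> bool" where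
  "homogeneous n f \<equiv> for_pairs n f \<or> for_pairs n (\<lambda>i j. \<not> f i j)"

text \<open>This is Ramsey's theorem for graphs with the homogeneous set listed in increasing order.
  The relation \<open>f\<close> may be asymmetric, since a pair is coloured through its ordered
  version.\<close>

lemma ramsey_seq:
  "\<exists>N. \<forall>f::nat \<Rightarrow> nat \<Rightarrow> bool. \<exists>g::nat \<Rightarrow> nat. for_pairs k (\<lambda>i j. g i < g j) \<and> (\<forall>i<k. g i < N) \<and>
     (homogeneous k (\<lambda>i j. f (g i) (g j)))"
proof -
  obtain N where N: "\<And>V E. finite (V::nat set) \<Longrightarrow> card V \<ge> N \<Longrightarrow>
      \<exists>R\<subseteq>V. card R = k \<and> clique R E \<or> card R = k \<and> indep R E"
    using ramsey2[of k k] by metis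
  show ?thesis
  proof (intro exI[of _ N] allI)
    fix f :: "nat \<Rightarrow> nat \<Rightarrow> bool"
    define E where "E = {{i, j} | i j. i < j \<and> f i j}"
    have E: "{i, j} \<in> E \<longleftrightarrow> f i j" if "i < j" for i j
      using that by (auto simp: E_def doubleton_eq_iff)
    obtain R where R: "R \<subseteq> {..<N}" "card R = k" "clique R E \<or> indep R E" using N[of "{..<N}" E] by auto
    have fin: "finite R" using R(1) finite_subset by blast
    let ?g = "\<lambda>i. sorted_list_of_set R ! i"
    have mem: "?g i \<in> R" if "i < k" for i
      using that R(2) fin by (metis nth_mem length_sorted_list_of_set set_sorted_list_of_set)
    have mono: "?g i < ?g j" if "i < j" "j < k" for i j
      using that R(2) by (intro sorted_wrt_nth_less[OF strict_sorted_list_of_set]) simp_all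
    have "homogeneous k (\<lambda>i j. f (?g i) (?g j))"
      using R(3)
    proof
      assume c: "clique R E"
      have "f (?g i) (?g j)" if "i < j" "j < k" for i j
        using c mem[of i] mem[of j] E[OF mono[OF that]] mono[OF that] that unfolding clique_def by auto
      then show ?thesis by blast
    next
      assume c: "indep R E"
      have "\<not> f (?g i) (?g j)" if "i < j" "j < k" for i j
        using c mem[of i] mem[of j] E[OF mono[OF that]] mono[OF that] that unfolding indep_def by auto
      then show ?thesis by blast
    qed
    then show "\<exists>g. for_pairs k (\<lambda>i j. g i < g j) \<and> (\<forall>i<k. g i < N) \<and>
     (homogeneous k (\<lambda>i j. f (g i) (g j)))"
      using mem mono R(1) by (intro exI[of _ ?g]) blast
  qed
qed

text \<open>The relations are treated one after another. A sequence homogeneous for all but one of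
  them is chosen of length \<open>M\<close>, enough to extract \<open>k\<close> terms homogeneous
  for the last one; subsequences inherit the rest.\<close>

lemma ramsey_seqs:
  "\<exists>N. \<forall>fs::(nat \<Rightarrow> nat \<Rightarrow> bool) list. length fs = l \<longrightarrow>
     (\<exists>g::nat \<Rightarrow> nat. for_pairs k (\<lambda>i j. g i < g j) \<and> (\<forall>i<k. g i < N) \<and>
     (\<forall>f\<in>set fs. homogeneous k (\<lambda>i j. f (g i) (g j))))"
proof (induction l arbitrary: k)
  case 0
  show ?case by (intro exI[of _ k] allI impI exI[of _ "\<lambda>i::nat. i"]) auto
next
  case (Suc l)
  obtain M where M: "\<And>f::nat \<Rightarrow> nat \<Rightarrow> bool. \<exists>g::nat \<Rightarrow> nat. for_pairs k (\<lambda>i j. g i < g j) \<and> (\<forall>i<k. g i < M) \<and>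
     (homogeneous k (\<lambda>i j. f (g i) (g j)))"
    using ramsey_seq[of k] by metis
  obtain N where N: "\<And>fs::(nat \<Rightarrow> nat \<Rightarrow> bool) list. length fs = l \<Longrightarrow>
     (\<exists>g::nat \<Rightarrow> nat. for_pairs M (\<lambda>i j. g i < g j) \<and> (\<forall>i<M. g i < N) \<and>
     (\<forall>f\<in>set fs. homogeneous M (\<lambda>i j. f (g i) (g j))))"
    using Suc.IH[of M] by metis
  show ?case
  proof (intro exI[of _ N] allI impI)
    fix fs :: "(nat \<Rightarrow> nat \<Rightarrow> bool) list" assume "length fs = Suc l"
    then obtain f fs' where fs: "fs = f # fs'" "length fs' = l" by (cases fs) auto
    obtain g where g: "\<And>i j. i < j \<Longrightarrow> j < M \<Longrightarrow> g i < g j" "\<And>i. i < M \<Longrightarrow> g i < N"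
      "\<And>f. f \<in> set fs' \<Longrightarrow> homogeneous M (\<lambda>i j. f (g i) (g j))"
      using N[OF fs(2)] by metis
    obtain h where h: "\<And>i j. i < j \<Longrightarrow> j < k \<Longrightarrow> h i < h j" "\<And>i. i < k \<Longrightarrow> h i < M"
      "homogeneous k (\<lambda>i j. f (g (h i)) (g (h j)))"
      using M[of "\<lambda>i j. f (g i) (g j)"] by metis
    have "homogeneous k (\<lambda>i j. f' (g (h i)) (g (h j)))"
      if "f' \<in> set fs'" for f'
      using g(3)[OF that]
    proof
      assume "for_pairs M (\<lambda>i j. f' (g i) (g j))"
      then show ?thesis using h(1,2) by simp
    next
      assume "for_pairs M (\<lambda>i j. \<not> f' (g i) (g j))"
      then show ?thesis using h(1,2) by simp
    qed
    then show "\<exists>g. for_pairs k (\<lambda>i j. g i < g j) \<and> (\<forall>i<k. g i < N) \<and>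
     (\<forall>f\<in>set fs. homogeneous k (\<lambda>i j. f (g i) (g j)))"
      using g(1,2) h unfolding fs(1) by (intro exI[of _ "\<lambda>i. g (h i)"]) auto
  qed
qed

text \<open>A greedy matching: as long as deleting the endpoints of the pairs found so far leaves
  some \<open>Q\<close>-pair, that pair extends the matching.\<close>

lemma disjoint_pairs:
  fixes Q :: "'a \<Rightarrow> 'a \<Rightarrow> bool"
  assumes "finite A"
  shows "(\<exists>R\<subseteq>A. card R \<le> 2 * m \<and> (\<forall>p\<in>A - R. \<forall>q\<in>A - R. \<not> Q p q)) \<or>
    (\<exists>a b. \<forall>i<m. a i \<in> A \<and> b i \<in> A \<and> Q (a i) (b i) \<and>
       (\<forall>j<m. j \<noteq> i \<longrightarrow> a i \<noteq> a j \<and> b i \<noteq> b j \<and> a i \<noteq> b j))"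
proof (induction m)
  case (Suc m)
  show ?case
  proof (cases "\<exists>R\<subseteq>A. card R \<le> 2 * m \<and> (\<forall>p\<in>A - R. \<forall>q\<in>A - R. \<not> Q p q)")
    case True
    then obtain R where "R \<subseteq> A" "card R \<le> 2 * m" "\<forall>p\<in>A - R. \<forall>q\<in>A - R. \<not> Q p q" by blast
    then show ?thesis by (intro disjI1 exI[of _ R]) auto
  next
    case False
    then obtain a b where ab: "\<forall>i<m. a i \<in> A \<and> b i \<in> A \<and> Q (a i) (b i) \<and>
       (\<forall>j<m. j \<noteq> i \<longrightarrow> a i \<noteq> a j \<and> b i \<noteq> b j \<and> a i \<noteq> b j)" using Suc by blast
    define R where "R = a ` {..<m} \<union> b ` {..<m}"
    have "card R \<le> card (a ` {..<m}) + card (b ` {..<m})" unfolding R_def by (rule card_Un_le)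
    also have "\<dots> \<le> 2 * m" using card_image_le[of "{..<m}" a] card_image_le[of "{..<m}" b] by simp
    finally have "card R \<le> 2 * m" .
    moreover have "R \<subseteq> A" using ab by (auto simp: R_def)
    ultimately obtain p q where pq: "p \<in> A - R" "q \<in> A - R" "Q p q" using False by blast
    have new: "p \<noteq> a j \<and> p \<noteq> b j \<and> q \<noteq> a j \<and> q \<noteq> b j" if "j < m" for j
      using pq(1,2) that by (auto simp: R_def)
    let ?a = "a(m := p)" and ?b = "b(m := q)"
    have "?a i \<in> A \<and> ?b i \<in> A \<and> Q (?a i) (?b i)" if "i < Suc m" for i
      using ab pq that by (cases "i = m") simp_all
    moreover have "?a i \<noteq> ?a j \<and> ?b i \<noteq> ?b j \<and> ?a i \<noteq> ?b j" if ij: "i < Suc m" "j < Suc m" "j \<noteq> i" for i j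
    proof -
      consider "i = m" "j < m" | "j = m" "i < m" | "i < m" "j < m" using ij by linarith
      then show ?thesis
      proof cases
        case 1 then show ?thesis using new[of j] by simp
      next
        case 2 then show ?thesis using new[of i] by auto
      next
        case 3 then show ?thesis using ab ij(3) by simp
      qed
    qed
    ultimately show ?thesis by blast
  qed
qed auto

lemma has_skew:
  assumes "has_pattern A X Y \<sigma>" "has_pattern B X Y \<tau>" "\<sigma> \<in> perms" "\<tau> \<in> perms"
    "\<And>a b. a \<in> A \<Longrightarrow> b \<in> B \<Longrightarrow> X a < X b \<and> Y b < Y a"
  shows "has_pattern (A \<union> B) X Y (skew_sum \<sigma> \<tau>)"
proof -
  have "has_pattern (A \<union> B) X Y (complement (direct_sum (complement \<sigma>) (complement \<tau>)))"
    using assms by (intro has_skew_sum) (simp_all add: complement_complement complement_perms)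
  moreover have "complement (direct_sum (complement \<sigma>) (complement \<tau>)) = skew_sum \<sigma> \<tau>"
  proof (rule nth_equalityI)
    fix i assume "i < length (complement (direct_sum (complement \<sigma>) (complement \<tau>)))"
    then have i: "i < length \<sigma> + length \<tau>" by (simp add: complement_def direct_sum_def)
    show "complement (direct_sum (complement \<sigma>) (complement \<tau>)) ! i = skew_sum \<sigma> \<tau> ! i"
    proof (cases "i < length \<sigma>")
      case True
      then show ?thesis using perms_nth_bounds[OF assms(3) True]
        by (simp add: complement_def direct_sum_def skew_sum_def nth_append)
    next
      case False
      then have "i - length \<sigma> < length \<tau>" using i by simp
      then show ?thesis using perms_nth_bounds[OF assms(4), of "i - length \<sigma>"] False i
        by (simp add: complement_def direct_sum_def skew_sum_def nth_append)
    qed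
  qed (simp add: complement_def direct_sum_def skew_sum_def)
  ultimately show ?thesis by simp
qed

text \<open>Blocks have six entries because some certificates use patterns of length 7 that consist
  of a whole block and the appended point. \<open>layers\<close> is the sum of six copies of
  21.\<close>

abbreviation "inc6 \<equiv> [1, 2, 3, 4, 5, 6::nat]"
abbreviation "dec6 \<equiv> [6, 5, 4, 3, 2, 1::nat]"
abbreviation "layers \<equiv> [2, 1, 4, 3, 6, 5, 8, 7, 10, 9, 12, 11::nat]"

lemma perms6: "inc6 \<in> perms" "dec6 \<in> perms" "layers \<in> perms" "[1] \<in> perms"
  by (rule is_perm; simp)+

lemma inc6_eq: "[1..<Suc 6] = inc6" and dec6_eq: "rev [1..<Suc 6] = dec6"
  by (simp_all add: upt_rec)

lemma inc_block:
  assumes "chain n (\<lambda>i. X (a i))" "chain n (\<lambda>i. Y (a i))" "s + 6 \<le> n"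
  shows "has_pattern ((\<lambda>i. a (s + i)) ` {..<6}) X Y inc6"
  using has_inc[of 6 X "\<lambda>i. a (s + i)" Y] chain_shift[OF assms(1,3)] chain_shift[OF assms(2,3)]
  by (simp only: inc6_eq)

lemma dec_block:
  assumes "chain n (\<lambda>i. X (a i))" "chain n (\<lambda>i. - Y (a i))" "s + 6 \<le> n"
  shows "has_pattern ((\<lambda>i. a (s + i)) ` {..<6}) X Y dec6"
  using has_dec[of 6 X "\<lambda>i. a (s + i)" Y] chain_shift[OF assms(1,3)] chain_shift[OF assms(2,3)]
  by (simp only: dec6_eq)

text \<open>The pairs (\<open>a i\<close>, \<open>b i\<close>) are inversions in uniform mutual
  position. Either a block of the \<open>a i\<close> lies entirely north-west of a block of the
  \<open>b i\<close>, or each pair precedes the next one in both coordinates, which gives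
  \<open>layers\<close>.\<close>

lemma inversions_cases:
  assumes mem: "\<And>i. i < 24 \<Longrightarrow> a i \<in> A \<and> b i \<in> A"
    and ab: "\<And>i. i < 24 \<Longrightarrow> X (a i) < X (b i) \<and> Y (b i) < Y (a i)"
    and a: "chain 24 (\<lambda>i. X (a i))" "chain 24 (\<lambda>i. Y (a i))"
    and b: "chain 24 (\<lambda>i. X (b i)) \<and> chain 24 (\<lambda>i. Y (b i)) \<or>
      chain 24 (\<lambda>i. - X (b i)) \<and> chain 24 (\<lambda>i. - Y (b i))"
    and hX: "for_pairs 24 (\<lambda>i j. X (a j) < X (b i)) \<or> for_pairs 24 (\<lambda>i j. X (b i) < X (a j))"
    and hY: "for_pairs 24 (\<lambda>i j. Y (b j) < Y (a i)) \<or> for_pairs 24 (\<lambda>i j. Y (a i) < Y (b j))"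
  shows "has_pattern A X Y (skew_sum inc6 inc6) \<or> has_pattern A X Y layers"
proof -
  have aX: "X (a i) \<le> X (a j)" and aY: "Y (a i) \<le> Y (a j)" if "i \<le> j" "j < 24" for i j
    using a that unfolding chain_def by (metis le_neq_implies_less order_le_less)+
  have skew: "has_pattern A X Y (skew_sum inc6 inc6)"
    if "has_pattern ((\<lambda>i. a (s + i)) ` {..<6}) X Y inc6" "has_pattern (c ` {..<6}) X Y inc6" "s + 6 \<le> 24"
      "\<And>i. i < 6 \<Longrightarrow> c i \<in> A"
      "\<And>i j. i < 6 \<Longrightarrow> j < 6 \<Longrightarrow> X (a (s + i)) < X (c j) \<and> Y (c j) < Y (a (s + i))" for s c
  proof (rule has_mono[OF has_skew[OF that(1,2) perms6(1) perms6(1)]])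
    show "(\<lambda>i. a (s + i)) ` {..<6} \<union> c ` {..<6} \<subseteq> A" using mem that(3,4) by auto
  qed (use that(5) in auto)
  note ai = inc_block[of 24 X a Y, OF a]
  show ?thesis
  proof (cases "chain 24 (\<lambda>i. X (b i)) \<and> chain 24 (\<lambda>i. Y (b i))")
    case inc: True
    then have bX: "X (b i) \<le> X (b j)" and bY: "Y (b i) \<le> Y (b j)" if "i \<le> j" "j < 24" for i j
      using that unfolding chain_def by (metis le_neq_implies_less order_le_less)+
    have bi: "s + 6 \<le> 24 \<Longrightarrow> has_pattern ((\<lambda>i. b (s + i)) ` {..<6}) X Y inc6" for s
      using inc_block[of 24 X b Y] inc by blast
    consider (X) "for_pairs 24 (\<lambda>i j. X (a j) < X (b i))"
      | (Y) "for_pairs 24 (\<lambda>i j. Y (b j) < Y (a i))"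
      | (N) "for_pairs 24 (\<lambda>i j. X (b i) < X (a j))" "for_pairs 24 (\<lambda>i j. Y (a i) < Y (b j))"
      using hX hY by blast
    then show ?thesis
    proof cases
      case X
      \<comment> \<open>The shift by 6 makes every index of \<open>a\<close> exceed every index of
        \<open>b\<close>, as \<open>X\<close> requires. The vertical comparison goes through
        \<open>a j\<close>, which lies above \<open>b j\<close>.\<close>
      have "X (a (6 + i)) < X (b (0 + j)) \<and> Y (b (0 + j)) < Y (a (6 + i))" if "i < 6" "j < 6" for i j
        using X that ab[of j] aY[of j "6 + i"] by force
      then show ?thesis using ai[of 6] bi[of 0] mem by (intro disjI1 skew[of 6 "\<lambda>i. b (0 + i)"]) auto
    next
      case Y
      have "X (a (0 + i)) < X (b (6 + j)) \<and> Y (b (6 + j)) < Y (a (0 + i))" if "i < 6" "j < 6" for i j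
        using Y that ab[of "6 + j"] aX[of i "6 + j"] by force
      then show ?thesis using ai[of 0] bi[of 6] mem by (intro disjI1 skew[of 0 "\<lambda>i. b (6 + i)"]) auto
    next
      case N
      let ?e = "\<lambda>i. if even i then a (i div 2) else b (i div 2)"
      let ?h = "\<lambda>i. Y (if even i then b (i div 2) else a (i div 2))"
      have "list_all (\<lambda>i. 1 \<le> layers ! i \<and> layers ! i \<le> 12 \<and> (layers ! i - 1) div 2 = i div 2 \<and>
          even (layers ! i - 1) = odd i) [0..<12]"
        by code_simp
      then have l: "1 \<le> layers ! i \<and> layers ! i \<le> 12 \<and> (layers ! i - 1) div 2 = i div 2 \<and>
          even (layers ! i - 1) = odd i" if "i < 12" for i
        using that unfolding list_all_iff by (metis atLeastLessThan_iff le0 set_upt)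
      have step: "X (?e i) < X (?e (Suc i)) \<and> ?h i < ?h (Suc i)" if "Suc i < 12" for i
      proof (cases "even i")
        case True
        then have "Suc i div 2 = i div 2" "odd (Suc i)" by simp_all
        then show ?thesis using True ab[of "i div 2"] that by simp
      next
        case False
        then have "Suc i div 2 = Suc (i div 2)" "even (Suc i)" by presburger+
        then show ?thesis using False N that by simp
      qed
      have "has_pattern A X Y layers"
      proof (rule hasI[where e = ?e and h = ?h])
        show "chain (length layers) (\<lambda>i. X (?e i))" "chain (length layers) ?h"
          by (rule chain_Suc; use step in simp)+
        fix i assume "i < length layers"
        then have i: "i < 12" by simp
        show "?e i \<in> A" using mem[of "i div 2"] i by simp
        show "1 \<le> layers ! i \<and> layers ! i \<le> length layers" using l[OF i] by simp
        show "Y (?e i) = ?h (layers ! i - 1)" using l[OF i] by presburger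
      qed
      then show ?thesis ..
    qed
  next
    case False
    \<comment> \<open>If \<open>b\<close> runs south-west while \<open>a\<close> runs north-east,
      every \<open>a i\<close> lies north-west of every \<open>b j\<close>. Only the order of
      \<open>b\<close> has to be reversed to make it increasing.\<close>
    then have dec: "chain 24 (\<lambda>i. - X (b i))" "chain 24 (\<lambda>i. - Y (b i))" using b by auto
    then have bX: "X (b j) \<le> X (b i)" and bY: "Y (b j) \<le> Y (b i)" if "i \<le> j" "j < 24" for i j
      using that unfolding chain_def by (metis le_neq_implies_less order_le_less neg_less_iff_less)+
    let ?c = "\<lambda>i. b (23 - i)"
    have "chain 24 (\<lambda>i. X (?c i))" "chain 24 (\<lambda>i. Y (?c i))"
      using chain_rev[OF dec(1)] chain_rev[OF dec(2)] by simp_all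
    from inc_block[of 24 X ?c Y, OF this, of 0]
    have c: "has_pattern ((\<lambda>i. b (23 - i)) ` {..<6}) X Y inc6" by simp
    have "X (a (0 + i)) < X (b (23 - j)) \<and> Y (b (23 - j)) < Y (a (0 + i))" if "i < 6" "j < 6" for i j
      using that ab[of "23 - j"] aX[of i "23 - j"] aY[of 0 i] bY[of 0 "23 - j"] ab[of 0] by force
    then show ?thesis using ai[of 0] c mem by (intro disjI1 skew[of 0 ?c]) auto
  qed
qed

lemma dichotomy:
  assumes "homogeneous n (\<lambda>i j. f i j)"
    "\<And>i j. \<not> f i j \<Longrightarrow> i < j \<Longrightarrow> j < n \<Longrightarrow> f' i j"
  shows "for_pairs n (\<lambda>i j. f i j) \<or> for_pairs n (\<lambda>i j. f' i j)"
  using assms by blast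

lemma same_direction:
  assumes "a \<or> a'" "b \<or> b'" "c \<or> c'" "d \<or> d'"
    "a \<Longrightarrow> b' \<Longrightarrow> D" "a' \<Longrightarrow> b \<Longrightarrow> D" "c \<Longrightarrow> d' \<Longrightarrow> D" "c' \<Longrightarrow> d \<Longrightarrow> D"
  obtains D | a b "c \<and> d \<or> c' \<and> d'" | a' b' "c \<and> d \<or> c' \<and> d'"
  using assms by blast

text \<open>Either few points meet all inversions, or there are \<open>N\<close> disjoint
  inversions. In the latter case the uniform pairs obtained from Ramsey's theorem contain a
  decreasing sequence or satisfy \<open>inversions_cases\<close>. The length 24 is dictated by
  \<open>halving\<close>.\<close>

lemma near_incr:
  "\<exists>r. \<forall>(A::'a set) X Y. finite A \<and> inj_on X A \<and> inj_on Y A \<longrightarrow>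
     (\<exists>R\<subseteq>A. card R \<le> r \<and> incr X Y (A - R)) \<or>
     (\<exists>a. (\<forall>i<24. a i \<in> A) \<and> chain 24 (\<lambda>i. X (a i)) \<and> chain 24 (\<lambda>i. - Y (a i))) \<or>
     has_pattern A X Y (skew_sum inc6 inc6) \<or> has_pattern A X Y layers"
proof -
  obtain N where N: "\<forall>fs::(nat \<Rightarrow> nat \<Rightarrow> bool) list. length fs = 8 \<longrightarrow>
     (\<exists>g::nat \<Rightarrow> nat. for_pairs 24 (\<lambda>i j. g i < g j) \<and> (\<forall>i<24. g i < N) \<and>
     (\<forall>f\<in>set fs. homogeneous 24 (\<lambda>i j. f (g i) (g j))))"
    using ramsey_seqs[of 8 24] by (rule exE)
  show ?thesis
  proof (intro exI[of _ "2 * N"] allI impI)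
    fix A :: "'a set" and X Y :: "'a \<Rightarrow> real"
    assume A: "finite A \<and> inj_on X A \<and> inj_on Y A"
    let ?Q = "\<lambda>p q. X p < X q \<and> Y q < Y p"
    consider (near) R where "R \<subseteq> A" "card R \<le> 2 * N" "\<forall>p\<in>A - R. \<forall>q\<in>A - R. \<not> ?Q p q"
      | (far) a b where "\<forall>i<N. a i \<in> A \<and> b i \<in> A \<and> ?Q (a i) (b i) \<and>
       (\<forall>j<N. j \<noteq> i \<longrightarrow> a i \<noteq> a j \<and> b i \<noteq> b j \<and> a i \<noteq> b j)"
      using disjoint_pairs[of A N ?Q] A by blast
    then show "(\<exists>R\<subseteq>A. card R \<le> 2 * N \<and> incr X Y (A - R)) \<or>
     (\<exists>a. (\<forall>i<24. a i \<in> A) \<and> chain 24 (\<lambda>i. X (a i)) \<and> chain 24 (\<lambda>i. - Y (a i))) \<or>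
     has_pattern A X Y (skew_sum inc6 inc6) \<or> has_pattern A X Y layers" (is "_ \<or> ?D \<or> ?S \<or> ?L")
    proof cases
      case near
      have "incr X Y (A - R)" unfolding incr_def
      proof (intro ballI impI)
        fix p q assume pq: "p \<in> A - R" "q \<in> A - R" "X p < X q"
        then have "Y p \<noteq> Y q" using A by (metis DiffD1 inj_onD order_less_irrefl)
        then show "Y p < Y q" using near(3) pq by (meson linorder_neqE)
      qed
      then show ?thesis using near by blast
    next
      case far
      \<comment> \<open>Four relations give the directions of \<open>a\<close> and \<open>b\<close>,
        the next two are those of \<open>inversions_cases\<close>. The last two are what these
        become when the indices are reversed, as happens in the case \<open>down\<close>.\<close>
      define fs where "fs = [\<lambda>i j. X (a i) < X (a j), \<lambda>i j. Y (a i) < Y (a j), \<lambda>i j. X (b i) < X (b j),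
        \<lambda>i j. Y (b i) < Y (b j), \<lambda>i j. X (a j) < X (b i), \<lambda>i j. Y (b j) < Y (a i),
        \<lambda>i j. X (a i) < X (b j), \<lambda>i j. Y (b i) < Y (a j)]"
      have "length fs = 8" by (simp add: fs_def)
      then have "\<exists>g::nat \<Rightarrow> nat. for_pairs 24 (\<lambda>i j. g i < g j) \<and> (\<forall>i<24. g i < N) \<and>
         (\<forall>f\<in>set fs. homogeneous 24 (\<lambda>i j. f (g i) (g j)))"
        by (rule N[THEN spec, THEN mp])
      then obtain g :: "nat \<Rightarrow> nat" where g': "for_pairs 24 (\<lambda>i j. g i < g j) \<and> (\<forall>i<24. g i < N) \<and>
         (\<forall>f\<in>set fs. homogeneous 24 (\<lambda>i j. f (g i) (g j)))"
        by (rule exE)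
      have g: "g i < g j" if "i < j" "j < 24" for i j using g'[THEN conjunct1] that by simp
      have gN: "g i < N" if "i < 24" for i using g'[THEN conjunct2, THEN conjunct1] that by simp
      have hom: "homogeneous 24 (\<lambda>i j. f (g i) (g j))"
        if "f \<in> set fs" for f
        using g'[THEN conjunct2, THEN conjunct2] that by (rule bspec)
      define c where "c i = a (g i)" for i
      define d where "d i = b (g i)" for i
      have f1: "a i \<in> A \<and> b i \<in> A \<and> ?Q (a i) (b i)" if "i < N" for i
        using far[THEN spec, THEN mp, OF that] by simp
      have f2: "a i \<noteq> a j \<and> b i \<noteq> b j \<and> a i \<noteq> b j" if "i < N" "j < N" "j \<noteq> i" for i j
        using far[THEN spec, THEN mp, OF that(1)] that by simp
      have cd: "c i \<in> A" "d i \<in> A" "X (c i) < X (d i)" "Y (d i) < Y (c i)" if "i < 24" for i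
        using f1[OF gN[OF that]] by (auto simp: c_def d_def)
      have ne: "c i \<noteq> c j" "d i \<noteq> d j" "c i \<noteq> d j" "d i \<noteq> c j" if ij: "i < j" "j < 24" for i j
      proof -
        have *: "g i < N" "g j < N" "g j \<noteq> g i" using g[OF ij] gN[of i] gN[of j] ij by auto
        show "c i \<noteq> c j" "d i \<noteq> d j" "c i \<noteq> d j" "d i \<noteq> c j"
          unfolding c_def d_def using f2[OF *] f2[OF *(2,1) *(3)[symmetric]] by auto
      qed
      have X: "X q < X p" if "\<not> X p < X q" "p \<noteq> q" "p \<in> A" "q \<in> A" for p q
        using A that by (metis inj_onD linorder_neqE)
      have Y: "Y q < Y p" if "\<not> Y p < Y q" "p \<noteq> q" "p \<in> A" "q \<in> A" for p q
        using A that by (metis inj_onD linorder_neqE)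
      have m: "c i \<in> A" "c j \<in> A" "d i \<in> A" "d j \<in> A" if "i < j" "j < 24" for i j
        using cd(1,2) that by auto
      have h1: "chain 24 (\<lambda>i. X (c i)) \<or> chain 24 (\<lambda>i. - X (c i))"
        unfolding chain_def neg_less_iff_less
        by (rule dichotomy[OF hom[of "\<lambda>i j. X (a i) < X (a j)", folded c_def]])
          (simp_all add: fs_def X ne m)
      have h2: "chain 24 (\<lambda>i. Y (c i)) \<or> chain 24 (\<lambda>i. - Y (c i))"
        unfolding chain_def neg_less_iff_less
        by (rule dichotomy[OF hom[of "\<lambda>i j. Y (a i) < Y (a j)", folded c_def]])
          (simp_all add: fs_def Y ne m)
      have h3: "chain 24 (\<lambda>i. X (d i)) \<or> chain 24 (\<lambda>i. - X (d i))"
        unfolding chain_def neg_less_iff_less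
        by (rule dichotomy[OF hom[of "\<lambda>i j. X (b i) < X (b j)", folded d_def]])
          (simp_all add: fs_def X ne m)
      have h4: "chain 24 (\<lambda>i. Y (d i)) \<or> chain 24 (\<lambda>i. - Y (d i))"
        unfolding chain_def neg_less_iff_less
        by (rule dichotomy[OF hom[of "\<lambda>i j. Y (b i) < Y (b j)", folded d_def]])
          (simp_all add: fs_def Y ne m)
      have h5: "for_pairs 24 (\<lambda>i j. X (c j) < X (d i)) \<or> for_pairs 24 (\<lambda>i j. X (d i) < X (c j))"
        by (rule dichotomy[OF hom[of "\<lambda>i j. X (a j) < X (b i)", folded c_def d_def]])
          (simp_all add: fs_def X ne(4)[symmetric] m)
      have h6: "for_pairs 24 (\<lambda>i j. Y (d j) < Y (c i)) \<or> for_pairs 24 (\<lambda>i j. Y (c i) < Y (d j))"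
        by (rule dichotomy[OF hom[of "\<lambda>i j. Y (b j) < Y (a i)", folded c_def d_def]])
          (simp_all add: fs_def Y ne(3)[symmetric] m)
      have h7: "for_pairs 24 (\<lambda>i j. X (c i) < X (d j)) \<or> for_pairs 24 (\<lambda>i j. X (d j) < X (c i))"
        by (rule dichotomy[OF hom[of "\<lambda>i j. X (a i) < X (b j)", folded c_def d_def]])
          (simp_all add: fs_def X ne m)
      have h8: "for_pairs 24 (\<lambda>i j. Y (d i) < Y (c j)) \<or> for_pairs 24 (\<lambda>i j. Y (c j) < Y (d i))"
        by (rule dichotomy[OF hom[of "\<lambda>i j. Y (b i) < Y (a j)", folded c_def d_def]])
          (simp_all add: fs_def Y ne m)
      have D1: ?D if "chain 24 (\<lambda>i. X (s i))" "chain 24 (\<lambda>i. - Y (s i))" "\<And>i. i < 24 \<Longrightarrow> s i \<in> A" for s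
        using that by blast
      have D2: ?D if "chain 24 (\<lambda>i. - X (s i))" "chain 24 (\<lambda>i. Y (s i))" "\<And>i. i < 24 \<Longrightarrow> s i \<in> A" for s
        using chain_rev[OF that(1)] chain_rev[OF that(2)] that(3)
        by (intro exI[of _ "\<lambda>i. s (24 - Suc i)"]) simp
      have i: "?D" if "chain 24 (\<lambda>i. X (c i))" "chain 24 (\<lambda>i. - Y (c i))"
        by (rule D1[OF that cd(1)])
      have ii: "?D" if "chain 24 (\<lambda>i. - X (c i))" "chain 24 (\<lambda>i. Y (c i))"
        by (rule D2[OF that cd(1)])
      have iii: "?D" if "chain 24 (\<lambda>i. X (d i))" "chain 24 (\<lambda>i. - Y (d i))"
        by (rule D1[OF that cd(2)])
      have iv: "?D" if "chain 24 (\<lambda>i. - X (d i))" "chain 24 (\<lambda>i. Y (d i))"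
        by (rule D2[OF that cd(2)])
      let ?d = "chain 24 (\<lambda>i. X (d i)) \<and> chain 24 (\<lambda>i. Y (d i)) \<or>
        chain 24 (\<lambda>i. - X (d i)) \<and> chain 24 (\<lambda>i. - Y (d i))"
      consider (D) ?D
        | (up) "chain 24 (\<lambda>i. X (c i))" "chain 24 (\<lambda>i. Y (c i))" ?d
        | (down) "chain 24 (\<lambda>i. - X (c i))" "chain 24 (\<lambda>i. - Y (c i))" ?d
        by (rule same_direction[OF h1 h2 h3 h4 D1[OF _ _ cd(1)] D2[OF _ _ cd(1)] D1[OF _ _ cd(2)] D2[OF _ _ cd(2)]])
      then show ?thesis
      proof cases
        case up
        have "?S \<or> ?L" by (rule inversions_cases[OF _ _ up h5 h6]) (use cd in auto)
        then show ?thesis by (rule disjI2[OF disjI2])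
      next
        case down
        let ?c = "\<lambda>i. c (24 - Suc i)" and ?d = "\<lambda>i. d (24 - Suc i)"
        have "?S \<or> ?L"
        proof (rule inversions_cases[where a = ?c and b = ?d])
          show "chain 24 (\<lambda>i. X (?c i))" "chain 24 (\<lambda>i. Y (?c i))"
            using chain_rev[OF down(1)] chain_rev[OF down(2)] by simp_all
          show "chain 24 (\<lambda>i. X (?d i)) \<and> chain 24 (\<lambda>i. Y (?d i)) \<or>
              chain 24 (\<lambda>i. - X (?d i)) \<and> chain 24 (\<lambda>i. - Y (?d i))"
            using down(3) chain_rev[of 24 "\<lambda>i. X (d i)"] chain_rev[of 24 "\<lambda>i. Y (d i)"]
              chain_rev[of 24 "\<lambda>i. - X (d i)"] chain_rev[of 24 "\<lambda>i. - Y (d i)"] by auto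
          show "for_pairs 24 (\<lambda>i j. X (?c j) < X (?d i)) \<or> for_pairs 24 (\<lambda>i j. X (?d i) < X (?c j))"
            using h7 by (elim disj_forward) simp_all
          show "for_pairs 24 (\<lambda>i j. Y (?d j) < Y (?c i)) \<or> for_pairs 24 (\<lambda>i j. Y (?c i) < Y (?d j))"
            using h8 by (elim disj_forward) simp_all
        qed (use cd in auto)
        then show ?thesis by (rule disjI2[OF disjI2])
      next
        case D
        then show ?thesis by (rule disjI2[OF disjI1])
      qed
    qed
  qed
qed

text \<open>Comparing the two middle points horizontally leaves half of \<open>p\<close> entirely to
  one side of half of \<open>q\<close>. Comparing the middle points of these halves vertically
  leaves quarters that are separated in both coordinates, whence 24 = 4 * 6.\<close>

lemma halving:
  assumes mem: "\<And>i. i < 24 \<Longrightarrow> p i \<in> A \<and> q i \<in> A"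
    and p: "chain 24 (\<lambda>i. X (p i))" "chain 24 (\<lambda>i. Y (p i))"
    and q: "chain 24 (\<lambda>i. X (q i))" "chain 24 (\<lambda>i. - Y (q i))"
  shows "has_pattern A X Y (direct_sum inc6 dec6) \<or> has_pattern A X Y (direct_sum dec6 inc6) \<or>
    has_pattern A X Y (skew_sum inc6 dec6) \<or> has_pattern A X Y (skew_sum dec6 inc6)"
proof -
  have le: "X (p i) \<le> X (p j)" "Y (p i) \<le> Y (p j)" "X (q i) \<le> X (q j)" "Y (q j) \<le> Y (q i)"
    if "i \<le> j" "j < 24" for i j
    using that p[unfolded chain_def, rule_format, of i j] q[unfolded chain_def, rule_format, of i j]
    by (cases "i = j"; simp)+
  have lt: "X (p i) < X (p j)" "Y (p i) < Y (p j)" "X (q i) < X (q j)" "Y (q j) < Y (q i)"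
    if "i < j" "j < 24" for i j
    using that p[unfolded chain_def, rule_format, of i j] q[unfolded chain_def, rule_format, of i j] by simp_all
  let ?I = "\<lambda>s. (\<lambda>i. p (s + i)) ` {..<6}" and ?D = "\<lambda>s. (\<lambda>i. q (s + i)) ` {..<6}"
  have I: "has_pattern (?I s) X Y inc6" if "s + 6 \<le> 24" for s by (rule inc_block[of 24 X p Y, OF p that])
  have D: "has_pattern (?D s) X Y dec6" if "s + 6 \<le> 24" for s by (rule dec_block[of 24 X q Y, OF q that])
  have sub: "?I s \<union> ?D t \<subseteq> A" "?D t \<union> ?I s \<subseteq> A" if "s + 6 \<le> 24" "t + 6 \<le> 24" for s t
    using mem that by auto
  have left: ?thesis if "X (p (s + 11)) < X (q t)" "s + 12 \<le> 24" "t + 12 \<le> 24" for s t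
  proof (cases "Y (p (s + 6)) \<le> Y (q (t + 6))")
    case True
    have "has_pattern A X Y (direct_sum inc6 dec6)"
    proof (rule has_mono[OF has_direct_sum[OF I[of s] D[of t] perms6(1,2)]])
      fix a b assume "a \<in> ?I s" "b \<in> ?D t"
      then obtain i j where ij: "a = p (s + i)" "b = q (t + j)" "i < 6" "j < 6" by auto
      then show "X a < X b \<and> Y a < Y b"
        using that True le(1)[of "s + i" "s + 11"] le(3)[of t "t + j"]
          lt(2)[of "s + i" "s + 6"] lt(4)[of "t + j" "t + 6"] by simp
    qed ((rule sub | use that in simp)+)
    then show ?thesis by simp
  next
    case False
    have "has_pattern A X Y (skew_sum inc6 dec6)"
    proof (rule has_mono[OF has_skew[OF I[of "s + 6"] D[of "t + 6"] perms6(1,2)]])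
      fix a b assume "a \<in> ?I (s + 6)" "b \<in> ?D (t + 6)"
      then obtain i j where ij: "a = p (s + 6 + i)" "b = q (t + 6 + j)" "i < 6" "j < 6" by auto
      then show "X a < X b \<and> Y b < Y a"
        using that False le(1)[of "s + 6 + i" "s + 11"] le(3)[of t "t + 6 + j"]
          le(2)[of "s + 6" "s + 6 + i"] le(4)[of "t + 6" "t + 6 + j"] by simp
    qed ((rule sub | use that in simp)+)
    then show ?thesis by simp
  qed
  have right: ?thesis if "X (q (t + 11)) < X (p s)" "s + 12 \<le> 24" "t + 12 \<le> 24" for s t
  proof (cases "Y (p (s + 6)) \<le> Y (q (t + 6))")
    case True
    have "has_pattern A X Y (skew_sum dec6 inc6)"
    proof (rule has_mono[OF has_skew[OF D[of t] I[of s] perms6(2,1)]])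
      fix b a assume "a \<in> ?I s" "b \<in> ?D t"
      then obtain i j where ij: "a = p (s + i)" "b = q (t + j)" "i < 6" "j < 6" by auto
      then show "X b < X a \<and> Y a < Y b"
        using that True le(3)[of "t + j" "t + 11"] le(1)[of s "s + i"]
          lt(2)[of "s + i" "s + 6"] lt(4)[of "t + j" "t + 6"] by simp
    qed ((rule sub | use that in simp)+)
    then show ?thesis by simp
  next
    case False
    have "has_pattern A X Y (direct_sum dec6 inc6)"
    proof (rule has_mono[OF has_direct_sum[OF D[of "t + 6"] I[of "s + 6"] perms6(2,1)]])
      fix b a assume "a \<in> ?I (s + 6)" "b \<in> ?D (t + 6)"
      then obtain i j where ij: "a = p (s + 6 + i)" "b = q (t + 6 + j)" "i < 6" "j < 6" by auto
      then show "X b < X a \<and> Y b < Y a"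
        using that False le(3)[of "t + 6 + j" "t + 11"] le(1)[of s "s + 6 + i"]
          le(2)[of "s + 6" "s + 6 + i"] le(4)[of "t + 6" "t + 6 + j"] by simp
    qed ((rule sub | use that in simp)+)
    then show ?thesis by simp
  qed
  show ?thesis
  proof (cases "X (p 12) \<le> X (q 12)")
    case True
    then show ?thesis using left[of 0 12] lt(1)[of 11 12] by simp
  next
    case False
    then show ?thesis using right[of 0 12] lt(3)[of 11 12] by simp
  qed
qed

section \<open>A uniform bound for the points north-west of a point\<close>

definition mono_pts :: "('a \<Rightarrow> real) \<Rightarrow> ('a \<Rightarrow> real) \<Rightarrow> 'a set \<Rightarrow> bool" where
  "mono_pts X Y A \<longleftrightarrow> incr X Y A \<or> decr X Y A"

definition generic :: "'a set \<Rightarrow> ('a \<Rightarrow> real) \<Rightarrow> ('a \<Rightarrow> real) \<Rightarrow> bool" where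
  "generic P X Y \<longleftrightarrow> finite P \<and> inj_on X P \<and> inj_on Y P \<and> light P X Y"

lemma generic_swap: "generic P X Y \<Longrightarrow> generic P Y X"
  by (simp add: generic_def light_swap)

lemma generic_rotate: "generic P X Y \<Longrightarrow> generic P (\<lambda>p. - X p) (\<lambda>p. - Y p)"
  by (simp add: generic_def light_rotate inj_on_def)

lemma inj_less: "inj_on X P \<Longrightarrow> p \<in> P \<Longrightarrow> q \<in> P \<Longrightarrow> p \<noteq> q \<Longrightarrow> \<not> X p < X q \<Longrightarrow> X q < (X p :: real)"
  by (metis inj_onD linorder_neqE)

lemma mono_pts_swap:
  assumes "inj_on X A" "inj_on Y A" "mono_pts X Y A" shows "mono_pts Y X A"
proof -
  have "incr Y X A" if "incr X Y A"
    unfolding incr_def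
  proof (intro ballI impI)
    fix p q assume *: "p \<in> A" "q \<in> A" "Y p < Y q"
    show "X p < X q"
    proof (rule ccontr)
      assume "\<not> X p < X q"
      then have "X q < X p" using * inj_less[OF assms(1)] by fastforce
      then show False using that * unfolding incr_def by fastforce
    qed
  qed
  moreover have "decr Y X A" if "decr X Y A"
    unfolding decr_def
  proof (intro ballI impI)
    fix p q assume *: "p \<in> A" "q \<in> A" "Y p < Y q"
    show "X q < X p"
    proof (rule ccontr)
      assume "\<not> X q < X p"
      then have "X p < X q" using * inj_less[OF assms(1), of q p] by fastforce
      then show False using that * unfolding decr_def by fastforce
    qed
  qed
  ultimately show ?thesis using assms(3) unfolding mono_pts_def by blast
qed

lemma mono_pts_rotate: "mono_pts X Y A \<Longrightarrow> mono_pts (\<lambda>p. - X p) (\<lambda>p. - Y p) A"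
  unfolding mono_pts_def incr_def decr_def by auto

lemma has_single: "has_pattern {x} X Y [1]"
  unfolding has_pattern_def by (intro exI[of _ "\<lambda>_. x"]) simp

lemma cert1: "light P X Y \<Longrightarrow> cert [(\<tau>, jss)] \<Longrightarrow> has_pattern P X Y \<tau> \<Longrightarrow> False"
  by (rule cert_contradiction[of P X Y "[(\<tau>, jss)]"]) auto

text \<open>A pattern of points north-west of \<open>x\<close> becomes sum-indecomposable when \<open>x\<close> is appended. Each of the
  eight patterns below contains at least \<open>n\<close> permutations of length \<open>n\<close> for all \<open>n \<le> 6\<close>, which
  together with the length-1 pattern is already too much: \<open>1 / xi + (\<Sum>n=1..6. n / xi ^ (n + 1)) > 1\<close>.\<close>

lemma no_bad_NW:
  assumes "light P X Y" "x \<in> P" "A \<subseteq> P" "\<And>a. a \<in> A \<Longrightarrow> X a < X x \<and> Y x < Y a"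
  shows "\<not> has_pattern A X Y (direct_sum inc6 dec6)" "\<not> has_pattern A X Y (direct_sum dec6 inc6)"
    "\<not> has_pattern A X Y (skew_sum inc6 dec6)" "\<not> has_pattern A X Y (skew_sum dec6 inc6)"
    "\<not> has_pattern A X Y (skew_sum inc6 inc6)" "\<not> has_pattern A X Y (complement (skew_sum inc6 inc6))"
    "\<not> has_pattern A X Y layers" "\<not> has_pattern A X Y (complement layers)"
proof -
  have *: "has_pattern P X Y (skew_sum \<tau> [1])" if "has_pattern A X Y \<tau>" "\<tau> \<in> perms" for \<tau>
    by (rule has_mono[OF has_skew[OF that(1) has_single[of x X Y] that(2) perms6(4)]])
      (use assms in auto)
  have p: "skew_sum inc6 dec6 \<in> perms" "skew_sum dec6 inc6 \<in> perms" "direct_sum inc6 dec6 \<in> perms"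
    "direct_sum dec6 inc6 \<in> perms" "skew_sum inc6 inc6 \<in> perms" "complement (skew_sum inc6 inc6) \<in> perms"
    "layers \<in> perms" "complement layers \<in> perms"
    by (rule is_perm; simp add: skew_sum_def direct_sum_def complement_def)+
  have e:
    "skew_sum (direct_sum inc6 dec6) [1] = [2, 3, 4, 5, 6, 7, 13, 12, 11, 10, 9, 8, 1]"
    "skew_sum (direct_sum dec6 inc6) [1] = [7, 6, 5, 4, 3, 2, 8, 9, 10, 11, 12, 13, 1]"
    "skew_sum (skew_sum inc6 dec6) [1] = [8, 9, 10, 11, 12, 13, 7, 6, 5, 4, 3, 2, 1]"
    "skew_sum (skew_sum dec6 inc6) [1] = [13, 12, 11, 10, 9, 8, 2, 3, 4, 5, 6, 7, 1]"
    "skew_sum (skew_sum inc6 inc6) [1] = [8, 9, 10, 11, 12, 13, 2, 3, 4, 5, 6, 7, 1]"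
    "skew_sum (complement (skew_sum inc6 inc6)) [1] = [7, 6, 5, 4, 3, 2, 13, 12, 11, 10, 9, 8, 1]"
    "skew_sum layers [1] = [3, 2, 5, 4, 7, 6, 9, 8, 11, 10, 13, 12, 1]"
    "skew_sum (complement layers) [1] = [12, 13, 10, 11, 8, 9, 6, 7, 4, 5, 2, 3, 1]"
    by code_simp+
  note c = cert1[OF assms(1)]
  show "\<not> has_pattern A X Y (direct_sum inc6 dec6)"
    using c[OF cert_inc_dec] *[OF _ p(3)] unfolding e by blast
  show "\<not> has_pattern A X Y (direct_sum dec6 inc6)"
    using c[OF cert_dec_inc] *[OF _ p(4)] unfolding e by blast
  show "\<not> has_pattern A X Y (skew_sum inc6 dec6)"
    using c[OF cert_inc_skew_dec] *[OF _ p(1)] unfolding e by blast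
  show "\<not> has_pattern A X Y (skew_sum dec6 inc6)"
    using c[OF cert_dec_skew_inc] *[OF _ p(2)] unfolding e by blast
  show "\<not> has_pattern A X Y (skew_sum inc6 inc6)"
    using c[OF cert_inc_skew_inc] *[OF _ p(5)] unfolding e by blast
  show "\<not> has_pattern A X Y (complement (skew_sum inc6 inc6))"
    using c[OF cert_dec_dec] *[OF _ p(6)] unfolding e by blast
  show "\<not> has_pattern A X Y layers"
    using c[OF cert_21s] *[OF _ p(7)] unfolding e by blast
  show "\<not> has_pattern A X Y (complement layers)"
    using c[OF cert_12s] *[OF _ p(8)] unfolding e by blast
qed

text \<open>The bound is uniform in \<open>P\<close>, \<open>X\<close> and \<open>Y\<close>, so it
  also applies after exchanging the coordinates, which turns north-west into south-east. The first
  argument only fixes the type of points.\<close>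

definition near_bound :: "'a itself \<Rightarrow> nat \<Rightarrow> bool" where
  "near_bound _ r \<longleftrightarrow> (\<forall>(P::'a set) X Y x A. generic P X Y \<longrightarrow> x \<in> P \<longrightarrow> A \<subseteq> P \<longrightarrow>
     (\<forall>a\<in>A. X a < X x \<and> Y x < Y a) \<longrightarrow> (\<exists>R\<subseteq>A. card R \<le> r \<and> mono_pts X Y (A - R)))"

text \<open>\<open>near_incr\<close> is applied to \<open>Y\<close> and to \<open>- Y\<close>. If
  both near-monotone outcomes fail, the set contains a decreasing and an increasing sequence of
  length 24, and \<open>halving\<close> produces a forbidden pattern.\<close>

lemma near_mono: "\<exists>r. near_bound TYPE('a) r"
proof -
  obtain r where r: "\<forall>(A::'a set) X Y. finite A \<and> inj_on X A \<and> inj_on Y A \<longrightarrow>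
     (\<exists>R\<subseteq>A. card R \<le> r \<and> incr X Y (A - R)) \<or>
     (\<exists>a. (\<forall>i<24. a i \<in> A) \<and> chain 24 (\<lambda>i. X (a i)) \<and> chain 24 (\<lambda>i. - Y (a i))) \<or>
     has_pattern A X Y (skew_sum inc6 inc6) \<or> has_pattern A X Y layers"
    using near_incr by (rule exE)
  have "\<exists>R\<subseteq>A. card R \<le> r \<and> mono_pts X Y (A - R)"
    if P: "generic P X Y" and x: "x \<in> P" and A: "A \<subseteq> P" and NW: "\<forall>a\<in>A. X a < X x \<and> Y x < Y a"
    for P and A :: "'a set" and X Y x
  proof -
    have g: "light P X Y" and fin: "finite A" "inj_on X A" "inj_on Y A" "inj_on (\<lambda>p. - Y p) A"
      using P A unfolding generic_def
      by (auto intro: finite_subset inj_on_subset simp: inj_on_def subset_iff)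
    note bad = no_bad_NW[OF g x A NW[rule_format]]
    have p: "skew_sum inc6 inc6 \<in> perms" "layers \<in> perms"
      by (rule is_perm; simp add: skew_sum_def)+
    have bad': "\<not> has_pattern A X (\<lambda>p. - Y p) (skew_sum inc6 inc6)" "\<not> has_pattern A X (\<lambda>p. - Y p) layers"
      using has_complement p bad(6,8) by blast+
    note r1 = r[rule_format, of A X Y] and r2 = r[rule_format, of A X "\<lambda>p. - Y p"]
    show ?thesis
    proof (rule ccontr)
      assume no: "\<not> ?thesis"
      have "\<not> (\<exists>R\<subseteq>A. card R \<le> r \<and> incr X Y (A - R))" using no unfolding mono_pts_def by blast
      then have "\<exists>a. (\<forall>i<24. a i \<in> A) \<and> chain 24 (\<lambda>i. X (a i)) \<and> chain 24 (\<lambda>i. - Y (a i))"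
        using r1 fin bad(5,7) by blast
      then obtain q where q: "\<forall>i<24. q i \<in> A" "chain 24 (\<lambda>i. X (q i))" "chain 24 (\<lambda>i. - Y (q i))" by blast
      have "incr X (\<lambda>p. - Y p) B = decr X Y B" for B unfolding incr_def decr_def by simp
      then have "\<not> (\<exists>R\<subseteq>A. card R \<le> r \<and> incr X (\<lambda>p. - Y p) (A - R))"
        using no unfolding mono_pts_def by blast
      then have "\<exists>a. (\<forall>i<24. a i \<in> A) \<and> chain 24 (\<lambda>i. X (a i)) \<and> chain 24 (\<lambda>i. - (- Y (a i)))"
        using r2 fin bad' by blast
      then obtain p where "\<forall>i<24. p i \<in> A" "chain 24 (\<lambda>i. X (p i))" "chain 24 (\<lambda>i. Y (p i))" by auto
      then show False using halving[of p A q X Y] q bad(1-4) by blast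
    qed
  qed
  then show ?thesis unfolding near_bound_def by blast
qed

lemma near_bound_NW:
  assumes "near_bound TYPE('a) r" "generic P X Y" "x \<in> P" "A \<subseteq> (P::'a set)"
    "\<And>a. a \<in> A \<Longrightarrow> X a < X x \<and> Y x < Y a"
  obtains R where "R \<subseteq> A" "card R \<le> r" "mono_pts X Y (A - R)"
proof -
  have "\<exists>R\<subseteq>A. card R \<le> r \<and> mono_pts X Y (A - R)"
    by (rule assms(1)[unfolded near_bound_def, rule_format, OF assms(2-4)]) (use assms(5) in auto)
  then show thesis using that by blast
qed

lemma near_bound_SE:
  assumes "near_bound TYPE('a) r" "generic P X Y" "x \<in> P" "A \<subseteq> (P::'a set)"
    "\<And>a. a \<in> A \<Longrightarrow> X x < X a \<and> Y a < Y x"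
  obtains R where "R \<subseteq> A" "card R \<le> r" "mono_pts X Y (A - R)"
proof -
  obtain R where R: "R \<subseteq> A" "card R \<le> r" "mono_pts Y X (A - R)"
    by (rule near_bound_NW[OF assms(1) generic_swap[OF assms(2)] assms(3,4)]) (use assms(5) in auto)
  have "inj_on X (A - R)" "inj_on Y (A - R)"
    using assms(2,4) unfolding generic_def by (auto intro: inj_on_subset)
  then show thesis using that R mono_pts_swap[of Y "A - R" X] by blast
qed

section \<open>Interleaving and oscillations\<close>

lemma chain_le: "chain n f \<Longrightarrow> k \<le> n \<Longrightarrow> chain k f"
  unfolding chain_def by auto

lemma sorted_chain:
  assumes "finite A" "inj_on X A"
  obtains a where "\<And>i. i < card A \<Longrightarrow> a i \<in> A" "chain (card A) (\<lambda>i. X (a i) :: real)"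
proof -
  define vs where "vs = sorted_list_of_set (X ` A)"
  have len: "length vs = card A" and set: "set vs = X ` A"
    using assms by (simp_all add: vs_def card_image)
  have mem: "vs ! i \<in> X ` A" if "i < card A" for i using nth_mem[of i vs] that unfolding len set .
  have "chain (card A) (\<lambda>i. vs ! i)"
    unfolding chain_def using sorted_wrt_nth_less[of "(<)" vs] len by (simp add: vs_def)
  then have "chain (card A) (\<lambda>i. X (inv_into A X (vs ! i)))"
    using f_inv_into_f[OF mem] unfolding chain_def by simp
  then show thesis using that[of "\<lambda>i. inv_into A X (vs ! i)"] inv_into_into[OF mem] by blast
qed

lemma mono_pts_chain:
  assumes "mono_pts X Y A" "\<And>i. i < n \<Longrightarrow> a i \<in> A" "chain n (\<lambda>i. X (a i))"
  shows "chain n (\<lambda>i. Y (a i)) \<or> chain n (\<lambda>i. - Y (a i))"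
  using assms unfolding mono_pts_def incr_def decr_def chain_def by fastforce

lemma mono_pts_has:
  assumes "finite A" "inj_on X A" "mono_pts X Y A" "k \<le> card A"
  shows "has_pattern A X Y [1..<Suc k] \<or> has_pattern A X Y (rev [1..<Suc k])"
proof -
  obtain a where a: "\<And>i. i < card A \<Longrightarrow> a i \<in> A" "chain (card A) (\<lambda>i. X (a i))"
    using sorted_chain[OF assms(1,2)] by blast
  have X: "chain k (\<lambda>i. X (a i))" by (rule chain_le[OF a(2) assms(4)])
  have mem: "a i \<in> A" if "i < k" for i using a(1) that assms(4) by simp
  then have "a ` {..<k} \<subseteq> A" by auto
  then show ?thesis using mono_pts_chain[OF assms(3) mem X] has_inc[of k X a Y] has_dec[of k X a Y] X
      has_mono[of "a ` {..<k}" X Y _ A] by blast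
qed

text \<open>Four upper and four lower points alternate from left to right. Each side is increasing
  or decreasing, and each of the four combinations has its own certificate.\<close>

lemma alternation_False:
  assumes "light P X Y"
    and mem: "\<And>i. i < 4 \<Longrightarrow> s i \<in> A \<and> t i \<in> B" and sub: "A \<subseteq> P" "B \<subseteq> P"
    and mono: "mono_pts X Y A" "mono_pts X Y B"
    and AB: "\<And>a b. a \<in> A \<Longrightarrow> b \<in> B \<Longrightarrow> Y b < Y a"
    and alt: "\<And>i. i < 4 \<Longrightarrow> X (s i) < X (t i)" "\<And>i. i < 3 \<Longrightarrow> X (t i) < X (s (Suc i))"
  shows False
proof -
  let ?e = "\<lambda>i. if even i then s (i div 2) else t (i div 2)"
  have e: "X (?e i) < X (?e (Suc i))" if "Suc i < 8" for i
  proof (cases "even i")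
    case True
    then have "Suc i div 2 = i div 2" by simp
    then show ?thesis using True alt(1)[of "i div 2"] that by simp
  next
    case False
    then have "Suc i div 2 = Suc (i div 2)" "even (Suc i)" by presburger+
    moreover have "i div 2 < 3" using False that by presburger
    ultimately show ?thesis using False alt(2)[of "i div 2"] by simp
  qed
  have cs: "chain 4 (\<lambda>i. X (s i))" "chain 4 (\<lambda>i. X (t i))"
  proof -
    have "X (s i) < X (s (Suc i))" "X (t i) < X (t (Suc i))" if "Suc i < 4" for i
      using alt(1)[of i] alt(1)[of "Suc i"] alt(2)[of i] that by auto
    then show "chain 4 (\<lambda>i. X (s i))" "chain 4 (\<lambda>i. X (t i))" by (auto intro: chain_Suc)
  qed
  have key: False if c: "cert [(\<tau>, jss)]" and len: "length \<tau> = 8"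
    and h: "\<And>i. i < 8 \<Longrightarrow> 1 \<le> \<tau> ! i \<and> \<tau> ! i \<le> 8 \<and> Y (?e i) = h (\<tau> ! i - 1)" "chain 8 h" for \<tau> jss h
  proof -
    have "has_pattern P X Y \<tau>"
    proof (rule hasI[where e = ?e and h = h])
      show "chain (length \<tau>) (\<lambda>i. X (?e i))" unfolding len using e by (rule chain_Suc)
      show "?e i \<in> P" if "i < length \<tau>" for i using mem[of "i div 2"] sub that len by auto
    qed (use h len in auto)
    then show False by (rule cert1[OF assms(1) c])
  qed
  have lt8: "i = 0 \<or> i = 1 \<or> i = 2 \<or> i = 3 \<or> i = 4 \<or> i = 5 \<or> i = 6 \<or> i = 7" if "i < 8" for i :: nat
    using that by linarith
  have join: "chain 8 (\<lambda>i. if i < 4 then f i else g (i - 4))"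
    if "chain 4 f" "chain 4 g" "f 3 < g 0" for f g
  proof (rule chain_Suc)
    fix i :: nat assume i: "Suc i < 8"
    consider "Suc i < 4" | "i = 3" | "4 \<le> i" by linarith
    then show "(if i < 4 then f i else g (i - 4)) < (if Suc i < 4 then f (Suc i) else g (Suc i - 4))"
    proof cases
      case 3
      then have "Suc i - 4 = Suc (i - 4)" by simp
      then show ?thesis using 3 i that(2) unfolding chain_def by simp
    qed (use that in \<open>simp_all add: chain_def\<close>)
  qed
  have m: "s i \<in> A" "t i \<in> B" if "i < 4" for i using mem that by auto
  have ends: "Y (t i) < Y (s j)" if "i < 4" "j < 4" for i j using AB m that by blast
  consider (ii) "chain 4 (\<lambda>i. Y (s i))" "chain 4 (\<lambda>i. Y (t i))"
    | (id) "chain 4 (\<lambda>i. Y (s i))" "chain 4 (\<lambda>i. - Y (t i))"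
    | (di) "chain 4 (\<lambda>i. - Y (s i))" "chain 4 (\<lambda>i. Y (t i))"
    | (dd) "chain 4 (\<lambda>i. - Y (s i))" "chain 4 (\<lambda>i. - Y (t i))"
    using mono_pts_chain[OF mono(1) m(1) cs(1)] mono_pts_chain[OF mono(2) m(2) cs(2)] by blast
  then show False
  proof cases
    case ii
    show False
    proof (rule key[OF cert_alt_ii])
      show "chain 8 (\<lambda>i. if i < 4 then Y (t i) else Y (s (i - 4)))"
        using ii ends by (intro join) auto
    qed (auto dest!: lt8)
  next
    case id
    show False
    proof (rule key[OF cert_alt_id])
      show "chain 8 (\<lambda>i. if i < 4 then Y (t (4 - Suc i)) else Y (s (i - 4)))"
        using id(1) chain_rev[OF id(2)] ends by (intro join) auto
    qed (auto dest!: lt8)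
  next
    case di
    show False
    proof (rule key[OF cert_alt_di])
      show "chain 8 (\<lambda>i. if i < 4 then Y (t i) else Y (s (4 - Suc (i - 4))))"
        using di(2) chain_rev[OF di(1)] ends by (intro join[of "\<lambda>i. Y (t i)" "\<lambda>i. Y (s (4 - Suc i))"]) auto
    qed (auto dest!: lt8)
  next
    case dd
    show False
    proof (rule key[OF cert_alt_dd])
      show "chain 8 (\<lambda>i. if i < 4 then Y (t (4 - Suc i)) else Y (s (4 - Suc (i - 4))))"
        using chain_rev[OF dd(1)] chain_rev[OF dd(2)] ends
        by (intro join[of "\<lambda>i. Y (t (4 - Suc i))" "\<lambda>i. Y (s (4 - Suc i))"]) auto
    qed (auto dest!: lt8)
  qed
qed

text \<open>The sets cut off by the points of \<open>A\<close> are nested, so distinct ones have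
  distinct cardinalities and can be listed by size. Between the points of \<open>A\<close> that cut
  off two successive ones lies a point of \<open>B\<close>.\<close>

lemma interleaving_sequence:
  fixes X :: "'a \<Rightarrow> real"
  assumes fin: "finite A" "finite B" and n: "n < card ((\<lambda>a. {b \<in> B. X b < X a}) ` A)"
  obtains s t where "\<And>i. i \<le> n \<Longrightarrow> s i \<in> A" "\<And>i. i < n \<Longrightarrow> t i \<in> B"
    "\<And>i. i < n \<Longrightarrow> X (s i) \<le> X (t i)" "\<And>i. i < n \<Longrightarrow> X (t i) < X (s (Suc i))"
proof -
  let ?l = "\<lambda>a. {b \<in> B. X b < X a}"
  have nested: "?l a \<subseteq> ?l a' \<or> ?l a' \<subseteq> ?l a" for a a'
    by (cases "X a \<le> X a'") auto
  have "inj_on card (?l ` A)"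
  proof (rule inj_onI)
    fix U V assume UV: "U \<in> ?l ` A" "V \<in> ?l ` A" "card U = card V"
    then have "finite U" "finite V" using fin by auto
    moreover have "U \<subseteq> V \<or> V \<subseteq> U" using UV nested by auto
    ultimately show "U = V" using UV(3) card_subset_eq by metis
  qed
  then have card: "card (card ` ?l ` A) = card (?l ` A)" by (rule card_image)
  define vs where "vs = sorted_list_of_set (card ` ?l ` A)"
  have len: "n < length vs" using n card by (simp add: vs_def)
  have set: "set vs = card ` ?l ` A" using fin by (simp add: vs_def)
  have "\<exists>a\<in>A. card (?l a) = vs ! i" if "i \<le> n" for i
  proof -
    have "vs ! i \<in> card ` ?l ` A" using that len set nth_mem[of i vs] by simp
    then show ?thesis by auto
  qed
  then obtain s where s: "\<And>i. i \<le> n \<Longrightarrow> s i \<in> A \<and> card (?l (s i)) = vs ! i" by metis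
  have "\<exists>b\<in>B. X (s i) \<le> X b \<and> X b < X (s (Suc i))" if "i < n" for i
  proof (rule ccontr)
    assume "\<not> ?thesis"
    then have "?l (s (Suc i)) \<subseteq> ?l (s i)" by (auto simp: not_le)
    then have "card (?l (s (Suc i))) \<le> card (?l (s i))" using fin by (intro card_mono) auto
    moreover have "vs ! i < vs ! Suc i"
      using that len sorted_wrt_nth_less[of "(<)" vs i "Suc i"] by (simp add: vs_def)
    ultimately show False using s that by simp
  qed
  then obtain t where "\<And>i. i < n \<Longrightarrow> t i \<in> B \<and> X (s i) \<le> X (t i) \<and> X (t i) < X (s (Suc i))" by metis
  then show thesis using that[of s t] s by blast
qed

text \<open>Five distinct sets would yield five points of one side alternating with four of the
  other, which contains the alternation of eight points excluded above.\<close>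

lemma alternation:
  assumes gen: "generic P X Y" and sub: "A \<subseteq> P" "B \<subseteq> P"
    and mono: "mono_pts X Y A" "mono_pts X Y B"
    and AB: "\<And>a b. a \<in> A \<Longrightarrow> b \<in> B \<Longrightarrow> Y b < Y a"
  shows "card ((\<lambda>a. {b \<in> B. X b < X a}) ` A) \<le> 4" "card ((\<lambda>b. {a \<in> A. X a < X b}) ` B) \<le> 4"
proof -
  have fin: "finite A" "finite B" and g: "light P X Y"
    using gen sub by (auto simp: generic_def finite_subset)
  have strict: "X a < X b" if "X a \<le> X b" "a \<in> A" "b \<in> B" for a b
    using that gen sub AB[OF that(2,3)] unfolding generic_def
    by (metis inj_onD in_mono order_less_irrefl order_less_le)
  have strict': "X b < X a" if "X b \<le> X a" "a \<in> A" "b \<in> B" for a b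
    using that gen sub AB[OF that(2,3)] unfolding generic_def
    by (metis inj_onD in_mono order_less_irrefl order_less_le)
  show "card ((\<lambda>a. {b \<in> B. X b < X a}) ` A) \<le> 4"
  proof (rule ccontr)
    assume "\<not> ?thesis"
    then have "4 < card ((\<lambda>a. {b \<in> B. X b < X a}) ` A)" by simp
    then obtain s t where st: "\<And>i. i \<le> 4 \<Longrightarrow> s i \<in> A" "\<And>i. i < 4 \<Longrightarrow> t i \<in> B"
        "\<And>i. i < 4 \<Longrightarrow> X (s i) \<le> X (t i)" "\<And>i. i < 4 \<Longrightarrow> X (t i) < X (s (Suc i))"
      using interleaving_sequence[OF fin, of 4 X] by blast
    show False
      by (rule alternation_False[OF g _ sub mono AB, where s = s and t = t]) (use st strict in auto)
  qed
  show "card ((\<lambda>b. {a \<in> A. X a < X b}) ` B) \<le> 4"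
  proof (rule ccontr)
    assume "\<not> ?thesis"
    then have "4 < card ((\<lambda>b. {a \<in> A. X a < X b}) ` B)" by simp
    then obtain s t where st: "\<And>i. i \<le> 4 \<Longrightarrow> s i \<in> B" "\<And>i. i < 4 \<Longrightarrow> t i \<in> A"
        "\<And>i. i < 4 \<Longrightarrow> X (s i) \<le> X (t i)" "\<And>i. i < 4 \<Longrightarrow> X (t i) < X (s (Suc i))"
      using interleaving_sequence[OF fin(2,1), of 4 X] by blast
    \<comment> \<open>The alternation must start on the upper side, and here the first point belongs
      to \<open>B\<close>. It is dropped, and the fifth point of \<open>B\<close> ends the
      sequence.\<close>
    show False
      by (rule alternation_False[OF g _ sub mono AB, where s = t and t = "\<lambda>i. s (Suc i)"])
        (use st strict' in auto)
  qed
qed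

text \<open>The coordinates are swapped in the recursive call: the links of a chain lie alternately
  south-east and north-west of the last chosen point.\<close>

fun long_chain :: "nat \<Rightarrow> ('a \<Rightarrow> real) \<Rightarrow> ('a \<Rightarrow> real) \<Rightarrow> nat \<Rightarrow> 'a \<Rightarrow> 'a set \<Rightarrow> bool" where
  "long_chain d X Y 0 z W \<longleftrightarrow> True"
| "long_chain d X Y (Suc T) z W \<longleftrightarrow> d < card {w \<in> W. X z < X w} \<and>
     (\<exists>w\<in>W. X z < X w \<and> long_chain d Y X T w (W - {w \<in> W. X z < X w}))"

text \<open>From left to right, w4, w5, w2, w3, z, w1 form 315264, which is why five steps are
  taken. Only the first two links have to be large. They lie south-east of \<open>z\<close> and
  north-west of \<open>w1\<close>, so without \<open>r\<close> exceptions they still contain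
  monotone sequences of length 5. \<open>cert_osc_dec\<close> forces these to increase, and
  \<open>cert_osc_inc\<close> then gives the contradiction.\<close>

lemma long_chain_False:
  fixes W :: "'a set"
  assumes nb: "near_bound TYPE('a) r" and gen: "generic P X Y" and z: "z \<in> P" and W: "W \<subseteq> P"
    and below: "\<And>w. w \<in> W \<Longrightarrow> Y w < Y z" and long_chain: "long_chain d X Y (Suc (Suc (Suc (Suc (Suc 0))))) z W"
    and d: "r + 5 \<le> d"
  shows False
proof -
  have g: "light P X Y" and inj: "inj_on X P" "inj_on Y P" and fin: "finite P"
    using gen by (auto simp: generic_def)
  define W1 where "W1 = W - {w \<in> W. X z < X w}"
  obtain w1 where w1: "w1 \<in> W" "X z < X w1" "long_chain d Y X (Suc (Suc (Suc (Suc 0)))) w1 W1"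
    and c1: "d < card {w \<in> W. X z < X w}"
    using iffD1[OF long_chain.simps(2) long_chain] unfolding W1_def by blast
  define W2 where "W2 = W1 - {w \<in> W1. Y w1 < Y w}"
  obtain w2 where w2: "w2 \<in> W1" "Y w1 < Y w2" "long_chain d X Y (Suc (Suc (Suc 0))) w2 W2"
    and c2: "d < card {w \<in> W1. Y w1 < Y w}"
    using iffD1[OF long_chain.simps(2) w1(3)] unfolding W2_def by blast
  define W3 where "W3 = W2 - {w \<in> W2. X w2 < X w}"
  obtain w3 where w3: "w3 \<in> W2" "X w2 < X w3" "long_chain d Y X (Suc (Suc 0)) w3 W3"
    using iffD1[OF long_chain.simps(2) w2(3)] unfolding W3_def by blast
  define W4 where "W4 = W3 - {w \<in> W3. Y w3 < Y w}"
  obtain w4 where w4: "w4 \<in> W3" "Y w3 < Y w4" "long_chain d X Y (Suc 0) w4 W4"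
    using iffD1[OF long_chain.simps(2) w3(3)] unfolding W4_def by blast
  obtain w5 where w5: "w5 \<in> W4" "X w4 < X w5"
    using iffD1[OF long_chain.simps(2) w4(3)] by blast
  have sub: "W1 \<subseteq> W" "W2 \<subseteq> W1" "W3 \<subseteq> W2" "W4 \<subseteq> W3"
    by (auto simp: W1_def W2_def W3_def W4_def)
  have subP: "W1 \<subseteq> P" by (rule order.trans[OF sub(1) W])
  then have subP2: "W2 \<subseteq> P" by (rule order.trans[OF sub(2)])
  then have subP3: "W3 \<subseteq> P" by (rule order.trans[OF sub(3)])
  then have subP4: "W4 \<subseteq> P" by (rule order.trans[OF sub(4)])
  have in_P: "w1 \<in> P" "w2 \<in> P" "w3 \<in> P" "w4 \<in> P" "w5 \<in> P"
    using w1(1) w2(1) w3(1) w4(1) w5(1) W subP subP2 subP3 subP4 by auto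
  have left1: "X w < X z" if "w \<in> W1" for w
  proof -
    have "w \<in> W" "\<not> X z < X w" using that by (auto simp: W1_def)
    then show ?thesis using inj_less[OF inj(1) z, of w] W below[of w] by auto
  qed
  have below2: "Y w < Y w1" if "w \<in> W2" for w
  proof -
    have "w \<in> W1" "\<not> Y w1 < Y w" using that by (auto simp: W2_def)
    moreover from this have "w1 \<noteq> w" using subP left1[of w] w1(2) by auto
    ultimately show ?thesis using inj_less[OF inj(2) in_P(1), of w] subP by blast
  qed
  have left3: "X w < X w2" if "w \<in> W3" for w
  proof -
    have "w \<in> W2" "\<not> X w2 < X w" using that by (auto simp: W3_def)
    moreover from this have "w2 \<noteq> w" using subP2 below2[of w] w2(2) by auto
    ultimately show ?thesis using inj_less[OF inj(1) in_P(2), of w] subP2 by blast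
  qed
  have below4: "Y w < Y w3" if "w \<in> W4" for w
  proof -
    have "w \<in> W3" "\<not> Y w3 < Y w" using that by (auto simp: W4_def)
    moreover from this have "w3 \<noteq> w" using subP3 left3[of w] w3(2) by auto
    ultimately show ?thesis using inj_less[OF inj(2) in_P(3), of w] subP3 by blast
  qed
  have X: "X w4 < X w5" "X w5 < X w2" "X w2 < X w3" "X w3 < X z" "X z < X w1"
    using w5 left3[of w5] w3(2) left1[of w3] w1(2) w3(1) sub by auto
  have Y: "Y w5 < Y w3" "Y w3 < Y w4" "Y w4 < Y w1" "Y w1 < Y w2" "Y w2 < Y z"
    using below4[OF w5(1)] w4 below2[of w4] w2 below[of w2] sub by auto
  have osc: "has_pattern P X Y [3, 1, 5, 2, 6, 4]"
  proof -
    let ?e = "\<lambda>i. [w4, w5, w2, w3, z, w1] ! i" and ?h = "\<lambda>i. [Y w5, Y w3, Y w4, Y w1, Y w2, Y z] ! i"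
    have lt6: "i = 0 \<or> i = 1 \<or> i = 2 \<or> i = 3 \<or> i = 4 \<or> i = 5" if "i < 6" for i :: nat
      using that by linarith
    have lt5: "i = 0 \<or> i = 1 \<or> i = 2 \<or> i = 3 \<or> i = 4" if "i < 5" for i :: nat
      using that by linarith
    have "chain 6 (\<lambda>i. X (?e i))"
      by (rule chain_Suc) (use X in \<open>auto dest!: lt5\<close>)
    moreover have "chain 6 ?h"
      by (rule chain_Suc) (use Y in \<open>auto dest!: lt5\<close>)
    moreover have len: "length [3, 1, 5, 2, 6, 4::nat] = 6" by simp
    ultimately show ?thesis
      by (intro hasI[where \<tau> = "[3, 1, 5, 2, 6, 4]" and e = ?e and h = ?h, unfolded len])
        (use in_P z in \<open>auto dest!: lt6\<close>)
  qed
  have five: "[1..<Suc 5] = [1, 2, 3, 4, 5]" "rev [1..<Suc 5] = [5, 4, 3, 2, 1]"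
    by (simp_all add: upt_rec)
  have perm5: "[1, 2, 3, 4, 5] \<in> perms" by (rule is_perm) simp_all
  have mono5: "has_pattern (A - R) X Y [1, 2, 3, 4, 5]"
    if "A \<subseteq> P" "R \<subseteq> A" "card R \<le> r" "mono_pts X Y (A - R)" "d < card A" for A R
  proof -
    have fA: "finite A" using that(1) fin finite_subset by blast
    then have "card (A - R) = card A - card R" using that(2) by (simp add: card_Diff_subset finite_subset)
    then have "5 \<le> card (A - R)" using that d by simp
    moreover have "inj_on X (A - R)" using inj(1) that(1) by (auto intro: inj_on_subset)
    ultimately have "has_pattern (A - R) X Y [1, 2, 3, 4, 5] \<or> has_pattern (A - R) X Y [5, 4, 3, 2, 1]"
      using mono_pts_has[of "A - R" X Y 5] fA that(4) unfolding five by simp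
    moreover have "\<not> has_pattern (A - R) X Y [5, 4, 3, 2, 1]"
    proof
      assume "has_pattern (A - R) X Y [5, 4, 3, 2, 1]"
      then have "has_pattern P X Y [5, 4, 3, 2, 1]" using that(1) by (blast intro: has_mono)
      then show False using osc
        by (intro cert_contradiction[OF g _ cert_osc_dec]) auto
    qed
    ultimately show ?thesis by blast
  qed
  let ?Z1 = "{w \<in> W. X z < X w}" and ?Z2 = "{w \<in> W1. Y w1 < Y w}"
  have Z: "?Z1 \<subseteq> P" "?Z2 \<subseteq> P" using W sub by auto
  obtain R1 where R1: "R1 \<subseteq> ?Z1" "card R1 \<le> r" "mono_pts X Y (?Z1 - R1)"
    by (rule near_bound_SE[OF nb gen z Z(1)]) (use below in auto)
  obtain R2 where R2: "R2 \<subseteq> ?Z2" "card R2 \<le> r" "mono_pts X Y (?Z2 - R2)"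
    by (rule near_bound_NW[OF nb gen in_P(1) Z(2)]) (use left1 w1(2) in force)+
  have "has_pattern P X Y (skew_sum [1] [1, 2, 3, 4, 5])"
    by (rule has_mono[OF has_skew[OF has_single mono5[OF Z(1) R1 c1] perms6(4) perm5]])
      (use z Z below in auto)
  moreover have "skew_sum [1] [1, 2, 3, 4, 5] = [6, 1, 2, 3, 4, 5]" by code_simp
  ultimately have a: "has_pattern P X Y [6, 1, 2, 3, 4, 5]" by simp
  have "has_pattern P X Y (skew_sum [1, 2, 3, 4, 5] [1])"
    by (rule has_mono[OF has_skew[OF mono5[OF Z(2) R2 c2] has_single[of w1] perm5 perms6(4)]])
      (use in_P Z left1 w1(2) in force)+
  moreover have "skew_sum [1, 2, 3, 4, 5] [1] = [2, 3, 4, 5, 6, 1]" by code_simp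
  ultimately have b: "has_pattern P X Y [2, 3, 4, 5, 6, 1]" by simp
  show False
    using osc a b by (intro cert_contradiction[OF g _ cert_osc_inc]) auto
qed

section \<open>Decomposition into independent blocks\<close>

text \<open>This expresses independence without minima and maxima. For disjoint sets with distinct
  coordinates, the spanned intervals meet exactly when a point of one set lies strictly between two
  points of the other. The condition is invariant under negating a coordinate.\<close>

definition straddled :: "('a \<Rightarrow> real) \<Rightarrow> 'a set \<Rightarrow> 'a \<Rightarrow> bool" where
  "straddled X B p \<longleftrightarrow> (\<exists>b\<in>B. \<exists>b'\<in>B. X b < X p \<and> X p < X b')"

definition indep_sets :: "('a \<Rightarrow> real) \<Rightarrow> ('a \<Rightarrow> real) \<Rightarrow> 'a set \<Rightarrow> 'a set \<Rightarrow> bool" where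
  "indep_sets X Y A B \<longleftrightarrow> A \<inter> B = {} \<and>
     (\<forall>a\<in>A. \<not> straddled X B a \<and> \<not> straddled Y B a) \<and> (\<forall>b\<in>B. \<not> straddled X A b \<and> \<not> straddled Y A b)"

definition blocks :: "('a \<Rightarrow> real) \<Rightarrow> ('a \<Rightarrow> real) \<Rightarrow> 'a set set \<Rightarrow> bool" where
  "blocks X Y \<P> \<longleftrightarrow> (\<forall>A\<in>\<P>. \<forall>B\<in>\<P>. A \<noteq> B \<longrightarrow> indep_sets X Y A B)"

lemma indep_sets_sym: "indep_sets X Y A B \<Longrightarrow> indep_sets X Y B A"
  unfolding indep_sets_def by auto

lemma indep_sets_swap: "indep_sets X Y A B \<longleftrightarrow> indep_sets Y X A B"
  unfolding indep_sets_def by auto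

lemma blocks_swap: "blocks X Y \<P> \<longleftrightarrow> blocks Y X \<P>"
  unfolding blocks_def using indep_sets_swap by metis

lemma straddled_neg: "straddled (\<lambda>p. - X p) B p \<longleftrightarrow> straddled X B p"
  unfolding straddled_def by auto

lemma blocks_neg1: "blocks (\<lambda>p. - X p) Y \<P> \<longleftrightarrow> blocks X Y \<P>"
  unfolding blocks_def indep_sets_def straddled_neg ..

lemma blocks_rotate: "blocks (\<lambda>p. - X p) (\<lambda>p. - Y p) \<P> \<longleftrightarrow> blocks X Y \<P>"
  unfolding blocks_def indep_sets_def straddled_neg ..

lemma blocks_Un:
  assumes "blocks X Y \<P>" "blocks X Y \<Q>" "\<And>A B. A \<in> \<P> \<Longrightarrow> B \<in> \<Q> \<Longrightarrow> indep_sets X Y A B"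
  shows "blocks X Y (\<P> \<union> \<Q>)"
  using assms indep_sets_sym unfolding blocks_def by (metis Un_iff)

lemma not_straddled_less: "(\<And>b. b \<in> B \<Longrightarrow> X p < X b) \<Longrightarrow> \<not> straddled X B p"
  and not_straddled_greater: "(\<And>b. b \<in> B \<Longrightarrow> X b < X p) \<Longrightarrow> \<not> straddled X B p"
  unfolding straddled_def by fastforce+

section \<open>Cutting a monotone link into classes\<close>

abbreviation below :: "('a \<Rightarrow> real) \<Rightarrow> 'a set \<Rightarrow> 'a \<Rightarrow> 'a set" where
  "below X U p \<equiv> {u \<in> U. X u < X p}"

text \<open>The set \<open>M\<close> is cut horizontally at the points of \<open>U\<close> and
  vertically at those of \<open>W\<close>: two points stay together unless a point of
  \<open>U\<close> separates them in \<open>X\<close> or one of \<open>W\<close> separates them in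
  \<open>Y\<close>.\<close>

definition classes :: "('a \<Rightarrow> real) \<Rightarrow> ('a \<Rightarrow> real) \<Rightarrow> 'a set \<Rightarrow> 'a set \<Rightarrow> 'a set \<Rightarrow> 'a set set" where
  "classes X Y U M W = (\<lambda>m. {m' \<in> M. below X U m' = below X U m \<and> below Y W m' = below Y W m}) ` M"

lemma Union_classes: "\<Union>(classes X Y U M W) = M"
  unfolding classes_def by auto

lemma class_subset: "A \<in> classes X Y U M W \<Longrightarrow> A \<subseteq> M"
  unfolding classes_def by auto

lemma card_classes:
  assumes "finite M" "card (below X U ` M) \<le> k" "card (below Y W ` M) \<le> l"
  shows "finite (classes X Y U M W) \<and> card (classes X Y U M W) \<le> k * l"
proof -
  let ?g = "\<lambda>(u, w). {m' \<in> M. below X U m' = u \<and> below Y W m' = w}"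
  have "classes X Y U M W \<subseteq> ?g ` (below X U ` M \<times> below Y W ` M)" unfolding classes_def by auto
  moreover have fin: "finite (below X U ` M \<times> below Y W ` M)" using assms(1) by simp
  ultimately have "card (classes X Y U M W) \<le> card (below X U ` M \<times> below Y W ` M)"
    using surj_card_le by blast
  also have "\<dots> \<le> k * l" using assms by (simp add: card_cartesian_product mult_le_mono)
  finally show ?thesis using assms(1) by (simp add: classes_def)
qed

lemma class_eq:
  assumes "A \<in> classes X Y U M W" "b \<in> A"
  shows "A = {a \<in> M. below X U a = below X U b \<and> below Y W a = below Y W b}"
proof -
  obtain m where "A = {m' \<in> M. below X U m' = below X U m \<and> below Y W m' = below Y W m}"
    using assms(1) unfolding classes_def by (rule imageE)
  then show ?thesis using assms(2) by simp
qed

lemma class_same: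
  assumes "A \<in> classes X Y U M W" "b \<in> A" "b' \<in> A"
  shows "below X U b' = below X U b" "below Y W b' = below Y W b"
proof -
  have "b' \<in> {a \<in> M. below X U a = below X U b \<and> below Y W a = below Y W b}"
    using class_eq[OF assms(1,2)] assms(3) by simp
  then show "below X U b' = below X U b" "below Y W b' = below Y W b" by simp_all
qed

lemma class_not_straddled:
  assumes "A \<in> classes X Y U M W"
  shows "u \<in> U \<Longrightarrow> \<not> straddled X A u" "w \<in> W \<Longrightarrow> \<not> straddled Y A w"
proof -
  show "\<not> straddled X A u" if "u \<in> U"
  proof
    assume "straddled X A u"
    then obtain b b' where b: "b \<in> A" "b' \<in> A" "X b < X u" "X u < X b'" unfolding straddled_def by blast
    have "u \<in> below X U b'" using that b by simp
    then have "u \<in> below X U b" unfolding class_same(1)[OF assms b(1,2)] .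
    then show False using b by simp
  qed
  show "\<not> straddled Y A w" if "w \<in> W"
  proof
    assume "straddled Y A w"
    then obtain b b' where b: "b \<in> A" "b' \<in> A" "Y b < Y w" "Y w < Y b'" unfolding straddled_def by blast
    have "w \<in> below Y W b'" using that b by simp
    then have "w \<in> below Y W b" unfolding class_same(2)[OF assms b(1,2)] .
    then show False using b by simp
  qed
qed

text \<open>On a monotone set, lying between two points in \<open>X\<close> implies lying between
  them in \<open>Y\<close>. The cut-off sets of the middle point are therefore squeezed between
  equal sets.\<close>

lemma class_convex:
  assumes "mono_pts X Y M" "b \<in> M" "a \<in> M" "b' \<in> M" "X b < X a" "X a < X b'"
    "below X U b = below X U b'" "below Y W b = below Y W b'"
  shows "below X U a = below X U b \<and> below Y W a = below Y W b"
proof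
  have "below X U b \<subseteq> below X U a" "below X U a \<subseteq> below X U b'" using assms(5,6) by auto
  then show "below X U a = below X U b" using assms(7) by auto
  have "Y b < Y a \<and> Y a < Y b' \<or> Y b' < Y a \<and> Y a < Y b"
    using assms(1-6) unfolding mono_pts_def incr_def decr_def by blast
  then have "below Y W b \<subseteq> below Y W a \<and> below Y W a \<subseteq> below Y W b' \<or>
      below Y W b' \<subseteq> below Y W a \<and> below Y W a \<subseteq> below Y W b"
    by auto
  then show "below Y W a = below Y W b" using assms(8) by auto
qed

lemma classes_not_straddled:
  assumes "mono_pts X Y M" "A \<in> classes X Y U M W" "a \<in> M" "a \<notin> A"
  shows "\<not> straddled X A a"
proof
  assume "straddled X A a"
  then obtain b b' where b: "b \<in> A" "b' \<in> A" "X b < X a" "X a < X b'" unfolding straddled_def by blast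
  have "A \<subseteq> M" by (rule class_subset[OF assms(2)])
  then have M: "b \<in> M" "b' \<in> M" using b by auto
  have "below X U a = below X U b \<and> below Y W a = below Y W b"
    by (rule class_convex[OF assms(1) M(1) assms(3) M(2) b(3,4)])
      (rule class_same[OF assms(2) b(2,1)])+
  then have "a \<in> A" using class_eq[OF assms(2) b(1)] assms(3) by simp
  then show False using assms(4) by contradiction
qed

lemma classes_swap: "classes X Y U M W = classes Y X W M U"
  unfolding classes_def by (simp add: conj_commute)

text \<open>By convexity a class straddles no point of \<open>M\<close> outside it in
  \<open>X\<close>. Since \<open>M\<close> is also monotone with the coordinates exchanged, the same
  holds in \<open>Y\<close>.\<close>

lemma blocks_classes:
  assumes "inj_on X M" "inj_on Y M" "mono_pts X Y M"
  shows "blocks X Y (classes X Y U M W)"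
  unfolding blocks_def
proof (intro ballI impI)
  fix A B assume AB: "A \<in> classes X Y U M W" "B \<in> classes X Y U M W" "A \<noteq> B"
  have sub: "A \<subseteq> M" "B \<subseteq> M" using AB(1,2) by (auto dest: class_subset)
  have "A = B" if "x \<in> A" "x \<in> B" for x
    using class_eq[OF AB(1) that(1)] class_eq[OF AB(2) that(2)] by simp
  then have disj: "A \<inter> B = {}" using AB(3) by blast
  have "\<not> straddled X B a \<and> \<not> straddled Y B a" if "a \<in> A" for a
    using classes_not_straddled[OF assms(3) AB(2), of a]
      classes_not_straddled[OF mono_pts_swap[OF assms] AB(2)[unfolded classes_swap[of X Y]], of a]
      that disj sub by blast
  moreover have "\<not> straddled X A b \<and> \<not> straddled Y A b" if "b \<in> B" for b
    using classes_not_straddled[OF assms(3) AB(1), of b]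
      classes_not_straddled[OF mono_pts_swap[OF assms] AB(1)[unfolded classes_swap[of X Y]], of b]
      that disj sub by blast
  ultimately show "indep_sets X Y A B" using disj unfolding indep_sets_def by blast
qed

text \<open>Here \<open>Z\<close> is a monotone link lying above \<open>W\<close>, so that the two only interleave horizontally. The last
  two conditions allow \<open>Z\<close> to be cut into few pieces that are independent of the pieces of \<open>W\<close>.\<close>

definition splits :: "nat \<Rightarrow> nat \<Rightarrow> ('a \<Rightarrow> real) \<Rightarrow> ('a \<Rightarrow> real) \<Rightarrow> 'a set \<Rightarrow> 'a set \<Rightarrow> bool" where
  "splits q r X Y Z W \<longleftrightarrow> (\<exists>R \<P>. R \<subseteq> W \<and> card R \<le> r \<and> finite \<P> \<and> card \<P> \<le> q \<and> \<Union>\<P> = W - R \<and>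
     blocks X Y \<P> \<and> (\<forall>A\<in>\<P>. \<forall>z\<in>Z. \<not> straddled X A z) \<and> card (below X (W - R) ` Z) \<le> 4)"

lemma splitsE:
  assumes "splits q r X Y Z W"
  obtains R \<P> where "R \<subseteq> W" "card R \<le> r" "finite \<P>" "card \<P> \<le> q" "\<Union>\<P> = W - R"
    "blocks X Y \<P>" "\<And>A z. A \<in> \<P> \<Longrightarrow> z \<in> Z \<Longrightarrow> \<not> straddled X A z" "card (below X (W - R) ` Z) \<le> 4"
proof -
  from assms obtain R \<P> where *: "R \<subseteq> W" "card R \<le> r" "finite \<P>" "card \<P> \<le> q" "\<Union>\<P> = W - R"
     "blocks X Y \<P>" "\<forall>A\<in>\<P>. \<forall>z\<in>Z. \<not> straddled X A z" "card (below X (W - R) ` Z) \<le> 4"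
    unfolding splits_def by (elim exE conjE) (rule that; assumption)
  show thesis by (rule that[OF *(1-6) _ *(8)]) (use *(7) in blast)
qed

lemma indep_left:
  assumes "\<And>a w. a \<in> A \<Longrightarrow> w \<in> B \<Longrightarrow> X w < X a" "\<And>a. a \<in> A \<Longrightarrow> \<not> straddled Y B a" "\<And>w. w \<in> B \<Longrightarrow> \<not> straddled Y A w"
  shows "indep_sets X Y A B"
proof -
  have "A \<inter> B = {}" using assms(1) by fastforce
  moreover have "\<not> straddled X B a" if "a \<in> A" for a using assms(1) that by (intro not_straddled_greater) auto
  moreover have "\<not> straddled X A b" if "b \<in> B" for b using assms(1) that by (intro not_straddled_less) auto
  ultimately show ?thesis using assms(2,3) unfolding indep_sets_def by blast
qed

text \<open>The end of a chain: a small next link \<open>Z1\<close> is deleted, and the remaining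
  points, all left of \<open>Z\<close>, form a single block that no point of \<open>Z\<close>
  cuts.\<close>

lemma splits_trivial:
  assumes "finite W" "Z1 \<subseteq> W" "card Z1 \<le> r" "\<And>w z. w \<in> W - Z1 \<Longrightarrow> z \<in> Z \<Longrightarrow> X w < X z" "0 < q"
  shows "splits q r X Y Z W"
  unfolding splits_def
proof (intro exI conjI)
  show "Z1 \<subseteq> W" "card Z1 \<le> r" by fact+
  show "\<Union>{W - Z1} = W - Z1" "finite {W - Z1}" "card {W - Z1} \<le> q" using assms(5) by auto
  show "blocks X Y {W - Z1}" by (simp add: blocks_def)
  show "\<forall>A\<in>{W - Z1}. \<forall>z\<in>Z. \<not> straddled X A z" using assms(4) not_straddled_greater by (metis singletonD)
  have "below X (W - Z1) ` Z \<subseteq> {W - Z1}" using assms(4) by auto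
  then have "card (below X (W - Z1) ` Z) \<le> card {W - Z1}" by (intro card_mono) auto
  also have "\<dots> \<le> 4" by simp
  finally show "card (below X (W - Z1) ` Z) \<le> 4" .
qed

text \<open>The next link \<open>Z1\<close> consists of the points of \<open>W\<close> to the right
  of the leftmost point of \<open>Z\<close>. The others lie left of all of \<open>Z\<close>, so only
  \<open>M\<close> = \<open>Z1 - R1\<close> interleaves with \<open>Z\<close>, and it interleaves
  with the rest only vertically. \<open>M\<close> is cut at both neighbours: at most 4 parts arise
  from \<open>Z\<close> by \<open>alternation\<close> and at most 4 from the rest by the last
  condition of \<open>splits\<close>, hence 16.\<close>

lemma splits_step:
  assumes gen: "generic P X Y" and sub: "Z \<subseteq> P" "W \<subseteq> P" and mono: "mono_pts X Y Z"
    and z: "z \<in> Z" "\<And>z'. z' \<in> Z \<Longrightarrow> X z \<le> X z'"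
    and below: "\<And>w z. w \<in> W \<Longrightarrow> z \<in> Z \<Longrightarrow> Y w < Y z"
    and Z1: "Z1 = {w \<in> W. X z < X w}" and R1: "R1 \<subseteq> Z1" "card R1 \<le> r1" "mono_pts X Y (Z1 - R1)"
    and IH: "splits q r Y X (Z1 - R1) (W - Z1)"
  shows "splits (16 + q) (r1 + r) X Y Z W"
proof -
  define M where "M = Z1 - R1"
  obtain R \<Q> where R: "R \<subseteq> W - Z1" "card R \<le> r" and Q: "finite \<Q>" "card \<Q> \<le> q" "\<Union>\<Q> = W - Z1 - R"
    "blocks Y X \<Q>" "\<And>A z. A \<in> \<Q> \<Longrightarrow> z \<in> M \<Longrightarrow> \<not> straddled Y A z"
    and card4: "card ((\<lambda>m. below Y (W - Z1 - R) m) ` M) \<le> 4"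
    by (rule splitsE[OF IH[folded M_def]]) blast
  define W1 where "W1 = W - Z1 - R"
  have inj: "inj_on X P" "inj_on Y P" and fin: "finite Z" "finite W" "finite M"
    using gen sub by (auto simp: generic_def M_def Z1 finite_subset)
  have M: "M \<subseteq> P" "M \<subseteq> W" "mono_pts X Y M" using sub R1 by (auto simp: M_def Z1)
  have injM: "inj_on X M" "inj_on Y M" using inj M(1) by (auto intro: inj_on_subset)
  have left: "X w < X z'" if "w \<in> W1" "z' \<in> Z" for w z'
  proof -
    have w: "w \<in> W" "\<not> X z < X w" using that(1) by (auto simp: W1_def Z1)
    then have "w \<noteq> z" using below[of w z] z(1) by auto
    then have "X w < X z" using inj_less[OF inj(1), of z w] w z(1) sub by auto
    then show ?thesis using z(2)[OF that(2)] by simp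
  qed
  have leftM: "X w < X m" if "w \<in> W1" "m \<in> M" for w m
    using left[OF that(1) z(1)] that(2) by (auto simp: M_def Z1)
  have alt: "card (below X M ` Z) \<le> 4" "card (below X Z ` M) \<le> 4"
    using alternation[OF gen sub(1) M(1) mono M(3)] below M(2) by blast+
  let ?\<P> = "classes X Y Z M W1"
  have cl: "finite ?\<P> \<and> card ?\<P> \<le> 4 * 4"
    by (rule card_classes[OF fin(3) alt(2)]) (use card4 in \<open>simp add: W1_def\<close>)
  have WR: "W - (R1 \<union> R) = W1 \<union> M" using R(1) R1(1) by (auto simp: W1_def M_def Z1)
  show ?thesis unfolding splits_def
  proof (intro exI conjI)
    show "R1 \<union> R \<subseteq> W" using R(1) R1(1) by (auto simp: Z1)
    show "card (R1 \<union> R) \<le> r1 + r" using card_Un_le[of R1 R] R(2) R1(2) by simp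
    show "finite (?\<P> \<union> \<Q>)" using cl Q(1) by simp
    show "card (?\<P> \<union> \<Q>) \<le> 16 + q" using card_Un_le[of ?\<P> \<Q>] cl Q(2) by simp
    show "\<Union>(?\<P> \<union> \<Q>) = W - (R1 \<union> R)" unfolding WR Union_Un_distrib Union_classes Q(3) W1_def by blast
    show "blocks X Y (?\<P> \<union> \<Q>)"
    proof (rule blocks_Un)
      show "blocks X Y ?\<P>" by (rule blocks_classes[OF injM M(3)])
      show "blocks X Y \<Q>" using Q(4) blocks_swap by blast
      fix A B assume AB: "A \<in> ?\<P>" "B \<in> \<Q>"
      have sub: "A \<subseteq> M" "B \<subseteq> W1" using class_subset[OF AB(1)] Q(3) AB(2) by (auto simp: W1_def)
      show "indep_sets X Y A B"
      proof (rule indep_left)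
        show "X w < X a" if "a \<in> A" "w \<in> B" for a w using leftM[of w a] sub that by auto
        show "\<not> straddled Y B a" if "a \<in> A" for a using Q(5)[OF AB(2), of a] sub that by auto
        show "\<not> straddled Y A w" if "w \<in> B" for w using class_not_straddled(2)[OF AB(1), of w] sub that by auto
      qed
    qed
    show "\<forall>A\<in>?\<P> \<union> \<Q>. \<forall>z\<in>Z. \<not> straddled X A z"
    proof (intro ballI)
      fix A z' assume z': "z' \<in> Z" and "A \<in> ?\<P> \<union> \<Q>"
      from this(2) show "\<not> straddled X A z'"
      proof
        assume A: "A \<in> ?\<P>" show ?thesis by (rule class_not_straddled(1)[OF A z'])
      next
        assume "A \<in> \<Q>"
        then have "A \<subseteq> W1" using Q(3) by (auto simp: W1_def)
        then show ?thesis using left[OF _ z'] by (intro not_straddled_greater) auto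
      qed
    qed
    \<comment> \<open>The set \<open>W1\<close> lies left of every point of \<open>Z\<close>, so it
      adds the same points to every cut-off set and does not increase their number.\<close>
    have "below X (W - (R1 \<union> R)) ` Z = (\<lambda>U. W1 \<union> U) ` below X M ` Z"
      unfolding WR image_image using left by (intro image_cong) auto
    then have "card (below X (W - (R1 \<union> R)) ` Z) \<le> card (below X M ` Z)"
      using fin(1) by (simp add: card_image_le)
    then show "card (below X (W - (R1 \<union> R)) ` Z) \<le> 4" using alt(1) by simp
  qed
qed

text \<open>Each link beyond \<open>Z\<close> costs at most 16 blocks and \<open>r\<close> deleted
  exceptions. The end of the chain costs one block and at most \<open>d\<close> deleted
  points.\<close>

lemma splits_or_long_chain:
  assumes nb: "near_bound TYPE('a) r" and d: "r \<le> d"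
  shows "generic (P::'a set) X Y \<Longrightarrow> Z \<subseteq> P \<Longrightarrow> W \<subseteq> P \<Longrightarrow> mono_pts X Y Z \<Longrightarrow> z \<in> Z \<Longrightarrow>
    (\<And>z'. z' \<in> Z \<Longrightarrow> X z \<le> X z') \<Longrightarrow> (\<And>w z. w \<in> W \<Longrightarrow> z \<in> Z \<Longrightarrow> Y w < Y z) \<Longrightarrow>
    splits (16 * T + 1) (r * T + d) X Y Z W \<or> long_chain d X Y T z W"
proof (induction T arbitrary: X Y Z W z)
  case (Suc T)
  define Z1 where "Z1 = {w \<in> W. X z < X w}"
  have inj: "inj_on X P" "inj_on Y P" and fin: "finite W" "finite Z1"
    using Suc.prems by (auto simp: generic_def finite_subset Z1_def)
  have left: "X w < X z" if "w \<in> W - Z1" for w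
  proof -
    have w: "w \<in> W" "\<not> X z < X w" using that by (auto simp: Z1_def)
    then have "w \<noteq> z" using Suc.prems(7)[of w z] Suc.prems(5) by auto
    then show ?thesis using inj_less[OF inj(1), of z w] w Suc.prems by auto
  qed
  show ?case
  proof (cases "card Z1 \<le> d")
    case True
    have "splits (16 * Suc T + 1) (r * Suc T + d) X Y Z W"
      by (rule splits_trivial[OF fin(1), of Z1])
        (use True left Suc.prems(6) in \<open>auto simp: Z1_def intro: less_le_trans\<close>)
    then show ?thesis ..
  next
    case False
    have Z1P: "Z1 \<subseteq> P" using Suc.prems(3) by (auto simp: Z1_def)
    obtain R1 where R1: "R1 \<subseteq> Z1" "card R1 \<le> r" "mono_pts X Y (Z1 - R1)"
      by (rule near_bound_SE[OF nb Suc.prems(1) _ Z1P, of z])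
        (use Suc.prems(2,5,7) in \<open>auto simp: Z1_def\<close>)
    have "card (Z1 - R1) \<noteq> 0"
      using False d R1(1,2) fin(2) by (simp add: card_Diff_subset finite_subset)
    then have ne: "Z1 - R1 \<noteq> {}" by force
    have injM: "inj_on X (Z1 - R1)" "inj_on Y (Z1 - R1)" using inj Z1P by (auto intro: inj_on_subset)
    \<comment> \<open>The coordinates are exchanged for the next link, so its extreme point is now
      the lowest one. The link is nonempty because it had more than \<open>d\<close> points, with
      \<open>d\<close> at least \<open>r\<close>, and lost at most \<open>r\<close>.\<close>
    define w where "w = arg_min_on Y (Z1 - R1)"
    have w: "w \<in> Z1 - R1" "\<And>v. v \<in> Z1 - R1 \<Longrightarrow> Y w \<le> Y v"
      using arg_min_if_finite(1)[of "Z1 - R1" Y] arg_min_least[of "Z1 - R1" _ Y] ne fin(2)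
      unfolding w_def by auto
    have "splits (16 * T + 1) (r * T + d) Y X (Z1 - R1) (W - Z1) \<or> long_chain d Y X T w (W - Z1)"
    proof (rule Suc.IH[OF generic_swap[OF Suc.prems(1)] _ _ mono_pts_swap[OF injM R1(3)] w(1)])
      show "Y w \<le> Y z'" if "z' \<in> Z1 - R1" for z' using w(2) that .
      show "X v < X m" if "v \<in> W - Z1" "m \<in> Z1 - R1" for v m
        using left[OF that(1)] that(2) by (auto simp: Z1_def)
    qed (use Z1P Suc.prems(3) in auto)
    then show ?thesis
    proof
      assume "splits (16 * T + 1) (r * T + d) Y X (Z1 - R1) (W - Z1)"
      then have "splits (16 + (16 * T + 1)) (r + (r * T + d)) X Y Z W"
        using Suc.prems by (intro splits_step[where P = P and z = z, OF _ _ _ _ _ _ _ Z1_def R1]) auto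
      then show ?thesis by (simp add: algebra_simps)
    next
      assume l: "long_chain d Y X T w (W - Z1)"
      have "long_chain d X Y (Suc T) z W"
        unfolding long_chain.simps Z1_def[symmetric] using False w(1) l by (auto simp: Z1_def)
      then show ?thesis ..
    qed
  qed
qed simp

section \<open>Joining the two chains at a line\<close>

definition cover :: "nat \<Rightarrow> nat \<Rightarrow> 'a set \<Rightarrow> ('a \<Rightarrow> real) \<Rightarrow> ('a \<Rightarrow> real) \<Rightarrow> real \<Rightarrow> bool" where
  "cover q r P X Y c \<longleftrightarrow> (\<exists>R \<P>. R \<subseteq> P \<and> card R \<le> r \<and> finite \<P> \<and> card \<P> \<le> q \<and> \<Union>\<P> = P - R \<and>
     blocks X Y \<P> \<and> (\<forall>A\<in>\<P>. (\<forall>a\<in>A. X a < c) \<or> (\<forall>a\<in>A. c < X a)))"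

text \<open>The set \<open>M\<close> serves as upper link \<open>Z\<close> for both chains: for
  \<open>L\<close> with the coordinates exchanged and for \<open>U\<close> after a half turn.
  \<open>L\<close> and \<open>U\<close> are separated in both coordinates and do not interact. The
  two chains give 2 q blocks and \<open>M\<close> at most 16, so 2 q + 18 suffices.\<close>

lemma generic_cover: "\<exists>q r. \<forall>(P::'a set) X Y c. generic P X Y \<longrightarrow> c \<notin> X ` P \<longrightarrow> cover q r P X Y c"
proof -
  obtain r0 where nb: "near_bound TYPE('a) r0" using near_mono by (rule exE)
  define d where "d = r0 + 5"
  define q where "q = 16 * Suc (Suc (Suc (Suc (Suc 0)))) + (1::nat)"
  define r where "r = r0 * Suc (Suc (Suc (Suc (Suc 0)))) + d"
  have split: "splits q r X Y Z W"
    if "generic P X Y" "Z \<subseteq> P" "W \<subseteq> P" "mono_pts X Y Z" "z \<in> Z"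
    "\<And>z'. z' \<in> Z \<Longrightarrow> X z \<le> X z'" "\<And>w z. w \<in> W \<Longrightarrow> z \<in> Z \<Longrightarrow> Y w < Y z" for P :: "'a set" and X Y Z W z
  proof -
    have "splits q r X Y Z W \<or> long_chain d X Y (Suc (Suc (Suc (Suc (Suc 0))))) z W"
      unfolding q_def r_def by (rule splits_or_long_chain[OF nb _ that]) (simp_all add: d_def)
    moreover have False if l: "long_chain d X Y (Suc (Suc (Suc (Suc (Suc 0))))) z W"
    proof (rule long_chain_False[OF nb \<open>generic P X Y\<close> _ \<open>W \<subseteq> P\<close> _ l])
      show "z \<in> P" using \<open>z \<in> Z\<close> \<open>Z \<subseteq> P\<close> by (rule rev_subsetD)
      show "Y w < Y z" if "w \<in> W" for w by (rule \<open>\<And>w z. w \<in> W \<Longrightarrow> z \<in> Z \<Longrightarrow> Y w < Y z\<close>[OF that \<open>z \<in> Z\<close>])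
    qed (simp add: d_def)
    ultimately show ?thesis by (elim disjE) simp_all
  qed
  have "cover (2 * q + 18) (2 * r + r0) P X Y c" if gen: "generic P X Y" and c: "c \<notin> X ` P"
    for P :: "'a set" and X Y c
  proof -
    define L where "L = {p \<in> P. X p < c}"
    define Rt where "Rt = {p \<in> P. c < X p}"
    have inj: "inj_on X P" "inj_on Y P" and fin: "finite P" "finite L" "finite Rt"
      using gen by (auto simp: generic_def L_def Rt_def)
    have "X p < c \<or> c < X p" if "p \<in> P" for p using c that by (metis imageI linorder_neqE)
    then have P: "P = L \<union> Rt" by (auto simp: L_def Rt_def)
    have LR: "X l < X p" if "l \<in> L" "p \<in> Rt" for l p using that by (auto simp: L_def Rt_def)
    show ?thesis
    proof (cases "L = {}")
      case True
      then have "\<Union>{Rt} = P - {}" using P by auto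
      then show ?thesis unfolding cover_def
        by (intro exI[of _ "{}"] exI[of _ "{Rt}"]) (auto simp: blocks_def Rt_def)
    next
      case False
      define y where "y = arg_max_on Y L"
      have y: "y \<in> L" "\<And>l. l \<in> L \<Longrightarrow> Y l \<le> Y y"
      proof -
        have ne: "Y ` L \<noteq> {}" "finite (Y ` L)" using False fin by auto
        have "\<exists>y. is_arg_max Y (\<lambda>x. x \<in> L) y"
        proof -
          obtain y where "y \<in> L" "Y y = Max (Y ` L)" using Max_in[OF ne(2,1)] by auto
          then show ?thesis using ne(2) by (auto simp: is_arg_max_def not_less intro!: exI[of _ y])
        qed
        then have "is_arg_max Y (\<lambda>x. x \<in> L) y"
          unfolding y_def arg_max_on_def arg_max_def by (rule someI_ex)
        then show "y \<in> L" "\<And>l. l \<in> L \<Longrightarrow> Y l \<le> Y y" by (auto simp: is_arg_max_def not_less)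
      qed
      define M0 where "M0 = {p \<in> Rt. Y p < Y y}"
      define U where "U = {p \<in> Rt. Y y < Y p}"
      have yP: "y \<in> P" using y(1) by (simp add: L_def)
      have "Y p < Y y \<or> Y y < Y p" if "p \<in> Rt" for p
      proof -
        have "p \<in> P" "p \<noteq> y" using that LR[OF y(1) that] by (auto simp: Rt_def)
        then show ?thesis using inj_less[OF inj(2) \<open>p \<in> P\<close> yP] by blast
      qed
      then have Rt: "Rt = M0 \<union> U" by (auto simp: M0_def U_def)
      have M0P: "M0 \<subseteq> P" by (auto simp: M0_def Rt_def)
      obtain R0 where R0: "R0 \<subseteq> M0" "card R0 \<le> r0" "mono_pts X Y (M0 - R0)"
        by (rule near_bound_SE[OF nb gen yP M0P]) (use LR[OF y(1)] in \<open>auto simp: M0_def\<close>)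
      define M where "M = M0 - R0"
      have M: "M \<subseteq> P" "M \<subseteq> Rt" "mono_pts X Y M" and MY: "\<And>m. m \<in> M \<Longrightarrow> Y m < Y y"
        using M0P R0(3) by (auto simp: M_def M0_def)
      have injM: "inj_on X M" "inj_on Y M" and finM: "finite M"
        using inj M(1) fin by (auto intro: inj_on_subset finite_subset)
      have LU: "Y l < Y u" if "l \<in> L" "u \<in> U" for l u using y(2)[OF that(1)] that(2) by (auto simp: U_def)
      have subs: "L \<subseteq> P" "U \<subseteq> P" "U \<subseteq> Rt" using P Rt by auto
      \<comment> \<open>With the coordinates exchanged, "\<open>M\<close> above \<open>L\<close>"
        means that \<open>M\<close> is right of the line. An empty \<open>M\<close> has no extreme
        point and is treated separately.\<close>
      have sL: "splits q r Y X M L"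
      proof (cases "M = {}")
        case True
        then show ?thesis by (intro splits_trivial[OF fin(2), of "{}"]) (auto simp: q_def)
      next
        case False
        define z where "z = arg_min_on Y M"
        have z: "z \<in> M" "\<And>v. v \<in> M \<Longrightarrow> Y z \<le> Y v"
          using arg_min_if_finite(1)[OF finM False, of Y] arg_min_least[OF finM False, of _ Y]
          unfolding z_def by auto
        show ?thesis
          by (rule split[OF generic_swap[OF gen] M(1) subs(1) mono_pts_swap[OF injM M(3)] z])
            (use LR M(2) in auto)
      qed
      have UM: "- Y u < - Y m" if "u \<in> U" "m \<in> M" for u m
        using MY[OF that(2)] that(1) by (simp add: U_def)
      have sU: "splits q r (\<lambda>p. - X p) (\<lambda>p. - Y p) M U"
      proof (cases "M = {}")
        case True
        have "finite U" using fin(1) subs(2) finite_subset by blast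
        then show ?thesis using True by (intro splits_trivial[of _ "{}"]) (auto simp: q_def)
      next
        case False
        define z where "z = arg_min_on (\<lambda>p. - X p) M"
        have z: "z \<in> M" "\<And>v. v \<in> M \<Longrightarrow> - X z \<le> - X v"
          using arg_min_if_finite(1)[OF finM False, of "\<lambda>p. - X p"] arg_min_least[OF finM False, of _ "\<lambda>p. - X p"]
          unfolding z_def by auto
        show ?thesis
          by (rule split[OF generic_rotate[OF gen] M(1) subs(2) mono_pts_rotate[OF M(3)] z])
            (assumption | rule UM)+
      qed
      obtain RL \<P> where RL: "RL \<subseteq> L" "card RL \<le> r" and P: "finite \<P>" "card \<P> \<le> q" "\<Union>\<P> = L - RL"
          "blocks Y X \<P>" "\<And>A m. A \<in> \<P> \<Longrightarrow> m \<in> M \<Longrightarrow> \<not> straddled Y A m"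
          and cL: "card ((\<lambda>m. below Y (L - RL) m) ` M) \<le> 4"
        by (rule splitsE[OF sL]) blast
      obtain RU \<Q> where RU: "RU \<subseteq> U" "card RU \<le> r" and Q: "finite \<Q>" "card \<Q> \<le> q" "\<Union>\<Q> = U - RU"
          "blocks (\<lambda>p. - X p) (\<lambda>p. - Y p) \<Q>" "\<And>A m. A \<in> \<Q> \<Longrightarrow> m \<in> M \<Longrightarrow> \<not> straddled (\<lambda>p. - X p) A m"
          and cU: "card ((\<lambda>m. below (\<lambda>p. - X p) (U - RU) m) ` M) \<le> 4"
        by (rule splitsE[OF sU]) blast
      define L' where "L' = L - RL"
      define U' where "U' = U - RU"
      \<comment> \<open>The half turn counts the points of \<open>U'\<close> on the other side of
        \<open>m\<close>. As no coordinates coincide, this is the complementary set, so the bound 4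
        carries over.\<close>
      have inj_compl: "below X U' m = U' - below (\<lambda>p. - X p) U' m" if "m \<in> M" for m
      proof -
        have "X u \<noteq> X m" if "u \<in> U'" for u
          using inj(1) that \<open>m \<in> M\<close> subs(2) M(1) MY[OF \<open>m \<in> M\<close>]
          by (auto simp: U'_def U_def dest!: inj_onD)
        then show ?thesis by (auto simp: not_less le_less)
      qed
      have "below X U' ` M = (\<lambda>V. U' - V) ` below (\<lambda>p. - X p) U' ` M"
        unfolding image_image using inj_compl by (intro image_cong) auto
      then have "card (below X U' ` M) \<le> card ((\<lambda>m. below (\<lambda>p. - X p) U' m) ` M)"
        using finM by (simp add: card_image_le)
      then have cU': "card (below X U' ` M) \<le> 4" using cU by (simp add: U'_def)
      let ?C = "classes X Y U' M L'"
      have cl: "finite ?C \<and> card ?C \<le> 4 * 4"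
        by (rule card_classes[OF finM cU']) (use cL in \<open>simp add: L'_def\<close>)
      have inC: "A \<subseteq> M" if "A \<in> ?C" for A by (rule class_subset[OF that])
      have inP: "A \<subseteq> L'" if "A \<in> \<P>" for A using that P(3) by (auto simp: L'_def)
      have inQ: "A \<subseteq> U'" if "A \<in> \<Q>" for A using that Q(3) by (auto simp: U'_def)
      have CP: "indep_sets X Y A B" if "A \<in> ?C" "B \<in> \<P>" for A B
      proof (rule indep_left)
        show "X w < X a" if "a \<in> A" "w \<in> B" for a w
          using LR[of w a] inC[OF \<open>A \<in> ?C\<close>] inP[OF \<open>B \<in> \<P>\<close>] that M(2) by (auto simp: L'_def)
        show "\<not> straddled Y B a" if "a \<in> A" for a
          using P(5)[OF \<open>B \<in> \<P>\<close>, of a] inC[OF \<open>A \<in> ?C\<close>] that by auto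
        show "\<not> straddled Y A w" if "w \<in> B" for w
          using class_not_straddled(2)[OF \<open>A \<in> ?C\<close>, of w] inP[OF \<open>B \<in> \<P>\<close>] that by auto
      qed
      have QC: "indep_sets X Y A B" if "A \<in> \<Q>" "B \<in> ?C" for A B
      proof -
        have "indep_sets Y X A B"
        proof (rule indep_left)
          show "Y w < Y a" if "a \<in> A" "w \<in> B" for a w
            using MY[of w] inC[OF \<open>B \<in> ?C\<close>] inQ[OF \<open>A \<in> \<Q>\<close>] that by (fastforce simp: U'_def U_def)
          show "\<not> straddled X B a" if "a \<in> A" for a
            using class_not_straddled(1)[OF \<open>B \<in> ?C\<close>, of a] inQ[OF \<open>A \<in> \<Q>\<close>] that by auto
          show "\<not> straddled X A w" if "w \<in> B" for w
            using Q(5)[OF \<open>A \<in> \<Q>\<close>, of w] inC[OF \<open>B \<in> ?C\<close>] that unfolding straddled_neg by auto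
        qed
        then show ?thesis by (simp add: indep_sets_swap[of X Y])
      qed
      have QP: "indep_sets X Y A B" if "A \<in> \<Q>" "B \<in> \<P>" for A B
      proof (rule indep_left)
        have sep: "Y b < Y a \<and> X b < X a" if "a \<in> A" "b \<in> B" for a b
          using LU[of b a] LR[of b a] inQ[OF \<open>A \<in> \<Q>\<close>] inP[OF \<open>B \<in> \<P>\<close>] that subs(3) by (auto simp: L'_def U'_def)
        show "X w < X a" if "a \<in> A" "w \<in> B" for a w using sep[OF that] by simp
        show "\<not> straddled Y B a" if "a \<in> A" for a using sep[OF that] by (intro not_straddled_greater) simp
        show "\<not> straddled Y A w" if "w \<in> B" for w using sep[OF _ that] by (intro not_straddled_less) simp
      qed
      show ?thesis unfolding cover_def
      proof (intro exI conjI)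
        let ?R = "R0 \<union> RL \<union> RU" and ?\<P> = "\<Q> \<union> (?C \<union> \<P>)"
        show "?R \<subseteq> P" using R0(1) RL(1) RU(1) M0P subs by blast
        show "card ?R \<le> 2 * r + r0"
          using card_Un_le[of "R0 \<union> RL" RU] card_Un_le[of R0 RL] R0(2) RL(2) RU(2) by simp
        show "finite ?\<P>" using P(1) Q(1) cl by simp
        show "card ?\<P> \<le> 2 * q + 18"
          using card_Un_le[of \<Q> "?C \<union> \<P>"] card_Un_le[of ?C \<P>] P(2) Q(2) cl by simp
        have disj: "L \<inter> Rt = {}" "M0 \<inter> U = {}" using LR by (fastforce simp: M0_def U_def)+
        have "P - ?R = (U - RU) \<union> ((M0 - R0) \<union> (L - RL))"
          unfolding \<open>P = L \<union> Rt\<close> Rt using disj R0(1) RL(1) RU(1) unfolding Rt by fast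
        then show "\<Union>?\<P> = P - ?R" unfolding Union_Un_distrib Union_classes P(3) Q(3) M_def by simp
        show "blocks X Y ?\<P>"
        proof (intro blocks_Un)
          show "blocks X Y \<Q>" using Q(4) unfolding blocks_rotate .
          show "blocks X Y ?C" by (rule blocks_classes[OF injM M(3)])
          show "blocks X Y \<P>" using P(4) by (simp add: blocks_swap[of X Y])
        qed (use CP QC QP in auto)
        show "\<forall>A\<in>?\<P>. (\<forall>a\<in>A. X a < c) \<or> (\<forall>a\<in>A. c < X a)"
        proof (intro ballI)
          fix A assume "A \<in> ?\<P>"
          then have "A \<subseteq> Rt \<or> A \<subseteq> L"
          proof (elim UnE)
            assume "A \<in> \<Q>"
            then have "A \<subseteq> U" using inQ unfolding U'_def by fastforce
            from order_trans[OF this subs(3)] show ?thesis by simp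
          next
            assume "A \<in> ?C"
            from order_trans[OF inC[OF this] M(2)] show ?thesis by simp
          next
            assume "A \<in> \<P>"
            then have "A \<subseteq> L" using inP unfolding L'_def by fastforce
            then show ?thesis ..
          qed
          then show "(\<forall>a\<in>A. X a < c) \<or> (\<forall>a\<in>A. c < X a)" by (auto simp: L_def Rt_def)
        qed
      qed
    qed
  qed
  then show ?thesis by blast
qed

section \<open>Growth rates of sum closures\<close>

lemma subseq_nthI:
  "sorted_wrt (<) js \<Longrightarrow> (\<And>j. j \<in> set js \<Longrightarrow> j < length xs) \<Longrightarrow> subseq (map ((!) xs) js) xs"
proof (induction js arbitrary: xs rule: rev_induct)
  case (snoc j js)
  have j: "j < length xs" using snoc.prems(2) by simp
  have "subseq (map ((!) (take j xs)) js) (take j xs)"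
    using snoc.prems j by (intro snoc.IH) (auto simp: sorted_wrt_append)
  moreover have "map ((!) (take j xs)) js = map ((!) xs) js"
    using snoc.prems by (auto simp: sorted_wrt_append)
  moreover have "subseq [xs ! j] (drop j xs)" using j by (metis Cons_nth_drop_Suc subseq_Cons2 list_emb_Nil)
  ultimately have "subseq (map ((!) xs) js @ [xs ! j]) (take j xs @ drop j xs)"
    by (metis list_emb_append_mono)
  then show ?case by simp
qed simp

lemma subseq_nthE:
  assumes "subseq ys xs"
  obtains g where "\<And>i j. i < j \<Longrightarrow> j < length ys \<Longrightarrow> g i < (g j :: nat)"
    "\<And>i. i < length ys \<Longrightarrow> g i < length xs \<and> xs ! g i = ys ! i"
proof -
  from assms have "\<exists>g. (\<forall>i j. i < j \<longrightarrow> j < length ys \<longrightarrow> g i < (g j :: nat)) \<and>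
     (\<forall>i<length ys. g i < length xs \<and> xs ! g i = ys ! i)"
  proof (induction ys xs rule: list_emb.induct)
    case (list_emb_Cons ys xs x)
    then obtain g where g: "\<forall>i j. i < j \<longrightarrow> j < length ys \<longrightarrow> g i < (g j :: nat)"
      "\<forall>i<length ys. g i < length xs \<and> xs ! g i = ys ! i" by blast
    then show ?case by (intro exI[of _ "\<lambda>i. Suc (g i)"]) simp
  next
    case (list_emb_Cons2 y x ys xs)
    then obtain g where g: "\<forall>i j. i < j \<longrightarrow> j < length ys \<longrightarrow> g i < (g j :: nat)"
      "\<forall>i<length ys. g i < length xs \<and> xs ! g i = ys ! i" by blast
    show ?case
    proof (intro exI[of _ "\<lambda>i. case i of 0 \<Rightarrow> 0 | Suc i \<Rightarrow> Suc (g i)"] conjI allI impI)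
      fix i j :: nat assume "i < j" "j < length (y # ys)"
      then show "(case i of 0 \<Rightarrow> 0 | Suc i \<Rightarrow> Suc (g i)) < (case j of 0 \<Rightarrow> 0 | Suc i \<Rightarrow> Suc (g i))"
        using g(1) by (cases i; cases j) auto
    next
      fix i :: nat assume "i < length (y # ys)"
      then show "(case i of 0 \<Rightarrow> 0 | Suc i \<Rightarrow> Suc (g i)) < length (x # xs)"
        "(x # xs) ! (case i of 0 \<Rightarrow> 0 | Suc i \<Rightarrow> Suc (g i)) = (y # ys) ! i"
        using g(2) list_emb_Cons2(1) by (cases i; simp)+
    qed
  qed simp
  then show thesis using that by blast
qed

definition embeds :: "nat list \<Rightarrow> nat list \<Rightarrow> (nat \<Rightarrow> nat) \<Rightarrow> bool" where
  "embeds \<sigma> \<pi> g \<longleftrightarrow> (\<forall>i j. i < j \<longrightarrow> j < length \<sigma> \<longrightarrow> g i < g j) \<and> (\<forall>i<length \<sigma>. g i < length \<pi>) \<and>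
     (\<forall>i<length \<sigma>. \<forall>j<length \<sigma>. \<sigma> ! i < \<sigma> ! j \<longleftrightarrow> \<pi> ! g i < \<pi> ! g j)"

lemma contained_in_iff: "contained_in \<sigma> \<pi> \<longleftrightarrow> (\<exists>g. embeds \<sigma> \<pi> g)"
proof
  assume "contained_in \<sigma> \<pi>"
  then obtain ys where ys: "subseq ys \<pi>" "order_isomorphic \<sigma> ys" by (auto simp: contained_in_def)
  obtain g where "\<And>i j. i < j \<Longrightarrow> j < length ys \<Longrightarrow> g i < (g j :: nat)"
    "\<And>i. i < length ys \<Longrightarrow> g i < length \<pi> \<and> \<pi> ! g i = ys ! i" using subseq_nthE[OF ys(1)] by blast
  then have "embeds \<sigma> \<pi> g" using ys(2) by (simp add: embeds_def order_isomorphic_def)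
  then show "\<exists>g. embeds \<sigma> \<pi> g" by blast
next
  assume "\<exists>g. embeds \<sigma> \<pi> g"
  then obtain g where g: "embeds \<sigma> \<pi> g" ..
  let ?ys = "map ((!) \<pi>) (map g [0..<length \<sigma>])"
  have "subseq ?ys \<pi>"
    using g by (intro subseq_nthI) (auto simp: embeds_def sorted_wrt_iff_nth_less)
  moreover have "order_isomorphic \<sigma> ?ys" using g by (simp add: embeds_def order_isomorphic_def)
  ultimately show "contained_in \<sigma> \<pi>" by (auto simp: contained_in_def)
qed

lemma contained_in_refl: "contained_in \<sigma> \<sigma>"
  unfolding contained_in_iff embeds_def by (intro exI[of _ "\<lambda>i. i"]) simp

lemma contained_in_trans:
  assumes "contained_in \<rho> \<sigma>" "contained_in \<sigma> \<pi>" shows "contained_in \<rho> \<pi>"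
proof -
  obtain g h where "embeds \<rho> \<sigma> g" "embeds \<sigma> \<pi> h" using assms contained_in_iff by blast
  then have "embeds \<rho> \<pi> (\<lambda>i. h (g i))" by (simp add: embeds_def)
  then show ?thesis using contained_in_iff by blast
qed

lemma contained_in_length:
  assumes "contained_in \<sigma> \<pi>" shows "length \<sigma> \<le> length \<pi>"
  using assms list_emb_length by (force simp: contained_in_def order_isomorphic_def)

lemma has_contained:
  assumes "has_pattern {..<length \<pi>} (\<lambda>i. real i) (\<lambda>i. real (\<pi> ! i)) \<sigma>"
  shows "contained_in \<sigma> \<pi>"
proof -
  obtain e where e: "\<And>i. i < length \<sigma> \<Longrightarrow> e i < length \<pi>"
    "\<And>i j. i < length \<sigma> \<Longrightarrow> j < length \<sigma> \<Longrightarrow> (e i < e j \<longleftrightarrow> i < j) \<and> (\<pi> ! e i < \<pi> ! e j \<longleftrightarrow> \<sigma> ! i < \<sigma> ! j)"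
    using assms unfolding has_pattern_def by auto
  have "embeds \<sigma> \<pi> e" unfolding embeds_def using e by simp
  then show ?thesis using contained_in_iff by blast
qed

lemma length_direct_sum [simp]: "length (direct_sum \<sigma> \<tau>) = length \<sigma> + length \<tau>"
  by (simp add: direct_sum_def)

lemma nth_direct_sum:
  "i < length \<sigma> + length \<tau> \<Longrightarrow>
    direct_sum \<sigma> \<tau> ! i = (if i < length \<sigma> then \<sigma> ! i else \<tau> ! (i - length \<sigma>) + length \<sigma>)"
  by (simp add: direct_sum_def nth_append)

lemma direct_sum_perms:
  assumes "\<sigma> \<in> perms" "\<tau> \<in> perms" shows "direct_sum \<sigma> \<tau> \<in> perms"
proof -
  have "set (direct_sum \<sigma> \<tau>) = {1..length \<sigma>} \<union> (\<lambda>v. v + length \<sigma>) ` {1..length \<tau>}"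
    using assms by (simp add: direct_sum_def perms_iff)
  also have "\<dots> = {1..length (direct_sum \<sigma> \<tau>)}" by (auto simp: image_add_atLeastAtMost')
  finally show ?thesis using assms
    by (auto simp: perms_iff direct_sum_def distinct_map inj_on_def)
qed

lemma direct_sum_assoc: "direct_sum (direct_sum a b) c = direct_sum a (direct_sum b c)"
  by (simp add: direct_sum_def add.assoc add.commute[of "length a"])

lemma direct_sum_Nil [simp]: "direct_sum [] \<sigma> = \<sigma>" "direct_sum \<sigma> [] = \<sigma>"
  by (simp_all add: direct_sum_def)

text \<open>Exactly the first \<open>k\<close> entries of \<open>\<tau>\<close> are mapped into
  \<open>\<sigma>\<close>. If \<open>k\<close> were neither 0 nor the full length, all of these
  would be smaller than all later ones, so they would have the values 1..k.\<close>

lemma indec_contained_direct_sum: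
  assumes ind: "indec \<tau>" and p: "\<sigma> \<in> perms" "\<sigma>' \<in> perms" and c: "contained_in \<tau> (direct_sum \<sigma> \<sigma>')"
  shows "contained_in \<tau> \<sigma> \<or> contained_in \<tau> \<sigma>'"
proof -
  obtain g where g: "embeds \<tau> (direct_sum \<sigma> \<sigma>') g" using c contained_in_iff by blast
  have gm: "\<And>i j. i < j \<Longrightarrow> j < length \<tau> \<Longrightarrow> g i < g j" and
    gl: "\<And>i. i < length \<tau> \<Longrightarrow> g i < length \<sigma> + length \<sigma>'" and
    go: "\<And>i j. i < length \<tau> \<Longrightarrow> j < length \<tau> \<Longrightarrow>
      \<tau> ! i < \<tau> ! j \<longleftrightarrow> direct_sum \<sigma> \<sigma>' ! g i < direct_sum \<sigma> \<sigma>' ! g j"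
    using g by (auto simp: embeds_def)
  define k where "k = card {i. i < length \<tau> \<and> g i < length \<sigma>}"
  have down: "g i < length \<sigma>" if "j < length \<tau>" "g j < length \<sigma>" "i \<le> j" for i j
    using gm[of i j] that by (cases "i = j") auto
  have k: "k \<le> length \<tau>" "\<And>i. i < length \<tau> \<Longrightarrow> g i < length \<sigma> \<longleftrightarrow> i < k"
  proof -
    have sub: "{i. i < length \<tau> \<and> g i < length \<sigma>} \<subseteq> {..<length \<tau>}" by auto
    then show "k \<le> length \<tau>" unfolding k_def by (metis card_lessThan card_mono finite_lessThan)
    fix i assume i: "i < length \<tau>"
    show "g i < length \<sigma> \<longleftrightarrow> i < k"
    proof
      assume "g i < length \<sigma>"
      then have "{..i} \<subseteq> {i. i < length \<tau> \<and> g i < length \<sigma>}" using down i by auto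
      from card_mono[OF finite_subset[OF sub] this] show "i < k" unfolding k_def by simp
    next
      assume "i < k"
      show "g i < length \<sigma>"
      proof (rule ccontr)
        assume "\<not> g i < length \<sigma>"
        then have "{i. i < length \<tau> \<and> g i < length \<sigma>} \<subseteq> {..<i}" using down by (auto simp: not_le[symmetric])
        then have "k \<le> i" unfolding k_def by (metis card_lessThan card_mono finite_lessThan)
        then show False using \<open>i < k\<close> by simp
      qed
    qed
  qed
  have pt: "\<tau> \<in> perms" and ne: "\<tau> \<noteq> []" using ind by (auto simp: indec_def)
  have "\<not> (0 < k \<and> k < length \<tau>)"
  proof
    assume k0: "0 < k \<and> k < length \<tau>"
    have lt: "\<tau> ! i < \<tau> ! j" if "i < k" "k \<le> j" "j < length \<tau>" for i j
    proof -
      have i: "i < length \<tau>" using that k0 by simp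
      have gi: "g i < length \<sigma>" and gj: "\<not> g j < length \<sigma>" using k(2)[OF i] k(2)[OF that(3)] that by auto
      have "\<sigma> ! g i \<le> length \<sigma>" "1 \<le> \<sigma>' ! (g j - length \<sigma>)"
        using perms_nth_bounds[OF p(1) gi] perms_nth_bounds[OF p(2), of "g j - length \<sigma>"] gl[OF that(3)] gj by auto
      then show ?thesis unfolding go[OF i that(3)]
        using gi gj gl[OF i] gl[OF that(3)] by (simp add: nth_direct_sum)
    qed
    have d: "distinct \<tau>" and s: "set \<tau> = {1..length \<tau>}" using pt by (auto simp: perms_iff)
    have T: "set (take k \<tau>) \<union> set (drop k \<tau>) = {1..length \<tau>}" using s by (metis append_take_drop_id set_append)
    have lt': "a < b" if ab: "a \<in> set (take k \<tau>)" "b \<in> set (drop k \<tau>)" for a b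
    proof -
      obtain i where i: "i < k" "a = \<tau> ! i" using ab(1) k0 by (auto simp: in_set_conv_nth)
      obtain j where j: "j < length \<tau> - k" "b = \<tau> ! (k + j)" using ab(2) k0 by (auto simp: in_set_conv_nth)
      show ?thesis using lt[of i "k + j"] i j k0 by simp
    qed
    have card: "card (set (take k \<tau>)) = k" using d k0 by (simp add: distinct_card)
    have "set (take k \<tau>) \<subseteq> {1..k}"
    proof
      fix a assume a: "a \<in> set (take k \<tau>)"
      have "set (drop k \<tau>) \<subseteq> {a<..length \<tau>}" using lt'[OF a] T by auto
      then have "card (set (drop k \<tau>)) \<le> length \<tau> - a" using card_mono[OF finite_greaterThanAtMost] by fastforce
      moreover have "card (set (drop k \<tau>)) = length \<tau> - k" using d by (simp add: distinct_card)
      ultimately have "length \<tau> - k \<le> length \<tau> - a" by simp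
      moreover have "a \<in> {1..length \<tau>}" using a T by blast
      ultimately show "a \<in> {1..k}" using k0 by auto
    qed
    then have "set (take k \<tau>) = {1..k}" using card by (intro card_subset_eq) auto
    then show False using ind k0 by (simp add: indec_def)
  qed
  then consider "k = 0" | "k = length \<tau>" using k(1) by linarith
  then show ?thesis
  proof cases
    case 1
    then have ge: "\<not> g i < length \<sigma>" if "i < length \<tau>" for i using k(2)[OF that] by simp
    have "embeds \<tau> \<sigma>' (\<lambda>i. g i - length \<sigma>)" unfolding embeds_def
    proof (intro conjI allI impI)
      fix i j assume "i < j" "j < length \<tau>"
      then show "g i - length \<sigma> < g j - length \<sigma>" using gm[of i j] ge[of i] by simp
    next
      fix i assume "i < length \<tau>"
      then show "g i - length \<sigma> < length \<sigma>'" using gl[of i] ge[of i] by simp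
    next
      fix i j assume "i < length \<tau>" "j < length \<tau>"
      then show "\<tau> ! i < \<tau> ! j \<longleftrightarrow> \<sigma>' ! (g i - length \<sigma>) < \<sigma>' ! (g j - length \<sigma>)"
        using go[of i j] gl[of i] gl[of j] ge[of i] ge[of j] by (simp add: nth_direct_sum)
    qed
    then show ?thesis using contained_in_iff by blast
  next
    case 2
    then have "embeds \<tau> \<sigma> g" using gm k(2) go gl by (simp add: embeds_def nth_direct_sum)
    then show ?thesis using contained_in_iff by blast
  qed
qed

lemma contained_direct_sum:
  assumes "\<sigma> \<in> perms" "\<tau> \<in> perms"
  shows "contained_in \<sigma> (direct_sum \<sigma> \<tau>)" "contained_in \<tau> (direct_sum \<sigma> \<tau>)"
proof -
  have "embeds \<sigma> (direct_sum \<sigma> \<tau>) (\<lambda>i. i)" "embeds \<tau> (direct_sum \<sigma> \<tau>) (\<lambda>i. length \<sigma> + i)"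
    by (auto simp: embeds_def nth_direct_sum)
  then show "contained_in \<sigma> (direct_sum \<sigma> \<tau>)" "contained_in \<tau> (direct_sum \<sigma> \<tau>)"
    using contained_in_iff by blast+
qed

section \<open>Unique decomposition into sum-indecomposables\<close>

definition sum_list_of :: "nat list list \<Rightarrow> nat list" where
  "sum_list_of l = foldr direct_sum l []"

lemma sum_list_of_simps [simp]:
  "sum_list_of [] = []" "sum_list_of (\<sigma> # l) = direct_sum \<sigma> (sum_list_of l)"
  by (simp_all add: sum_list_of_def)

lemma Nil_perms [simp]: "[] \<in> perms"
  by (simp add: perms_iff)

lemma length_sum_list_of: "length (sum_list_of l) = sum_list (map length l)"
  by (induction l) auto

lemma indec_decomposition:
  "\<sigma> \<in> perms \<Longrightarrow> \<exists>l. sum_list_of l = \<sigma> \<and> (\<forall>\<tau>\<in>set l. indec \<tau> \<and> contained_in \<tau> \<sigma>)"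
proof (induction "length \<sigma>" arbitrary: \<sigma> rule: less_induct)
  case less
  show ?case
  proof (cases "\<sigma> = [] \<or> indec \<sigma>")
    case True
    then show ?thesis
    proof
      assume "\<sigma> = []" then show ?thesis by (intro exI[of _ "[]"]) simp
    next
      assume "indec \<sigma>" then show ?thesis by (intro exI[of _ "[\<sigma>]"]) (simp add: contained_in_refl)
    qed
  next
    case False
    then obtain k where k: "0 < k" "k < length \<sigma>" "set (take k \<sigma>) = {1..k}"
      using less.prems by (auto simp: indec_def)
    have d: "distinct \<sigma>" and s: "set \<sigma> = {1..length \<sigma>}" using less.prems by (auto simp: perms_iff)
    define a where "a = take k \<sigma>"
    define b where "b = map (\<lambda>v. v - k) (drop k \<sigma>)"
    have la: "length a = k" and lb: "length b = length \<sigma> - k" using k by (auto simp: a_def b_def)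
    have a: "a \<in> perms" using k d by (simp add: a_def perms_iff)
    have disj: "set (take k \<sigma>) \<inter> set (drop k \<sigma>) = {}" using d by (simp add: set_take_disj_set_drop_if_distinct)
    have un: "set (take k \<sigma>) \<union> set (drop k \<sigma>) = {1..length \<sigma>}" using s by (metis append_take_drop_id set_append)
    have "set (drop k \<sigma>) = {1..length \<sigma>} - {1..k}" using disj un k(3) by blast
    also have "\<dots> = {Suc k..length \<sigma>}" by auto
    finally have drop: "set (drop k \<sigma>) = {Suc k..length \<sigma>}" .
    have "set b = {1..length \<sigma> - k}"
    proof -
      have "set b = (\<lambda>v. v - k) ` {Suc k..length \<sigma>}" by (simp add: b_def drop)
      also have "\<dots> = {1..length \<sigma> - k}"
      proof safe
        fix v assume "v \<in> {1..length \<sigma> - k}"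
        then show "v \<in> (\<lambda>v. v - k) ` {Suc k..length \<sigma>}" using k(2)
          by (intro image_eqI[of _ _ "v + k"]) auto
      qed auto
      finally show ?thesis .
    qed
    moreover have "distinct b" unfolding b_def distinct_map using d drop
      by (auto simp: inj_on_def)
    ultimately have b: "b \<in> perms" using lb by (simp add: perms_iff)
    have "map (\<lambda>v. v + k) b = map (\<lambda>v. v) (drop k \<sigma>)"
      unfolding b_def map_map using drop by (intro map_cong) auto
    then have eq: "direct_sum a b = \<sigma>" unfolding direct_sum_def la by (simp add: a_def)
    obtain l where l: "sum_list_of l = a" "\<forall>\<tau>\<in>set l. indec \<tau> \<and> contained_in \<tau> a"
      using less.hyps[of a] a la k(2) by blast
    obtain m where m: "sum_list_of m = b" "\<forall>\<tau>\<in>set m. indec \<tau> \<and> contained_in \<tau> b"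
    proof -
      have "length b < length \<sigma>" using lb k(1,2) by simp
      from less.hyps[OF this b] show thesis using that by blast
    qed
    have "sum_list_of (l @ m) = direct_sum (sum_list_of l) (sum_list_of m)" for l m
      by (induction l) (simp_all add: direct_sum_assoc)
    then have "sum_list_of (l @ m) = \<sigma>" using l m eq by simp
    moreover have "contained_in a \<sigma>" "contained_in b \<sigma>" using contained_direct_sum[OF a b] eq by auto
    then have "\<forall>\<tau>\<in>set (l @ m). indec \<tau> \<and> contained_in \<tau> \<sigma>"
      using l(2) m(2) contained_in_trans[of _ a \<sigma>] contained_in_trans[of _ b \<sigma>]
      unfolding set_append ball_Un by simp
    ultimately show ?thesis by blast
  qed
qed

text \<open>If the first summands had different lengths, the shorter one would be a proper prefix of
  the longer one with values 1..k. Equal first summands can be cancelled.\<close>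

lemma sum_list_of_inj:
  "(\<And>\<sigma>. \<sigma> \<in> set l \<Longrightarrow> indec \<sigma>) \<Longrightarrow> (\<And>\<sigma>. \<sigma> \<in> set m \<Longrightarrow> indec \<sigma>) \<Longrightarrow>
    sum_list_of l = sum_list_of m \<Longrightarrow> l = m"
proof (induction l arbitrary: m)
  case Nil
  then show ?case by (cases m) (auto simp: direct_sum_def indec_def)
next
  case (Cons a l)
  then obtain b m' where m: "m = b # m'" by (cases m) (auto simp: direct_sum_def indec_def)
  have ab: "indec a" "indec b" using Cons.prems m by auto
  have eq: "direct_sum a (sum_list_of l) = direct_sum b (sum_list_of m')" using Cons.prems(3) m by simp
  have not_less: False if "indec a" "indec b" "length a < length b" "direct_sum a u = direct_sum b v" for a b u v
  proof -
    have "take (length a) (direct_sum a u) = a" "take (length a) (direct_sum b v) = take (length a) b"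
      using that(3) by (simp_all add: direct_sum_def)
    then have "take (length a) b = a" using that(4) by simp
    then have "set (take (length a) b) = {1..length a}" using that(1) by (simp add: indec_def perms_iff)
    then show False using that(1,2,3) by (simp add: indec_def)
  qed
  have len: "length a = length b"
    using not_less[OF ab _ eq] not_less[OF ab(2,1) _ eq[symmetric]] by (meson linorder_neqE_nat)
  then have "a = b" "map (\<lambda>v. v + length b) (sum_list_of l) = map (\<lambda>v. v + length b) (sum_list_of m')"
    using eq by (auto simp: direct_sum_def)
  moreover have "inj (\<lambda>v::nat. v + length b)" by (simp add: inj_on_def)
  ultimately have "sum_list_of l = sum_list_of m'" by simp
  then have "l = m'" using Cons.IH[of m'] Cons.prems m by simp
  then show ?case using \<open>a = b\<close> m by simp
qed

definition components :: "nat list \<Rightarrow> nat list set" where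
  "components \<pi> = {\<sigma>. indec \<sigma> \<and> contained_in \<sigma> \<pi>}"

text \<open>For one inclusion, the permutations whose sum-indecomposable patterns all occur in
  \<open>\<pi>\<close> (the set \<open>D\<close>) form a sum-closed class, and each is the sum of
  its own components.\<close>

lemma sum_closure_eq: "sum_closure (Sub \<pi>) = sum_list_of ` lists (components \<pi>)"
  (is "?L = ?R")
proof
  define D where "D = {\<sigma> \<in> perms. \<forall>\<tau>. indec \<tau> \<longrightarrow> contained_in \<tau> \<sigma> \<longrightarrow> contained_in \<tau> \<pi>}"
  have "perm_class D" unfolding perm_class_def D_def using contained_in_trans by blast
  moreover have "Sub \<pi> \<subseteq> D" unfolding Sub_def D_def using contained_in_trans by blast
  moreover have "direct_sum \<sigma> \<tau> \<in> D" if "\<sigma> \<in> D" "\<tau> \<in> D" for \<sigma> \<tau>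
    using that direct_sum_perms indec_contained_direct_sum unfolding D_def by blast
  ultimately have LD: "?L \<subseteq> D" unfolding sum_closure_def by blast
  show "?L \<subseteq> ?R"
  proof
    fix \<sigma> assume "\<sigma> \<in> ?L"
    then have s: "\<sigma> \<in> perms" "\<And>\<tau>. indec \<tau> \<Longrightarrow> contained_in \<tau> \<sigma> \<Longrightarrow> contained_in \<tau> \<pi>"
      using LD unfolding D_def by auto
    obtain l where l: "sum_list_of l = \<sigma>" "\<forall>\<tau>\<in>set l. indec \<tau> \<and> contained_in \<tau> \<sigma>"
      using indec_decomposition[OF s(1)] by blast
    then have "l \<in> lists (components \<pi>)" using s(2) by (auto simp: components_def)
    then show "\<sigma> \<in> ?R" using l(1) by blast
  qed
  show "?R \<subseteq> ?L"
    unfolding sum_closure_def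
  proof (intro Inter_greatest)
    fix C assume C: "C \<in> {C. perm_class C \<and> Sub \<pi> \<subseteq> C \<and> (\<forall>\<sigma>\<in>C. \<forall>\<tau>\<in>C. direct_sum \<sigma> \<tau> \<in> C)}"
    have nil: "[] \<in> C" using C by (auto simp: Sub_def contained_in_def order_isomorphic_def)
    have comp: "components \<pi> \<subseteq> C" using C by (auto simp: Sub_def components_def indec_perms)
    have "sum_list_of l \<in> C" if "l \<in> lists (components \<pi>)" for l
      using that
    proof (induction l)
      case (Cons \<sigma> l)
      then show ?case using C comp by auto
    qed (simp add: nil)
    then show "?R \<subseteq> C" by blast
  qed
qed

lemma finite_components: "finite (components \<pi>)"
proof (rule finite_subset)
  show "components \<pi> \<subseteq> {xs. set xs \<subseteq> {..length \<pi>} \<and> length xs \<le> length \<pi>}"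
  proof
    fix \<sigma> assume "\<sigma> \<in> components \<pi>"
    then have "set \<sigma> = {1..length \<sigma>}" "length \<sigma> \<le> length \<pi>"
      using contained_in_length by (auto simp: components_def indec_def perms_iff)
    then show "\<sigma> \<in> {xs. set xs \<subseteq> {..length \<pi>} \<and> length xs \<le> length \<pi>}" by auto
  qed
  show "finite {xs. set xs \<subseteq> {..length \<pi>} \<and> length xs \<le> length \<pi>}"
    by (rule finite_lists_length_le) simp
qed

lemma components_length: "\<sigma> \<in> components \<pi> \<Longrightarrow> 0 < length \<sigma> \<and> length \<sigma> \<le> length \<pi>"
  using contained_in_length by (auto simp: components_def indec_def)

lemma singleton_component: "\<pi> \<noteq> [] \<Longrightarrow> [1] \<in> components \<pi>"
proof -
  assume "\<pi> \<noteq> []"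
  then have "embeds [1] \<pi> (\<lambda>_. 0)" by (simp add: embeds_def)
  then have "contained_in [1] \<pi>" using contained_in_iff by blast
  moreover have "indec [1]" by (auto simp: indec_def perms_iff)
  ultimately show ?thesis by (simp add: components_def)
qed

section \<open>Counting the sum closure by sequences of components\<close>

definition seqs :: "nat list set \<Rightarrow> nat \<Rightarrow> nat list list set" where
  "seqs S n = {l \<in> lists S. sum_list (map length l) = n}"

lemma card_sum_closure: "card {\<sigma> \<in> sum_closure (Sub \<pi>). length \<sigma> = n} = card (seqs (components \<pi>) n)"
proof -
  have "{\<sigma> \<in> sum_closure (Sub \<pi>). length \<sigma> = n} = sum_list_of ` seqs (components \<pi>) n"
    unfolding sum_closure_eq seqs_def by (auto simp: length_sum_list_of)
  moreover have "inj_on sum_list_of (seqs (components \<pi>) n)"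
    by (intro inj_onI sum_list_of_inj) (auto simp: seqs_def components_def)
  ultimately show ?thesis by (simp add: card_image)
qed

lemma seqs_0: "(\<And>\<sigma>. \<sigma> \<in> S \<Longrightarrow> 0 < length \<sigma>) \<Longrightarrow> seqs S 0 = {[]}"
  unfolding seqs_def by (auto simp: in_lists_conv_set)

lemma seqs_rec:
  assumes "0 < n"
  shows "seqs S n = (\<Union>\<sigma>\<in>{\<sigma> \<in> S. length \<sigma> \<le> n}. (#) \<sigma> ` seqs S (n - length \<sigma>))"
proof (intro set_eqI iffI)
  fix l assume l: "l \<in> seqs S n"
  then obtain \<sigma> l' where "l = \<sigma> # l'" using assms by (cases l) (auto simp: seqs_def)
  then show "l \<in> (\<Union>\<sigma>\<in>{\<sigma> \<in> S. length \<sigma> \<le> n}. (#) \<sigma> ` seqs S (n - length \<sigma>))"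
    using l by (intro UN_I[of \<sigma>] image_eqI[of _ _ l']) (auto simp: seqs_def)
qed (auto simp: seqs_def)

lemma finite_seqs:
  assumes "finite S" "\<And>\<sigma>. \<sigma> \<in> S \<Longrightarrow> 0 < length \<sigma>" shows "finite (seqs S n)"
proof (induction n rule: less_induct)
  case (less n)
  then show ?case
  proof (cases "n = 0")
    case False
    then show ?thesis unfolding seqs_rec[OF False[unfolded neq0_conv]]
      using assms less by auto
  qed (simp add: seqs_0[OF assms(2)])
qed

lemma card_seqs_rec:
  assumes "finite S" "\<And>\<sigma>. \<sigma> \<in> S \<Longrightarrow> 0 < length \<sigma>" "0 < n"
  shows "card (seqs S n) = (\<Sum>\<sigma>\<in>{\<sigma> \<in> S. length \<sigma> \<le> n}. card (seqs S (n - length \<sigma>)))"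
proof -
  have "card (seqs S n) = (\<Sum>\<sigma>\<in>{\<sigma> \<in> S. length \<sigma> \<le> n}. card ((#) \<sigma> ` seqs S (n - length \<sigma>)))"
    unfolding seqs_rec[OF assms(3)]
    using assms(1) finite_seqs[OF assms(1,2)] by (intro card_UN_disjoint) auto
  also have "\<dots> = (\<Sum>\<sigma>\<in>{\<sigma> \<in> S. length \<sigma> \<le> n}. card (seqs S (n - length \<sigma>)))"
    by (intro sum.cong refl card_image) (simp add: inj_on_def)
  finally show ?thesis .
qed

text \<open>If \<open>y\<close> solves the weight equation, the counts times \<open>y ^ n\<close>
  satisfy a recurrence whose coefficients sum to 1, so they stay between two positive constants.
  Hence the n-th roots converge to 1/\<open>y\<close>, and existence of the limit comes out of the
  same argument.\<close>

lemma growth_rate_ge_xi: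
  assumes "\<pi> \<noteq> []" "1 \<le> (\<Sum>\<sigma>\<in>components \<pi>. (1 / xi) ^ length \<sigma>)"
  shows "xi \<le> growth_rate (sum_closure (Sub \<pi>))"
proof -
  define S where "S = components \<pi>"
  define N where "N = length \<pi>"
  define c where "c n = real (card (seqs S n))" for n
  have fin: "finite S" and pos: "\<And>\<sigma>. \<sigma> \<in> S \<Longrightarrow> 0 < length \<sigma>" and le: "\<And>\<sigma>. \<sigma> \<in> S \<Longrightarrow> length \<sigma> \<le> N"
    and one: "[1] \<in> S"
    using finite_components components_length singleton_component[OF assms(1)] by (auto simp: S_def N_def)
  have "\<exists>y\<ge>0. y \<le> 1 / xi \<and> (\<Sum>\<sigma>\<in>S. y ^ length \<sigma>) = 1"
  proof (rule IVT')
    have "(\<Sum>\<sigma>\<in>S. (0::real) ^ length \<sigma>) = 0" using pos by (intro sum.neutral) auto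
    then show "(\<Sum>\<sigma>\<in>S. (0::real) ^ length \<sigma>) \<le> 1" by simp
    show "1 \<le> (\<Sum>\<sigma>\<in>S. (1 / xi) ^ length \<sigma>)" using assms(2) by (simp add: S_def)
    show "0 \<le> 1 / xi" using xi_pos by simp
    show "continuous_on {0..1 / xi} (\<lambda>y. \<Sum>\<sigma>\<in>S. y ^ length \<sigma>)" by (intro continuous_intros)
  qed
  then obtain y where y: "0 \<le> y" "y \<le> 1 / xi" "(\<Sum>\<sigma>\<in>S. y ^ length \<sigma>) = 1" by blast
  have "y \<noteq> 0"
  proof
    assume "y = 0"
    then have "(\<Sum>\<sigma>\<in>S. y ^ length \<sigma>) = 0" using pos by (intro sum.neutral) auto
    then show False using y(3) by simp
  qed
  then have y0: "0 < y" using y(1) by simp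
  have "y ^ length [1::nat] \<le> (\<Sum>\<sigma>\<in>S. y ^ length \<sigma>)"
    using one fin y0 by (intro member_le_sum[where f = "\<lambda>\<sigma>. y ^ length \<sigma>"]) auto
  then have y1: "y \<le> 1" using y(3) by simp
  define a where "a n = c n * y ^ n" for n
  have a0: "a 0 = 1" by (simp add: a_def c_def seqs_0[OF pos])
  have rec: "a n = (\<Sum>\<sigma>\<in>{\<sigma> \<in> S. length \<sigma> \<le> n}. y ^ length \<sigma> * a (n - length \<sigma>))" if "0 < n" for n
  proof -
    have "a n = (\<Sum>\<sigma>\<in>{\<sigma> \<in> S. length \<sigma> \<le> n}. c (n - length \<sigma>) * y ^ n)"
    proof -
      have "c n = (\<Sum>\<sigma>\<in>{\<sigma> \<in> S. length \<sigma> \<le> n}. c (n - length \<sigma>))"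
        using card_seqs_rec[OF fin pos that] by (simp add: c_def)
      then show ?thesis by (simp add: a_def sum_distrib_right)
    qed
    also have "\<dots> = (\<Sum>\<sigma>\<in>{\<sigma> \<in> S. length \<sigma> \<le> n}. y ^ length \<sigma> * a (n - length \<sigma>))"
    proof (rule sum.cong)
      fix \<sigma> assume "\<sigma> \<in> {\<sigma> \<in> S. length \<sigma> \<le> n}"
      then have "y ^ n = y ^ length \<sigma> * y ^ (n - length \<sigma>)" by (simp flip: power_add)
      then show "c (n - length \<sigma>) * y ^ n = y ^ length \<sigma> * a (n - length \<sigma>)" by (simp add: a_def)
    qed simp
    finally show ?thesis .
  qed
  have nonneg: "0 \<le> a n" for n using y0 by (simp add: a_def c_def)
  have upper: "a n \<le> 1" for n
  proof (induction n rule: less_induct)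
    case (less n)
    show ?case
    proof (cases "n = 0")
      case False
      have "a n = (\<Sum>\<sigma>\<in>{\<sigma> \<in> S. length \<sigma> \<le> n}. y ^ length \<sigma> * a (n - length \<sigma>))" using rec False by simp
      also have "\<dots> \<le> (\<Sum>\<sigma>\<in>{\<sigma> \<in> S. length \<sigma> \<le> n}. y ^ length \<sigma> * 1)"
        using less False pos y0 by (intro sum_mono mult_left_mono) auto
      also have "\<dots> \<le> (\<Sum>\<sigma>\<in>S. y ^ length \<sigma>)" using fin y0 by (auto intro: sum_mono2)
      finally show ?thesis using y(3) by simp
    qed (simp add: a0)
  qed
  have lower: "y ^ N \<le> a n" for n
  proof (induction n rule: less_induct)
    case (less n)
    show ?case
    proof (cases "n < N \<or> n = 0")
      case True
      \<comment> \<open>Below length \<open>N\<close> some components may not fit yet, so the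
        recurrence may miss weight. The sequence of \<open>n\<close> singletons gives a count of at
        least 1 there.\<close>
      have "replicate n [1] \<in> seqs S n" using one
        by (auto simp: seqs_def sum_list_replicate in_lists_conv_set)
      then have "0 < card (seqs S n)" using finite_seqs[OF fin pos] card_gt_0_iff by blast
      then have "1 * y ^ n \<le> a n" unfolding a_def c_def using y0 by (intro mult_right_mono) auto
      moreover have "y ^ N \<le> y ^ n" using True y0 y1 by (intro power_decreasing) auto
      ultimately show ?thesis by simp
    next
      case False
      then have S: "{\<sigma> \<in> S. length \<sigma> \<le> n} = S" using le by fastforce
      have "y ^ N = (\<Sum>\<sigma>\<in>S. y ^ length \<sigma> * y ^ N)" using y(3) by (simp flip: sum_distrib_right)
      also have "\<dots> \<le> (\<Sum>\<sigma>\<in>S. y ^ length \<sigma> * a (n - length \<sigma>))"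
        using less False pos y0 by (intro sum_mono mult_left_mono) auto
      finally show ?thesis using rec[of n] False unfolding S by simp
    qed
  qed
  have root: "root n (c n) = root n (a n) * (1 / y)" if "0 < n" for n
  proof -
    have "c n = a n * (1 / y) ^ n" using y0 by (simp add: a_def power_divide)
    then show ?thesis using that y0 by (simp add: real_root_mult real_root_power_cancel)
  qed
  have "(\<lambda>n. root n (a n)) \<longlonglongrightarrow> 1"
  proof (rule tendsto_sandwich)
    show "(\<lambda>n. root n (y ^ N)) \<longlonglongrightarrow> 1" using y0 by (intro LIMSEQ_root_const) simp
    show "(\<lambda>n. 1::real) \<longlonglongrightarrow> 1" by simp
    show "\<forall>\<^sub>F n in sequentially. root n (y ^ N) \<le> root n (a n)"
      by (rule eventually_mono[OF eventually_gt_at_top[of 0]]) (simp add: lower)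
    show "\<forall>\<^sub>F n in sequentially. root n (a n) \<le> 1"
      by (rule eventually_mono[OF eventually_gt_at_top[of 0]]) (simp add: upper)
  qed
  then have "(\<lambda>n. root n (a n) * (1 / y)) \<longlonglongrightarrow> 1 * (1 / y)" by (intro tendsto_mult tendsto_const)
  moreover have "\<forall>\<^sub>F n in sequentially. root n (a n) * (1 / y) = root n (c n)"
    using eventually_gt_at_top[of 0] by eventually_elim (simp add: root)
  ultimately have "(\<lambda>n. root n (c n)) \<longlonglongrightarrow> 1 / y" by (simp add: filterlim_cong)
  then have "growth_rate (sum_closure (Sub \<pi>)) = 1 / y"
    unfolding growth_rate_def card_sum_closure c_def S_def by (rule limI)
  moreover have "xi \<le> 1 / y" using y(2) y0 xi_pos by (simp add: field_simps)
  ultimately show ?thesis by simp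
qed

abbreviation col :: "nat \<Rightarrow> real" where "col i \<equiv> real (Suc i)"
abbreviation row :: "nat list \<Rightarrow> nat \<Rightarrow> real" where "row \<pi> i \<equiv> real (\<pi> ! i)"

lemma light_plot:
  assumes "growth_rate (sum_closure (Sub \<pi>)) < xi"
  shows "light {..<length \<pi>} col (row \<pi>)"
  unfolding light_def
proof (intro allI impI)
  fix F assume F: "finite F \<and> (\<forall>\<sigma>\<in>F. indec \<sigma> \<and> has_pattern {..<length \<pi>} col (row \<pi>) \<sigma>)"
  have "has_pattern {..<length \<pi>} col (row \<pi>) \<sigma> \<longleftrightarrow> has_pattern {..<length \<pi>} (\<lambda>i. real i) (row \<pi>) \<sigma>" for \<sigma>
    by (simp add: has_pattern_def)
  then have "F \<subseteq> components \<pi>" using F has_contained by (auto simp: components_def)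
  then have "(\<Sum>\<sigma>\<in>F. (1 / xi) ^ length \<sigma>) \<le> (\<Sum>\<sigma>\<in>components \<pi>. (1 / xi) ^ length \<sigma>)"
    using finite_components xi_pos by (intro sum_mono2) auto
  also have "\<dots> < 1"
  proof (cases "\<pi> = []")
    case True
    then have "components \<pi> = {}" using components_length by fastforce
    then show ?thesis by simp
  next
    case False
    then show ?thesis using growth_rate_ge_xi[OF False] assms by linarith
  qed
  finally show "(\<Sum>\<sigma>\<in>F. (1 / xi) ^ length \<sigma>) < 1" .
qed

section \<open>Reversal exchanges sum closures and skew closures\<close>

lemma embeds_rev:
  assumes "embeds \<sigma> \<pi> g"
  shows "embeds (rev \<sigma>) (rev \<pi>) (\<lambda>i. length \<pi> - Suc (g (length \<sigma> - Suc i)))"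
proof -
  have gm: "\<And>i j. i < j \<Longrightarrow> j < length \<sigma> \<Longrightarrow> g i < g j" and gl: "\<And>i. i < length \<sigma> \<Longrightarrow> g i < length \<pi>"
    and go: "\<And>i j. i < length \<sigma> \<Longrightarrow> j < length \<sigma> \<Longrightarrow> \<sigma> ! i < \<sigma> ! j \<longleftrightarrow> \<pi> ! g i < \<pi> ! g j"
    using assms by (auto simp: embeds_def)
  show ?thesis
    unfolding embeds_def
  proof (intro conjI allI impI)
    fix i j assume ij: "i < j" "j < length (rev \<sigma>)"
    then have "g (length \<sigma> - Suc j) < g (length \<sigma> - Suc i)" by (intro gm) auto
    moreover have "g (length \<sigma> - Suc i) < length \<pi>" using ij by (intro gl) auto
    ultimately show "length \<pi> - Suc (g (length \<sigma> - Suc i)) < length \<pi> - Suc (g (length \<sigma> - Suc j))" by linarith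
  next
    fix i assume i: "i < length (rev \<sigma>)"
    have gi: "g (length \<sigma> - Suc i) < length \<pi>" using i by (intro gl) auto
    then show "length \<pi> - Suc (g (length \<sigma> - Suc i)) < length (rev \<pi>)" by simp
    fix j assume j: "j < length (rev \<sigma>)"
    have gj: "g (length \<sigma> - Suc j) < length \<pi>" using j by (intro gl) auto
    show "rev \<sigma> ! i < rev \<sigma> ! j \<longleftrightarrow> rev \<pi> ! (length \<pi> - Suc (g (length \<sigma> - Suc i))) <
        rev \<pi> ! (length \<pi> - Suc (g (length \<sigma> - Suc j)))"
      using go[of "length \<sigma> - Suc i" "length \<sigma> - Suc j"] gi gj i j by (simp add: rev_nth)
  qed
qed

lemma contained_in_rev: "contained_in (rev \<sigma>) (rev \<pi>) \<longleftrightarrow> contained_in \<sigma> \<pi>"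
  using embeds_rev[of \<sigma> \<pi>] embeds_rev[of "rev \<sigma>" "rev \<pi>"] unfolding contained_in_iff rev_rev_ident by blast

lemma rev_perms: "rev \<sigma> \<in> perms \<longleftrightarrow> \<sigma> \<in> perms"
  by (simp add: perms_iff)

lemma perm_class_rev:
  assumes "perm_class C" shows "perm_class {\<sigma>. rev \<sigma> \<in> C}"
  using assms unfolding perm_class_def
proof (intro conjI ballI impI)
  assume C: "C \<subseteq> perms \<and> (\<forall>\<pi>\<in>C. \<forall>\<sigma>\<in>perms. contained_in \<sigma> \<pi> \<longrightarrow> \<sigma> \<in> C)"
  show "{\<sigma>. rev \<sigma> \<in> C} \<subseteq> perms" using C rev_perms by blast
  fix \<pi> \<sigma> assume "\<pi> \<in> {\<sigma>. rev \<sigma> \<in> C}" "\<sigma> \<in> perms" "contained_in \<sigma> \<pi>"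
  then have "rev \<pi> \<in> C" "rev \<sigma> \<in> perms" "contained_in (rev \<sigma>) (rev \<pi>)"
    by (simp_all add: contained_in_rev rev_perms)
  then show "\<sigma> \<in> {\<sigma>. rev \<sigma> \<in> C}" using C by simp
qed

text \<open>Reversal turns skew sums into direct sums with the summands exchanged. It therefore maps
  the classes in one intersection to those in the other, in both directions.\<close>

lemma skew_closure_rev: "skew_closure (Sub \<pi>) = {\<sigma>. rev \<sigma> \<in> sum_closure (Sub (rev \<pi>))}"
proof -
  define F where "F = {C. perm_class C \<and> Sub (rev \<pi>) \<subseteq> C \<and> (\<forall>\<sigma>\<in>C. \<forall>\<tau>\<in>C. direct_sum \<sigma> \<tau> \<in> C)}"
  define G where "G = {C. perm_class C \<and> Sub \<pi> \<subseteq> C \<and> (\<forall>\<sigma>\<in>C. \<forall>\<tau>\<in>C. skew_sum \<sigma> \<tau> \<in> C)}"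
  let ?r = "\<lambda>C. {\<sigma>. rev \<sigma> \<in> C}"
  have Sub: "rev \<sigma> \<in> Sub (rev \<pi>) \<longleftrightarrow> \<sigma> \<in> Sub \<pi>" for \<sigma>
    by (simp add: Sub_def rev_perms contained_in_rev)
  have skew: "rev (skew_sum \<sigma> \<tau>) = direct_sum (rev \<tau>) (rev \<sigma>)" for \<sigma> \<tau>
    by (simp add: skew_sum_def direct_sum_def rev_map)
  have dsum: "rev (direct_sum \<sigma> \<tau>) = skew_sum (rev \<tau>) (rev \<sigma>)" for \<sigma> \<tau>
    by (simp add: skew_sum_def direct_sum_def rev_map)
  have FG: "?r C \<in> G" if "C \<in> F" for C
  proof -
    have C: "perm_class C" "Sub (rev \<pi>) \<subseteq> C" "\<And>\<sigma> \<tau>. \<sigma> \<in> C \<Longrightarrow> \<tau> \<in> C \<Longrightarrow> direct_sum \<sigma> \<tau> \<in> C"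
      using that by (auto simp: F_def)
    show ?thesis unfolding G_def using perm_class_rev[OF C(1)] C(2,3) Sub by (auto simp: skew)
  qed
  have GF: "?r C \<in> F" if "C \<in> G" for C
  proof -
    have C: "perm_class C" "Sub \<pi> \<subseteq> C" "\<And>\<sigma> \<tau>. \<sigma> \<in> C \<Longrightarrow> \<tau> \<in> C \<Longrightarrow> skew_sum \<sigma> \<tau> \<in> C"
      using that by (auto simp: G_def)
    have "Sub (rev \<pi>) \<subseteq> ?r C" using C(2) Sub[of "rev _"] by auto
    then show ?thesis unfolding F_def using perm_class_rev[OF C(1)] C(3) by (auto simp: dsum)
  qed
  have "\<Inter>G = ?r (\<Inter>F)"
  proof (intro set_eqI iffI)
    fix \<sigma> assume "\<sigma> \<in> \<Inter>G"
    then have "\<sigma> \<in> ?r C" if "C \<in> F" for C using FG[OF that] by blast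
    then show "\<sigma> \<in> ?r (\<Inter>F)" by simp
  next
    fix \<sigma> assume s: "\<sigma> \<in> ?r (\<Inter>F)"
    have "\<sigma> \<in> C" if "C \<in> G" for C
    proof -
      have "rev \<sigma> \<in> ?r C" using s GF[OF that] by blast
      then show ?thesis by simp
    qed
    then show "\<sigma> \<in> \<Inter>G" by blast
  qed
  then show ?thesis unfolding skew_closure_def sum_closure_def F_def G_def .
qed

lemma growth_rate_skew_closure:
  "growth_rate (skew_closure (Sub \<pi>)) = growth_rate (sum_closure (Sub (rev \<pi>)))"
proof -
  have "card {\<sigma> \<in> skew_closure (Sub \<pi>). length \<sigma> = n} = card {\<sigma> \<in> sum_closure (Sub (rev \<pi>)). length \<sigma> = n}" for n
  proof (rule bij_betw_same_card[of rev])
    show "bij_betw rev {\<sigma> \<in> skew_closure (Sub \<pi>). length \<sigma> = n}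
        {\<sigma> \<in> sum_closure (Sub (rev \<pi>)). length \<sigma> = n}"
      by (rule bij_betwI[where g = rev]) (auto simp: skew_closure_rev)
  qed
  then show ?thesis by (simp add: growth_rate_def)
qed

text \<open>Negating the columns reads the plot from right to left, so the patterns found are those
  of \<open>rev \<pi>\<close>.\<close>

lemma light_plot_skew:
  assumes "growth_rate (skew_closure (Sub \<pi>)) < xi"
  shows "light {..<length \<pi>} (\<lambda>i. - col i) (row \<pi>)"
proof (rule light_transfer[where t = "\<lambda>\<sigma>. \<sigma>"])
  show "light {..<length \<pi>} col (row (rev \<pi>))"
    using assms light_plot[of "rev \<pi>"] by (simp add: growth_rate_skew_closure)
  fix \<sigma> assume s: "indec \<sigma>" "has_pattern {..<length \<pi>} (\<lambda>i. - col i) (row \<pi>) \<sigma>"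
  then obtain e where e: "\<And>i. i < length \<sigma> \<Longrightarrow> e i < length \<pi>"
    "\<And>i j. i < length \<sigma> \<Longrightarrow> j < length \<sigma> \<Longrightarrow> (e j < e i \<longleftrightarrow> i < j) \<and> (\<pi> ! e i < \<pi> ! e j \<longleftrightarrow> \<sigma> ! i < \<sigma> ! j)"
    unfolding has_pattern_def by auto
  let ?f = "\<lambda>i. length \<pi> - Suc (e i)"
  have "has_pattern {..<length \<pi>} col (row (rev \<pi>)) \<sigma>"
    unfolding has_pattern_def
  proof (intro exI[of _ ?f] conjI allI impI)
    fix i assume i: "i < length \<sigma>"
    then show "?f i \<in> {..<length \<pi>}" using e(1)[OF i] by simp
    fix j assume j: "j < length \<sigma>"
    show "col (?f i) < col (?f j) \<longleftrightarrow> i < j" using e(1)[OF i] e(1)[OF j] e(2)[OF i j] by auto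
    show "row (rev \<pi>) (?f i) < row (rev \<pi>) (?f j) \<longleftrightarrow> \<sigma> ! i < \<sigma> ! j"
      using e(1)[OF i] e(1)[OF j] e(2)[OF i j] by (simp add: rev_nth)
  qed
  then show "indec \<sigma> \<and> has_pattern {..<length \<pi>} col (row (rev \<pi>)) \<sigma> \<and> length \<sigma> = length \<sigma> \<and> \<sigma> = \<sigma>"
    using s(1) by simp
qed

section \<open>Concentration\<close>

text \<open>Lightness does not survive a reflection, but a cover by independent blocks does. This
  carries the result for the reversed plot back to the plot itself.\<close>

lemma cover_neg1:
  assumes "cover q r P (\<lambda>p. - X p) Y (- c)" shows "cover q r P X Y c"
proof -
  obtain R \<P> where "R \<subseteq> P" "card R \<le> r" "finite \<P>" "card \<P> \<le> q" "\<Union>\<P> = P - R"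
    "blocks (\<lambda>p. - X p) Y \<P>" "\<forall>A\<in>\<P>. (\<forall>a\<in>A. - X a < - c) \<or> (\<forall>a\<in>A. - c < - X a)"
    using assms unfolding cover_def by (elim exE conjE) (rule that; assumption)
  then show ?thesis unfolding cover_def blocks_neg1
    by (intro exI[of _ R] exI[of _ \<P>]) auto
qed

lemma cover_neg2:
  assumes "cover q r P X (\<lambda>p. - Y p) c" shows "cover q r P X Y c"
  using assms unfolding cover_def blocks_swap[of X "\<lambda>p. - Y p"] blocks_neg1 blocks_swap[of Y X] .

section \<open>From independent blocks to rectangles\<close>

text \<open>If the intervals met, the larger of the two minima would lie strictly between the
  minimum and the maximum of the other set.\<close>

lemma bbox_disjoint:
  fixes X :: "'a \<Rightarrow> real"
  assumes "finite A" "finite B" "A \<noteq> {}" "B \<noteq> {}" "inj_on X (A \<union> B)" "A \<inter> B = {}"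
    "\<And>a. a \<in> A \<Longrightarrow> \<not> straddled X B a" "\<And>b. b \<in> B \<Longrightarrow> \<not> straddled X A b"
  shows "{Min (X ` A)..Max (X ` A)} \<inter> {Min (X ` B)..Max (X ` B)} = {}"
proof (rule ccontr)
  assume "\<not> ?thesis"
  then obtain t where "t \<in> {Min (X ` A)..Max (X ` A)} \<inter> {Min (X ` B)..Max (X ` B)}" by blast
  then have t: "Min (X ` A) \<le> t" "t \<le> Max (X ` A)" "Min (X ` B) \<le> t" "t \<le> Max (X ` B)" by simp_all
  have ends: "Min (X ` A) \<in> X ` A" "Max (X ` A) \<in> X ` A" "Min (X ` B) \<in> X ` B" "Max (X ` B) \<in> X ` B"
    using assms(1-4) by simp_all
  obtain a1 where a1: "Min (X ` A) = X a1" "a1 \<in> A" using ends(1) by (rule imageE)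
  obtain a2 where a2: "Max (X ` A) = X a2" "a2 \<in> A" using ends(2) by (rule imageE)
  obtain b1 where b1: "Min (X ` B) = X b1" "b1 \<in> B" using ends(3) by (rule imageE)
  obtain b2 where b2: "Max (X ` B) = X b2" "b2 \<in> B" using ends(4) by (rule imageE)
  note ab = a1(2) a1(1)[symmetric] a2(2) a2(1)[symmetric] b1(2) b1(1)[symmetric] b2(2) b2(1)[symmetric]
  have ne: "X a \<noteq> X b" if "a \<in> A" "b \<in> B" for a b
    using assms(5,6) that by (metis UnCI disjoint_iff inj_onD)
  have "X a1 < X b1 \<or> X b1 < X a1" using ne[OF ab(1,5)] by linarith
  then show False
  proof
    assume "X a1 < X b1"
    moreover have "X b1 < X a2" using t ab ne[OF ab(3,5)] by linarith
    ultimately show False using assms(8)[OF ab(5)] ab(1,3) unfolding straddled_def by blast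
  next
    assume "X b1 < X a1"
    moreover have "X a1 < X b2" using t ab ne[OF ab(1,7)] by linarith
    ultimately show False using assms(7)[OF ab(1)] ab(5,7) unfolding straddled_def by blast
  qed
qed

definition bbox :: "('a \<Rightarrow> real) \<Rightarrow> ('a \<Rightarrow> real) \<Rightarrow> 'a set \<Rightarrow> (real \<times> real) set" where
  "bbox X Y A = {Min (X ` A)..Max (X ` A)} \<times> {Min (Y ` A)..Max (Y ` A)}"

lemma bbox_bounds:
  assumes "finite A" "A \<noteq> {}" "\<And>a. a \<in> A \<Longrightarrow> l \<le> X a \<and> X a \<le> (u::real)"
  shows "{Min (X ` A)..Max (X ` A)} \<subseteq> {l..u}" "{Min (X ` A)..Max (X ` A)} \<noteq> {}"
proof -
  have "Min (X ` A) \<in> X ` A" "Max (X ` A) \<in> X ` A" using assms(1,2) by simp_all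
  then show "{Min (X ` A)..Max (X ` A)} \<subseteq> {l..u}" using assms(3) by fastforce
  show "{Min (X ` A)..Max (X ` A)} \<noteq> {}"
    using assms(1,2) Min_le[of "X ` A" "Max (X ` A)"] by simp
qed

text \<open>The rectangles are the bounding boxes of the blocks; degenerate rectangles beyond the plot bring
  their number up to exactly \<open>q\<close>.\<close>

lemma blocks_rectangles:
  fixes P :: "'a set"
  assumes P: "finite P" "inj_on X P" "inj_on Y P" "\<And>p. p \<in> P \<Longrightarrow> X p \<le> n \<and> Y p \<le> n"
    and R: "R \<subseteq> P" "card R \<le> r" and \<P>: "finite \<P>" "card \<P> \<le> q" "\<Union>\<P> = P - R" "blocks X Y \<P>"
    and L: "\<And>A. A \<in> \<P> \<Longrightarrow> A \<noteq> {} \<Longrightarrow> bbox X Y A \<inter> L = {}" "\<And>t. n < t \<Longrightarrow> (t, t) \<notin> L"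
  shows "\<exists>S :: nat \<Rightarrow> (real \<times> real) set. (\<forall>i<q. rectangle (S i) \<and> S i \<inter> L = {}) \<and>
    (\<forall>i<q. \<forall>j<q. i \<noteq> j \<longrightarrow> independent_rects (S i) (S j)) \<and>
    card ((\<lambda>p. (X p, Y p)) ` P - (\<Union>i<q. S i)) \<le> r"
proof -
  obtain h where h: "bij_betw h {..<card \<P>} \<P>"
    using ex_bij_betw_nat_finite[OF \<P>(1)] by (auto simp: atLeast0LessThan)
  \<comment> \<open>Blocks may be empty and then have no bounding box, so their indices receive
    padding rectangles too.\<close>
  define real_block where "real_block i \<longleftrightarrow> i < card \<P> \<and> h i \<noteq> {}" for i
  define t where "t i = n + 1 + real i" for i
  define S where "S i = (if real_block i then bbox X Y (h i) else {t i..t i} \<times> {t i..t i})" for i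
  have hP: "h i \<in> \<P>" "h i \<noteq> {}" "finite (h i)" "h i \<subseteq> P" if "real_block i" for i
  proof -
    show "h i \<in> \<P>" "h i \<noteq> {}" using that h by (auto simp: real_block_def bij_betw_def)
    then show "h i \<subseteq> P" using \<P>(3) by blast
    then show "finite (h i)" using P(1) finite_subset by blast
  qed
  define m where "m = Min (insert 0 (X ` P \<union> Y ` P))"
  have m: "m \<le> X p" "m \<le> Y p" if "p \<in> P" for p using that P(1) by (auto simp: m_def)
  have bnd: "{Min (X ` h i)..Max (X ` h i)} \<subseteq> {m..n}" "{Min (X ` h i)..Max (X ` h i)} \<noteq> {}"
      "{Min (Y ` h i)..Max (Y ` h i)} \<subseteq> {m..n}" "{Min (Y ` h i)..Max (Y ` h i)} \<noteq> {}" if "real_block i" for i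
  proof -
    have "m \<le> X a \<and> X a \<le> n" "m \<le> Y a \<and> Y a \<le> n" if "a \<in> h i" for a
      using hP(4)[OF \<open>real_block i\<close>] that m P(4) by blast+
    then show "{Min (X ` h i)..Max (X ` h i)} \<subseteq> {m..n}" "{Min (X ` h i)..Max (X ` h i)} \<noteq> {}"
      "{Min (Y ` h i)..Max (Y ` h i)} \<subseteq> {m..n}" "{Min (Y ` h i)..Max (Y ` h i)} \<noteq> {}"
      using bbox_bounds[OF hP(3,2)[OF \<open>real_block i\<close>]] by blast+
  qed
  have proj: "fst ` S i = (if real_block i then {Min (X ` h i)..Max (X ` h i)} else {t i})"
    "snd ` S i = (if real_block i then {Min (Y ` h i)..Max (Y ` h i)} else {t i})" for i
    using bnd(2,4)[of i] by (auto simp: S_def bbox_def fst_image_times snd_image_times)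
  have tn: "n < t i" for i by (simp add: t_def)
  have ind: "fst ` S i \<inter> fst ` S j = {} \<and> snd ` S i \<inter> snd ` S j = {}" if ij: "i \<noteq> j" for i j
  proof -
    consider "real_block i" "real_block j" | "real_block i" "\<not> real_block j"
      | "\<not> real_block i" "real_block j" | "\<not> real_block i" "\<not> real_block j" by blast
    then show ?thesis
    proof cases
      case 1
      have "h i \<noteq> h j" using h 1 ij by (auto simp: bij_betw_def inj_on_def real_block_def)
      then have I: "indep_sets X Y (h i) (h j)" using \<P>(4) hP(1) 1 unfolding blocks_def by blast
      have sub: "h i \<union> h j \<subseteq> P" using hP(4) 1 by blast
      have "inj_on X (h i \<union> h j)" "inj_on Y (h i \<union> h j)" using P(2,3) sub by (auto intro: inj_on_subset)
      note inj = this
      have I': "h i \<inter> h j = {}" "\<And>a. a \<in> h i \<Longrightarrow> \<not> straddled X (h j) a" "\<And>a. a \<in> h i \<Longrightarrow> \<not> straddled Y (h j) a"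
        "\<And>b. b \<in> h j \<Longrightarrow> \<not> straddled X (h i) b" "\<And>b. b \<in> h j \<Longrightarrow> \<not> straddled Y (h i) b"
        using I unfolding indep_sets_def by simp_all
      note * = hP(3)[OF 1(1)] hP(3)[OF 1(2)] hP(2)[OF 1(1)] hP(2)[OF 1(2)]
      show ?thesis unfolding proj using 1 bbox_disjoint[OF * inj(1) I'(1,2,4)]
          bbox_disjoint[OF * inj(2) I'(1,3,5)] by (simp only: if_True simp_thms)
    next
      case 2
      have "t j \<notin> {m..n}" using tn[of j] by simp
      then show ?thesis unfolding proj using 2 bnd(1,3)[OF 2(1)] by (simp only: if_True if_False) blast
    next
      case 3
      have "t i \<notin> {m..n}" using tn[of i] by simp
      then show ?thesis unfolding proj using 3 bnd(1,3)[OF 3(2)] by (simp only: if_True if_False) blast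
    next
      case 4
      then show ?thesis unfolding proj using ij by (simp add: t_def)
    qed
  qed
  have "rectangle (S i)" for i
  proof (cases "real_block i")
    case True
    then show ?thesis unfolding S_def rectangle_def bbox_def using bnd(2,4)[OF True]
      by (simp only: if_True atLeastatMost_empty_iff2 atLeastatMost_empty_iff not_not) blast
  next
    case False
    then show ?thesis unfolding S_def rectangle_def by (simp only: if_False) blast
  qed
  moreover have "S i \<inter> L = {}" for i
  proof (cases "real_block i")
    case True
    then show ?thesis using L(1)[OF hP(1,2)[OF True]] by (simp add: S_def)
  next
    case False
    then show ?thesis using L(2)[OF tn[of i]] by (auto simp: S_def)
  qed
  moreover have "card ((\<lambda>p. (X p, Y p)) ` P - (\<Union>i<q. S i)) \<le> r"
  proof -
    have "(X p, Y p) \<in> (\<Union>i<q. S i)" if p: "p \<in> P" "p \<notin> R" for p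
    proof -
      obtain A where A: "A \<in> \<P>" "p \<in> A" using \<P>(3) p by blast
      have "A \<in> h ` {..<card \<P>}" using h A(1) by (simp add: bij_betw_def)
      then obtain i where i: "i < card \<P>" "h i = A" by auto
      have rb: "real_block i" using i A by (auto simp: real_block_def)
      have "(X p, Y p) \<in> S i" using rb A i hP(3)[OF rb] by (auto simp: S_def bbox_def)
      then show ?thesis using i(1) \<P>(2) by auto
    qed
    then have "(\<lambda>p. (X p, Y p)) ` P - (\<Union>i<q. S i) \<subseteq> (\<lambda>p. (X p, Y p)) ` R" by blast
    moreover have "finite R" using P(1) R(1) finite_subset by blast
    ultimately have "card ((\<lambda>p. (X p, Y p)) ` P - (\<Union>i<q. S i)) \<le> card R"
      by (meson card_image_le card_mono finite_imageI order_trans)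
    then show ?thesis using R(2) by simp
  qed
  ultimately show ?thesis using ind by (intro exI[of _ S]) (auto simp: independent_rects_def)
qed

lemma bbox_line:
  assumes "finite A" "A \<noteq> {}" "(\<forall>a\<in>A. X a < c) \<or> (\<forall>a\<in>A. c < X a)"
  shows "c \<notin> {Min (X ` A)..Max (X ` A) :: real}"
proof -
  have "Min (X ` A) \<in> X ` A" "Max (X ` A) \<in> X ` A" using assms(1,2) by simp_all
  then show ?thesis using assms(3) by fastforce
qed

theorem theorem5p7:
  shows "concentrated (cell_class xi)"
proof -
  obtain q r where all: "\<forall>(P::nat set) X Y c. generic P X Y \<longrightarrow> c \<notin> X ` P \<longrightarrow> cover q r P X Y c"
    using generic_cover by (elim exE)
  note qr = all[rule_format]
  have "qr_concentrated q r \<pi>" if \<pi>: "\<pi> \<in> cell_class xi" for \<pi>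
    unfolding qr_concentrated_def
  proof (intro allI impI)
    fix L assume L: "cutting_line \<pi> L"
    let ?P = "{..<length \<pi>}"
    have p: "\<pi> \<in> perms" using \<pi> by (simp add: cell_class_def)
    have inj: "inj_on col ?P" "inj_on (row \<pi>) ?P" "inj_on (\<lambda>i. - col i) ?P"
      using perms_nth_eq_iff[OF p] by (auto simp: inj_on_def)
    have gen: "generic ?P col (row \<pi>) \<or> generic ?P (\<lambda>i. - col i) (row \<pi>)"
      using \<pi> light_plot light_plot_skew inj by (auto simp: cell_class_def generic_def)
    have bound: "col i \<le> real (length \<pi>) \<and> row \<pi> i \<le> real (length \<pi>)" if "i \<in> ?P" for i
      using that perms_nth_bounds(2)[OF p, of i] by simp
    have plot: "plot \<pi> = (\<lambda>i. (col i, row \<pi> i)) ` ?P" by (auto simp: plot_def)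
    obtain c where "L = {c} \<times> UNIV \<or> L = UNIV \<times> {c}" using L by (auto simp: cutting_line_def axis_line_def)
    then show "\<exists>R :: nat \<Rightarrow> (real \<times> real) set. (\<forall>i<q. rectangle (R i) \<and> R i \<inter> L = {}) \<and>
        (\<forall>i<q. \<forall>j<q. i \<noteq> j \<longrightarrow> independent_rects (R i) (R j)) \<and>
        card (plot \<pi> - (\<Union>i<q. R i)) \<le> r"
    proof
      assume Lc: "L = {c} \<times> UNIV"
      have c: "c \<notin> col ` ?P" "c \<le> real (length \<pi>)"
      proof -
        have "(c, row \<pi> i) \<notin> plot \<pi>" for i using L by (auto simp: cutting_line_def Lc)
        then show "c \<notin> col ` ?P" unfolding plot by blast
        \<comment> \<open>This uses that the line meets the bounding square. It keeps the padding
          rectangles, placed beyond the top right corner, off the line.\<close>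
        show "c \<le> real (length \<pi>)" using L unfolding cutting_line_def Lc by (auto simp: cbox_Pair_eq)
      qed
      have "cover q r ?P col (row \<pi>) c"
        using gen
      proof
        assume "generic ?P col (row \<pi>)"
        from qr[OF this c(1)] show ?thesis .
      next
        assume "generic ?P (\<lambda>i. - col i) (row \<pi>)"
        moreover have "- c \<notin> (\<lambda>i. - col i) ` ?P" using c(1) by (auto simp del: of_nat_Suc)
        ultimately have "cover q r ?P (\<lambda>i. - col i) (row \<pi>) (- c)" by (rule qr)
        then show ?thesis by (rule cover_neg1)
      qed
      then obtain R \<P> where R: "R \<subseteq> ?P" "card R \<le> r" "finite \<P>" "card \<P> \<le> q" "\<Union>\<P> = ?P - R"
        "blocks col (row \<pi>) \<P>" and side: "\<forall>A\<in>\<P>. (\<forall>a\<in>A. col a < c) \<or> (\<forall>a\<in>A. c < col a)"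
        unfolding cover_def by (elim exE conjE) (rule that; assumption)
      show ?thesis unfolding plot
      proof (rule blocks_rectangles[OF _ inj(1,2) bound R])
        fix A assume A: "A \<in> \<P>" "A \<noteq> {}"
        then have "finite A" using R(5) by (metis Union_upper finite_Diff finite_lessThan finite_subset)
        then show "bbox col (row \<pi>) A \<inter> L = {}"
          using bbox_line[of A col c] A side by (auto simp: bbox_def Lc)
      qed (use c(2) in \<open>auto simp: Lc\<close>)
    next
      assume Lc: "L = UNIV \<times> {c}"
      have c: "c \<notin> row \<pi> ` ?P" "c \<le> real (length \<pi>)"
      proof -
        have "(col i, c) \<notin> plot \<pi>" for i using L by (auto simp: cutting_line_def Lc)
        then show "c \<notin> row \<pi> ` ?P" unfolding plot by blast
        show "c \<le> real (length \<pi>)" using L unfolding cutting_line_def Lc by (auto simp: cbox_Pair_eq)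
      qed
      \<comment> \<open>A horizontal line is a vertical one with the coordinates exchanged. In the
        skew case the negated columns thus become the second coordinate, and \<open>c\<close> keeps
        its sign.\<close>
      have "cover q r ?P (row \<pi>) col c"
        using gen
      proof
        assume "generic ?P col (row \<pi>)"
        from qr[OF generic_swap[OF this] c(1)] show ?thesis .
      next
        assume "generic ?P (\<lambda>i. - col i) (row \<pi>)"
        from qr[OF generic_swap[OF this] c(1)] show ?thesis by (rule cover_neg2)
      qed
      then obtain R \<P> where R: "R \<subseteq> ?P" "card R \<le> r" "finite \<P>" "card \<P> \<le> q" "\<Union>\<P> = ?P - R"
        "blocks (row \<pi>) col \<P>" and side: "\<forall>A\<in>\<P>. (\<forall>a\<in>A. row \<pi> a < c) \<or> (\<forall>a\<in>A. c < row \<pi> a)"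
        unfolding cover_def by (elim exE conjE) (rule that; assumption)
      have blk: "blocks col (row \<pi>) \<P>" using R(6) by (rule blocks_swap[THEN iffD1])
      show ?thesis unfolding plot
      proof (rule blocks_rectangles[OF _ inj(1,2) bound R(1-5) blk])
        fix A assume A: "A \<in> \<P>" "A \<noteq> {}"
        then have "finite A" using R(5) by (metis Union_upper finite_Diff finite_lessThan finite_subset)
        then show "bbox col (row \<pi>) A \<inter> L = {}"
          using bbox_line[of A "row \<pi>" c] A side by (auto simp: bbox_def Lc)
      qed (use c(2) in \<open>auto simp: Lc\<close>)
    qed
  qed
  then show ?thesis unfolding concentrated_def by blast
qed

end
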